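(* Let $Y$ be a random variable on $(0,\infty)$ with absolutely continuous distribution $\eta$ such that, for some $C_1>0$, $\frac{d\eta}{dx}\le C_1x^{-1}$ for all $x>0$, and such that $\log Y$ is integrable. Let $d_1,\dots,d_m\in\mathbb{R}$ and $\lambda_1,\dots,\lambda_m>0$, let $\mu$ be an ergodic $\sigma$-invariant probability measure on $\Sigma=\{1,\dots,m\}^{\mathbb{N}}$ with entropy $h(\mu)$, and let $$\chi(\mu,\eta)=\mathbb{E}[\log Y]+\int_\Sigma\log\lambda_{i_1}\,d\mu(\mathbf{i}).$$ Assume $\chi(\mu,\eta)<0$. Assume moreover that either (i) $d_i\neq d_j$ for all $i\ne j$, or (ii) $d_i=1$ for all $i$, and $\lambda_i\neq\lambda_j$ for all $i\neq j$. Let $\nu_{\mathbf{y}}=(\Pi_{\mathbf{y}})_*\mu$ be the measure on $\mathbb{R}$ defined in the context. Then: (a) If $h(\mu)>|\chi(\mu,\eta)|$, then $\nu_{\mathbf{y}}$ is absolutely continuous with respect to Lebesgue measure for $\eta_\infty$-a.e. $\mathbf{y}$. (b) If $h(\mu)\le|\chi(\mu,\eta)|$, then $\dim_H(\nu_{\mathbf{y}})=\dfrac{h(\mu)}{|\chi(\mu,\eta)|}$ for $\eta_\infty$-a.e. $\mathbf{y}$.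
   Context: $\sigma$ denotes the left shift on $\Sigma=\{1,\dots,m\}^{\mathbb{N}}$. The space of sequences $\mathbf{y}=(y_1,y_2,\dots)$ of positive reals (a subset of $\mathbb{R}^{\mathbb{N}}$) carries the product measure $\eta_\infty=\eta^{\mathbb{N}}$. For $\mathbf{i}=(i_1,i_2,\dots)\in\Sigma$ write $\lambda_{i_1\dots i_n}=\lambda_{i_1}\cdots\lambda_{i_n}$ and $y_{1\ldots n}=y_1\cdots y_n$. The natural projection is $$\Pi(\mathbf{i},\mathbf{y})=d_{i_1}+\sum_{n=1}^\infty d_{i_{n+1}}\lambda_{i_1\dots i_n}\,y_{1\ldots n},$$ which converges for $\mu\times\eta_\infty$-a.e. $(\mathbf{i},\mathbf{y})$ because $\chi(\mu,\eta)<0$. For fixed $\mathbf{y}$, $\Pi_{\mathbf{y}}(\mathbf{i})=\Pi(\mathbf{i},\mathbf{y})$, and $\nu_{\mathbf{y}}=(\Pi_{\mathbf{y}})_*\mu$ is the push-forward of $\mu$ (defined for $\eta_\infty$-a.e. $\mathbf{y}$); it is the conditional distribution of $\Pi$ given $\mathbf{y}$ under $\mu\times\eta_\infty$. For a Borel measure $\nu$ on $\mathbb{R}$, $\dim_H(\nu)=\inf\{\dim_H(A): A\subset\mathbb{R},\ \nu(\mathbb{R}\setminus A)=0\}$, where $\dim_H(A)$ is Hausdorff dimension. *)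

theory Defs
  imports "HOL-Probability.Probability"
begin

section \<open>Hausdorff dimension\<close>

text \<open>The term \<open>(diam U) ^ s\<close> of the Hausdorff sums, with \<open>0 ^ 0 = 1\<close> for nonempty \<open>U\<close>
  (whereas \<open>0 powr 0 = 0\<close> in the library) and with the empty set contributing nothing.\<close>

definition diam_power :: "real \<Rightarrow> 'a::metric_space set \<Rightarrow> real" where
  "diam_power s U = (if U = {} then 0 else if s = 0 then 1 else diameter U powr s)"

text \<open>Boundedness is required explicitly because \<open>diameter\<close> is unspecified on unbounded sets.
  Finite covers are included by padding with empty sets.\<close>

definition hausdorff_content :: "real \<Rightarrow> real \<Rightarrow> 'a::metric_space set \<Rightarrow> ennreal" where
  "hausdorff_content \<delta> s A =
     (INF U\<in>{U :: nat \<Rightarrow> 'a set. A \<subseteq> (\<Union>n. U n) \<and> (\<forall>n. bounded (U n) \<and> diameter (U n) \<le> \<delta>)}.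
        \<Sum>n. ennreal (diam_power s (U n)))"

definition hausdorff_measure :: "real \<Rightarrow> 'a::metric_space set \<Rightarrow> ennreal" where
  "hausdorff_measure s A = (SUP \<delta>\<in>{0<..}. hausdorff_content \<delta> s A)"

definition hausdorff_dim :: "'a::metric_space set \<Rightarrow> ereal" where
  "hausdorff_dim A = (INF s\<in>{s. 0 \<le> s \<and> hausdorff_measure s A = 0}. ereal s)"

text \<open>\<open>A\<close> ranges over arbitrary sets; \<open>AE x in \<nu>. x \<in> A\<close> says that the complement of \<open>A\<close> is
  contained in a \<open>\<nu>\<close>-null set. (\<open>emeasure \<nu> (- A) = 0\<close> would hold for every nonmeasurable \<open>A\<close>.)\<close>

definition measure_hausdorff_dim :: "'a::metric_space measure \<Rightarrow> ereal" where
  "measure_hausdorff_dim \<nu> = (INF A\<in>{A. AE x in \<nu>. x \<in> A}. hausdorff_dim A)"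


section \<open>Ergodic measures and Kolmogorov-Sinai entropy\<close>

definition measure_invariant :: "'a measure \<Rightarrow> ('a \<Rightarrow> 'a) \<Rightarrow> bool" where
  "measure_invariant M T \<longleftrightarrow> T \<in> measurable M M \<and> distr M M T = M"

definition ergodic :: "'a measure \<Rightarrow> ('a \<Rightarrow> 'a) \<Rightarrow> bool" where
  "ergodic M T \<longleftrightarrow> measure_invariant M T \<and>
     (\<forall>A\<in>sets M. T -` A \<inter> space M = A \<longrightarrow> emeasure M A = 0 \<or> emeasure M (space M - A) = 0)"

definition partition_entropy :: "'a measure \<Rightarrow> 'a set set \<Rightarrow> real" where
  "partition_entropy M P = - (\<Sum>A\<in>P. measure M A * ln (measure M A))"

text \<open>The join of \<open>P, T\<^sup>-\<^sup>1 P, \<dots>, T\<^sup>-\<^sup>(\<^sup>n\<^sup>-\<^sup>1\<^sup>) P\<close>, indexed by itineraries. It may contain the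
  empty set, which contributes \<open>0 * ln 0 = 0\<close> to the entropy.\<close>

definition iterated_join :: "'a measure \<Rightarrow> ('a \<Rightarrow> 'a) \<Rightarrow> 'a set set \<Rightarrow> nat \<Rightarrow> 'a set set" where
  "iterated_join M T P n =
     (\<lambda>F. {x \<in> space M. \<forall>k<n. (T ^^ k) x \<in> F k}) ` (\<Pi>\<^sub>E k\<in>{..<n}. P)"

definition entropy_wrt_partition :: "'a measure \<Rightarrow> ('a \<Rightarrow> 'a) \<Rightarrow> 'a set set \<Rightarrow> real" where
  "entropy_wrt_partition M T P = lim (\<lambda>n. partition_entropy M (iterated_join M T P n) / real n)"

definition ks_entropy :: "'a measure \<Rightarrow> ('a \<Rightarrow> 'a) \<Rightarrow> ereal" where
  "ks_entropy M T =
     (SUP P\<in>{P. finite P \<and> P \<subseteq> sets M \<and> partition_on (space M) P}.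
        ereal (entropy_wrt_partition M T P))"


section \<open>The symbolic space and the random natural projection\<close>

text \<open>All sequences are indexed from \<open>0\<close>: the symbol \<open>i\<^sub>n\<close> is \<open>i (n - 1)\<close>, and \<open>y\<^sub>n\<close> is \<open>y (n - 1)\<close>.\<close>

definition symbolic_space :: "nat \<Rightarrow> (nat \<Rightarrow> nat) measure" where
  "symbolic_space m = (\<Pi>\<^sub>M n\<in>UNIV. count_space {1..m})"

definition shift :: "(nat \<Rightarrow> 'a) \<Rightarrow> nat \<Rightarrow> 'a" where
  "shift i = (\<lambda>n. i (Suc n))"

text \<open>The summand with index \<open>n\<close> is \<open>d\<close> at \<open>i\<^bsub>n+2\<^esub>\<close> times
  \<open>\<lambda>\<close> at \<open>i\<^sub>1 \<dots> i\<^bsub>n+1\<^esub>\<close> times \<open>y\<^sub>1 \<dots> y\<^bsub>n+1\<^esub>\<close>.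
  Where the series diverges the value is arbitrary.\<close>

definition natural_projection ::
    "(nat \<Rightarrow> real) \<Rightarrow> (nat \<Rightarrow> real) \<Rightarrow> (nat \<Rightarrow> nat) \<Rightarrow> (nat \<Rightarrow> real) \<Rightarrow> real" where
  "natural_projection d lam i y =
     d (i 0) + (\<Sum>n. d (i (Suc n)) * (\<Prod>k\<le>n. lam (i k)) * (\<Prod>k\<le>n. y k))"

definition projected_measure ::
    "(nat \<Rightarrow> real) \<Rightarrow> (nat \<Rightarrow> real) \<Rightarrow> (nat \<Rightarrow> nat) measure \<Rightarrow> (nat \<Rightarrow> real) \<Rightarrow> real measure" where
  "projected_measure d lam \<mu> y = distr \<mu> borel (\<lambda>i. natural_projection d lam i y)"

text \<open>The push-forward is along a measurable map, for every \<open>y\<close>.\<close>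

lemma natural_projection_measurable:
  assumes "sets \<mu> = sets (symbolic_space m)"
  shows "(\<lambda>i. natural_projection d lam i y) \<in> borel_measurable \<mu>"
proof -
  have [measurable]: "(\<lambda>i. g (i n)) \<in> borel_measurable (symbolic_space m)"
    for g :: "nat \<Rightarrow> real" and n
    unfolding symbolic_space_def
    by (rule measurable_compose[OF measurable_component_singleton]) auto
  have "(\<lambda>i. natural_projection d lam i y) \<in> borel_measurable (symbolic_space m)"
    unfolding natural_projection_def by measurable
  then show ?thesis
    using measurable_cong_sets[OF assms refl] by blast
qed

definition lyapunov_exponent ::
    "'w measure \<Rightarrow> ('w \<Rightarrow> real) \<Rightarrow> (nat \<Rightarrow> real) \<Rightarrow> (nat \<Rightarrow> nat) measure \<Rightarrow> real" where
  "lyapunov_exponent \<Omega> Y lam \<mu> =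
     (\<integral>\<omega>. ln (Y \<omega>) \<partial>\<Omega>) + (\<integral>i. ln (lam (i 0)) \<partial>\<mu>)"

end

theory Submission
  imports Defs "HOL-Real_Asymp.Real_Asymp"
begin

text \<open>
  The dimension of \<open>\<nu>\<^sub>y\<close> compares two exponential rates. A typical cylinder of length \<open>n\<close> has
  \<open>\<mu>\<close>-measure about \<open>exp (- n h)\<close>, and \<open>\<Pi>\<^sub>y\<close> maps it to a set of diameter about \<open>exp (n \<chi>)\<close>.
  The first rate is the Shannon-McMillan-Breiman theorem (\<open>word_prob_eventually_ge\<close>,
  \<open>word_prob_eventually_le\<close>), the second one is Birkhoff's theorem (\<open>birkhoff_upper\<close>,
  \<open>birkhoff_lower\<close>), applied to \<open>\<mu>\<close> and to the Bernoulli shift \<open>\<eta>\<^sup>\<nat>\<close>. Covering by the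
  images of the likely cylinders gives \<open>dim \<nu>\<^sub>y \<le> h / \<bar>\<chi>\<bar>\<close> for almost every \<open>y\<close>.

  The opposite inequality can fail only if the images of many cylinders overlap, and the random
  factors prevent this on average. Let \<open>i\<close> and \<open>j\<close> first differ after \<open>n\<close> letters. Up to the common
  factor, which is about \<open>exp (n \<chi>)\<close>, the difference of their projections is \<open>D + y\<^sub>k Z\<close> for a
  single coordinate \<open>y\<^sub>k\<close>, where \<open>Z\<close> does not involve \<open>y\<^sub>k\<close> and the nonzero \<open>D\<close> is a difference of
  two translations or of two contractions (\<open>projection_diff_affine\<close>). Since the density of \<open>\<eta>\<close> is
  at most \<open>C1 / x\<close>, which is the density of a scale-invariant measure, the probability of
  \<open>\<bar>D + y\<^sub>k Z\<bar> < \<rho>\<close> is at most a constant times \<open>\<rho>\<close>, uniformly in \<open>Z\<close>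
  (\<open>emeasure_affine_small\<close>). Summing over \<open>n\<close> yields \<open>energy_estimate\<close>: for \<open>s \<le> 1\<close> with
  \<open>s \<bar>\<chi>\<bar> < h\<close>, and after restriction to sets of measure close to \<open>1\<close>, the pairs of points with
  projections closer than \<open>r\<close> have measure \<open>O(r\<^sup>s)\<close> on average over \<open>y\<close>. If \<open>s < 1\<close>, the mass
  distribution principle turns this into a lower bound for the dimension. If \<open>s = 1\<close> is possible,
  that is \<open>h > \<bar>\<chi>\<bar>\<close>, it bounds the \<open>L\<^sup>2\<close> norms of mollified densities of \<open>\<nu>\<^sub>y\<close> at infinitely many
  scales, which implies absolute continuity (\<open>absolutely_continuous_of_energy\<close>).

  The entropy results all rest on Gibbs' inequality (\<open>block_entropy_le\<close>): the entropy of a finite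
  distribution is at most the mean cost of coding it with any other subprobability. Coding with a
  Markov approximation, with a greedy parsing into likely blocks, and with a noisy observation of
  another labelling gives the two halves of the Shannon-McMillan-Breiman theorem and the
  Kolmogorov-Sinai theorem (\<open>ks_entropy_generator\<close>), which identifies the supremum over
  partitions with the entropy rate of the letters.
\<close>

section \<open>Birkhoff averages\<close>

locale measure_preserving_system = prob_space M for M :: "'a measure" +
  fixes T :: "'a \<Rightarrow> 'a"
  assumes invariant: "measure_invariant M T"
begin

lemma T_measurable [measurable]: "T \<in> measurable M M"
  using invariant by (simp add: measure_invariant_def)

lemma funpow_measurable [measurable]: "(T ^^ k) \<in> measurable M M"
  by (rule measurable_compose_n) simp

lemma distr_funpow: "distr M M (T ^^ k) = M"
proof (induction k)
  case 0
  then show ?case by (simp add: id_def distr_id)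
next
  case (Suc k)
  have "distr M M (T ^^ Suc k) = distr (distr M M (T ^^ k)) M T"
    by (subst distr_distr) (simp_all add: o_def)
  also have "\<dots> = M" using invariant by (simp add: Suc measure_invariant_def)
  finally show ?case .
qed

lemma
  fixes f :: "'a \<Rightarrow> real"
  assumes "integrable M f"
  shows integrable_funpow: "integrable M (\<lambda>x. f ((T ^^ k) x))"
    and integral_funpow: "(\<integral>x. f ((T ^^ k) x) \<partial>M) = (\<integral>x. f x \<partial>M)"
proof -
  have [measurable]: "f \<in> borel_measurable M" using assms by simp
  show "integrable M (\<lambda>x. f ((T ^^ k) x))"
    by (rule integrable_distr[of "T ^^ k" M M]) (auto simp: distr_funpow assms)
  have "(\<integral>x. f x \<partial>M) = (\<integral>x. f x \<partial>distr M M (T ^^ k))" by (simp add: distr_funpow)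
  also have "\<dots> = (\<integral>x. f ((T ^^ k) x) \<partial>M)" by (rule integral_distr) auto
  finally show "(\<integral>x. f ((T ^^ k) x) \<partial>M) = (\<integral>x. f x \<partial>M)" ..
qed

lemma measure_vimage_funpow:
  assumes "A \<in> sets M"
  shows "measure M ((T ^^ k) -` A \<inter> space M) = measure M A"
  using measure_distr[OF funpow_measurable assms, of k] by (simp add: distr_funpow)

lemma AE_funpow:
  assumes "AE x in M. P x"
  shows "AE x in M. \<forall>k. P ((T ^^ k) x)"
proof -
  have "AE x in M. P ((T ^^ k) x)" for k
  proof (rule AE_distrD[OF funpow_measurable])
    show "AE x in distr M M (T ^^ k). P x" by (subst distr_funpow) (rule assms)
  qed
  then show ?thesis by (simp add: AE_all_countable)
qed

definition birkhoff_sum :: "('a \<Rightarrow> real) \<Rightarrow> nat \<Rightarrow> 'a \<Rightarrow> real" where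
  "birkhoff_sum f n x = (\<Sum>k<n. f ((T ^^ k) x))"

lemma birkhoff_sum_Suc: "birkhoff_sum f (Suc n) x = f x + birkhoff_sum f n (T x)"
  unfolding birkhoff_sum_def by (subst sum.lessThan_Suc_shift) (simp add: funpow_swap1)

text \<open>The largest of the Birkhoff sums of lengths \<open>0, \<dots>, n\<close>; the recursion is the only
  property that the maximal inequality uses.\<close>

primrec running_max :: "('a \<Rightarrow> real) \<Rightarrow> nat \<Rightarrow> 'a \<Rightarrow> real" where
  "running_max f 0 x = 0"
| "running_max f (Suc n) x = max 0 (f x + running_max f n (T x))"

lemma running_max_nonneg: "0 \<le> running_max f n x"
  by (cases n) auto

lemma running_max_mono_Suc: "running_max f n x \<le> running_max f (Suc n) x"
proof (induction n arbitrary: x)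
  case (Suc n)
  from Suc[of "T x"] show ?case by auto
qed simp

lemma running_max_mono: "m \<le> n \<Longrightarrow> running_max f m x \<le> running_max f n x"
  by (rule lift_Suc_mono_le[of "\<lambda>n. running_max f n x"]) (rule running_max_mono_Suc)

lemma birkhoff_sum_le_running_max: "birkhoff_sum f n x \<le> running_max f n x"
proof (induction n arbitrary: x)
  case (Suc n)
  from Suc[of "T x"] show ?case by (simp add: birkhoff_sum_Suc)
qed (simp add: birkhoff_sum_def)

lemma running_max_integrable:
  assumes "integrable M f" shows "integrable M (running_max f n)"
proof (induction n)
  case (Suc n)
  have "integrable M (\<lambda>x. max 0 (f x + running_max f n (T x)))"
    using integrable_funpow[OF Suc, of 1] assms by (intro integrable_max Bochner_Integration.integrable_add) auto
  then show ?case by (simp add: running_max.simps(2)[abs_def])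
qed (simp add: running_max.simps(1)[abs_def])

text \<open>Garsia's argument: where the running maximum is positive, \<open>f\<close> is the difference between
  that maximum and its predecessor at the next point, and invariance makes the integral of this
  difference nonnegative.\<close>

lemma maximal_inequality:
  assumes f: "integrable M f"
  shows "0 \<le> (\<integral>x. f x * indicator {x \<in> space M. 0 < running_max f (Suc n) x} x \<partial>M)"
proof -
  have i: "integrable M (running_max f k)" for k by (rule running_max_integrable[OF f])
  note [measurable] = borel_measurable_integrable[OF f] borel_measurable_integrable[OF i]
  have iT: "integrable M (\<lambda>x. running_max f n (T x))"
    and eqT: "(\<integral>x. running_max f n (T x) \<partial>M) = (\<integral>x. running_max f n x \<partial>M)"
    using integrable_funpow[where k=1, OF i[of n]] integral_funpow[where k=1, OF i[of n]] by simp_all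
  have "0 \<le> (\<integral>x. running_max f (Suc n) x \<partial>M) - (\<integral>x. running_max f n (T x) \<partial>M)"
    unfolding eqT using integral_mono[OF i i running_max_mono_Suc, of n] by simp
  also have "\<dots> = (\<integral>x. running_max f (Suc n) x - running_max f n (T x) \<partial>M)"
    by (rule Bochner_Integration.integral_diff[symmetric]) (fact i iT)+
  also have "\<dots> \<le> (\<integral>x. f x * indicator {x \<in> space M. 0 < running_max f (Suc n) x} x \<partial>M)"
  proof (rule integral_mono)
    show "integrable M (\<lambda>x. running_max f (Suc n) x - running_max f n (T x))"
      by (rule Bochner_Integration.integrable_diff) (fact i iT)+
    have "{x \<in> space M. 0 < running_max f (Suc n) x} \<in> sets M" by measurable
    then show "integrable M (\<lambda>x. f x * indicator {x \<in> space M. 0 < running_max f (Suc n) x} x)"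
      by (rule integrable_real_mult_indicator[OF _ f])
    show "running_max f (Suc n) x - running_max f n (T x)
        \<le> f x * indicator {x \<in> space M. 0 < running_max f (Suc n) x} x" if "x \<in> space M" for x
      using that running_max_nonneg[of f n "T x"] by (auto simp: indicator_def max_def)
  qed
  finally show ?thesis .
qed

end

locale ergodic_system = measure_preserving_system +
  assumes ergodic: "ergodic M T"
begin

lemma AE_invariant_cases:
  assumes P [measurable]: "Measurable.pred M P" and inv: "\<And>x. x \<in> space M \<Longrightarrow> P (T x) \<longleftrightarrow> P x"
  shows "(AE x in M. P x) \<or> (AE x in M. \<not> P x)"
proof -
  let ?A = "{x \<in> space M. P x}"
  have "?A \<in> sets M" by measurable
  moreover have "T -` ?A \<inter> space M = ?A"
    using inv measurable_space[OF T_measurable] by auto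
  ultimately have "emeasure M ?A = 0 \<or> emeasure M (space M - ?A) = 0"
    using ergodic by (simp add: ergodic_def)
  moreover have "space M - ?A = {x \<in> space M. \<not> P x}" by auto
  ultimately show ?thesis
    by (auto simp: AE_iff_measurable[OF _ refl])
qed

text \<open>For a forward invariant event the events \<open>P ((T ^^ k) x)\<close> increase with \<open>k\<close> and all have the same
  measure, so up to a null set each of them is their invariant union.\<close>

lemma AE_forward_invariant_cases:
  assumes P [measurable]: "Measurable.pred M P" and inv: "\<And>x. x \<in> space M \<Longrightarrow> P x \<Longrightarrow> P (T x)"
  shows "(AE x in M. P x) \<or> (AE x in M. \<not> P x)"
proof -
  have Tk: "(T ^^ k) x \<in> space M" if "x \<in> space M" for x k
    using measurable_space[OF funpow_measurable that] .
  have mono: "P ((T ^^ j) x)" if "P ((T ^^ k) x)" "k \<le> j" "x \<in> space M" for x k j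
    using that(2,1) by (induction j rule: dec_induct) (auto intro: inv Tk[OF that(3)])
  let ?A = "\<lambda>k. {x \<in> space M. P ((T ^^ k) x)}"
  have m: "measure M (?A k) = measure M (?A 0)" for k
  proof -
    have "(T ^^ k) -` ?A 0 \<inter> space M = ?A k" by (auto simp: Tk simp del: funpow.simps)
    then show ?thesis using measure_vimage_funpow[of "?A 0" k] by simp
  qed
  have ev: "(AE x in M. \<exists>k. P ((T ^^ k) x)) \<or> (AE x in M. \<not> (\<exists>k. P ((T ^^ k) x)))"
  proof (rule AE_invariant_cases)
    fix x assume x: "x \<in> space M"
    show "(\<exists>k. P ((T ^^ k) (T x))) \<longleftrightarrow> (\<exists>k. P ((T ^^ k) x))"
    proof
      assume "\<exists>k. P ((T ^^ k) (T x))"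
      then obtain k where "P ((T ^^ Suc k) x)" by (auto simp: funpow_swap1)
      then show "\<exists>k. P ((T ^^ k) x)" by blast
    next
      assume "\<exists>k. P ((T ^^ k) x)"
      then obtain k where "P ((T ^^ k) x)" ..
      then have "P ((T ^^ Suc k) x)" using mono[of k x "Suc k"] x by auto
      then show "\<exists>k. P ((T ^^ k) (T x))" by (auto simp: funpow_swap1)
    qed
  qed measurable
  then show ?thesis
  proof
    assume "AE x in M. \<not> (\<exists>k. P ((T ^^ k) x))"
    then have "AE x in M. \<not> P x"
    proof eventually_elim
      case (elim x)
      then have "\<not> P ((T ^^ 0) x)" by blast
      then show ?case by simp
    qed
    then show ?thesis ..
  next
    assume "AE x in M. \<exists>k. P ((T ^^ k) x)"
    then have "measure M {x \<in> space M. \<exists>k. P ((T ^^ k) x)} = 1"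
      by (subst prob_Collect_eq_1) auto
    also have "{x \<in> space M. \<exists>k. P ((T ^^ k) x)} = (\<Union>k. ?A k)" by auto
    finally have "measure M (\<Union>k. ?A k) = 1" .
    moreover have "(\<lambda>k. measure M (?A k)) \<longlonglongrightarrow> measure M (\<Union>k. ?A k)"
    proof (rule finite_Lim_measure_incseq)
      show "incseq ?A" using mono[of k _ "Suc k" for k] by (auto intro!: incseq_SucI)
    qed auto
    ultimately have "measure M (?A 0) = 1" using m by (simp add: LIMSEQ_const_iff)
    then have "AE x in M. P x" by (subst prob_Collect_eq_1[symmetric]) auto
    then show ?thesis ..
  qed
qed

text \<open>If the running maxima were unbounded almost surely, they would eventually be positive, and
  the maximal inequality would give a nonnegative integral in the limit.\<close>

lemma running_max_bounded:
  assumes f: "integrable M f" and neg: "(\<integral>x. f x \<partial>M) < 0"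
  shows "AE x in M. \<exists>B. \<forall>n. birkhoff_sum f n x \<le> B"
proof -
  have i: "integrable M (running_max f k)" for k by (rule running_max_integrable[OF f])
  note [measurable] = borel_measurable_integrable[OF f] borel_measurable_integrable[OF i]
  let ?P = "\<lambda>x. \<forall>B::nat. \<exists>n. real B < running_max f n x"
  have "(AE x in M. ?P x) \<or> (AE x in M. \<not> ?P x)"
  proof (rule AE_invariant_cases)
    fix x assume "x \<in> space M"
    show "?P (T x) \<longleftrightarrow> ?P x"
    proof
      assume P: "?P (T x)"
      show "?P x"
      proof
        fix B :: nat
        obtain B' :: nat where "real B - f x \<le> B'" using real_arch_simple by blast
        moreover obtain n where "real B' < running_max f n (T x)" using P by blast
        ultimately have "real B < running_max f (Suc n) x" by simp
        then show "\<exists>n. real B < running_max f n x" by blast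
      qed
    next
      assume P: "?P x"
      show "?P (T x)"
      proof
        fix B :: nat
        obtain B' :: nat where B': "real B + f x \<le> B'" using real_arch_simple by blast
        obtain n where n: "real B' < running_max f n x" using P by blast
        then obtain k where "n = Suc k" by (cases n) auto
        then have "real B < running_max f k (T x)" using n B' by (auto simp: less_max_iff_disj)
        then show "\<exists>n. real B < running_max f n (T x)" by blast
      qed
    qed
  qed measurable
  moreover have "\<not> (AE x in M. ?P x)"
  proof
    assume P: "AE x in M. ?P x"
    let ?g = "\<lambda>n x. f x * indicator {x \<in> space M. 0 < running_max f (Suc n) x} x"
    have "(\<lambda>n. \<integral>x. ?g n x \<partial>M) \<longlonglongrightarrow> (\<integral>x. f x \<partial>M)"
    proof (rule integral_dominated_convergence[where w="\<lambda>x. \<bar>f x\<bar>"])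
      show "AE x in M. (\<lambda>n. ?g n x) \<longlonglongrightarrow> f x"
        using P AE_space
      proof eventually_elim
        case (elim x)
        then obtain n where "0 < running_max f n x" by (metis of_nat_0)
        then have "0 < running_max f (Suc k) x" if "n \<le> k" for k
          using running_max_mono[of n "Suc k" f x] that by linarith
        then have "\<forall>\<^sub>F k in sequentially. ?g k x = f x"
          using elim by (auto simp: eventually_sequentially intro!: exI[of _ n])
        then show ?case by (rule tendsto_eventually)
      qed
    qed (use f in \<open>auto simp: indicator_def\<close>)
    then have "0 \<le> (\<integral>x. f x \<partial>M)"
      by (rule LIMSEQ_le_const) (use maximal_inequality[OF f] in blast)
    then show False using neg by simp
  qed
  ultimately have "AE x in M. \<not> ?P x" by blast
  then show ?thesis
  proof eventually_elim
    case (elim x)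
    then obtain B :: nat where "running_max f n x \<le> B" for n by (auto simp: not_less)
    then show ?case using birkhoff_sum_le_running_max order_trans by blast
  qed
qed

theorem birkhoff_upper:
  fixes c :: real
  assumes f: "integrable M f" and c: "(\<integral>x. f x \<partial>M) < c"
  shows "AE x in M. \<forall>\<^sub>F n in sequentially. birkhoff_sum f n x < c * n"
proof -
  obtain c' where c': "(\<integral>x. f x \<partial>M) < c'" "c' < c" using c dense by blast
  have "AE x in M. \<exists>B. \<forall>n. birkhoff_sum (\<lambda>x. f x - c') n x \<le> B"
    by (rule running_max_bounded) (use f c' in \<open>auto simp: prob_space\<close>)
  then show ?thesis
  proof eventually_elim
    case (elim x)
    then obtain B where B: "birkhoff_sum f n x \<le> B + c' * n" for n
      by (force simp: birkhoff_sum_def sum_subtractf algebra_simps)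
    have "\<forall>\<^sub>F n in sequentially. B / (c - c') < real n"
      using filterlim_real_sequentially by (auto simp: filterlim_at_top_dense)
    then show ?case
    proof eventually_elim
      case (elim n)
      then have "B < (c - c') * n" using c' by (simp add: field_simps)
      then show ?case using B[of n] by (simp add: algebra_simps)
    qed
  qed
qed

theorem birkhoff_lower:
  fixes c :: real
  assumes f: "integrable M f" and c: "c < (\<integral>x. f x \<partial>M)"
  shows "AE x in M. \<forall>\<^sub>F n in sequentially. c * n < birkhoff_sum f n x"
  using birkhoff_upper[of "\<lambda>x. - f x" "- c"] f c by (simp add: birkhoff_sum_def sum_negf)

lemma
  fixes g :: "'a \<Rightarrow> real" and c :: real
  assumes ln: "integrable M (\<lambda>x. ln (g x))" and pos: "AE x in M. 0 < g x"
  shows prod_eventually_less: "(\<integral>x. ln (g x) \<partial>M) < c \<Longrightarrow>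
      AE x in M. \<forall>\<^sub>F n in sequentially. (\<Prod>k<n. g ((T ^^ k) x)) < exp (c * n)"
    and prod_eventually_greater: "c < (\<integral>x. ln (g x) \<partial>M) \<Longrightarrow>
      AE x in M. \<forall>\<^sub>F n in sequentially. exp (c * n) < (\<Prod>k<n. g ((T ^^ k) x))"
proof -
  have eq: "AE x in M. \<forall>n. (\<Prod>k<n. g ((T ^^ k) x)) = exp (birkhoff_sum (\<lambda>x. ln (g x)) n x)"
    using AE_funpow[OF pos]
  proof eventually_elim
    case (elim x)
    then show ?case by (simp add: birkhoff_sum_def exp_sum)
  qed
  show "AE x in M. \<forall>\<^sub>F n in sequentially. (\<Prod>k<n. g ((T ^^ k) x)) < exp (c * n)"
    if "(\<integral>x. ln (g x) \<partial>M) < c"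
    using birkhoff_upper[OF ln that] eq by eventually_elim simp
  show "AE x in M. \<forall>\<^sub>F n in sequentially. exp (c * n) < (\<Prod>k<n. g ((T ^^ k) x))"
    if "c < (\<integral>x. ln (g x) \<partial>M)"
    using birkhoff_lower[OF ln that] eq by eventually_elim simp
qed

end

section \<open>Entropy of a finite labelling\<close>

text \<open>Fekete's lemma; nonnegativity keeps the limit finite.\<close>

lemma subadditive_convergent:
  fixes a :: "nat \<Rightarrow> real"
  assumes sub: "\<And>m n. a (m + n) \<le> a m + a n" and nonneg: "\<And>n. 0 \<le> a n"
  shows "convergent (\<lambda>n. a n / n)"
proof -
  define L where "L = (INF n\<in>{1..}. a n / real n)"
  have bdd: "bdd_below ((\<lambda>n. a n / real n) ` {1..})"
    by (rule bdd_belowI[of _ 0]) (auto simp: nonneg)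
  have mult: "a (q * k) \<le> q * a k" if "q \<ge> 1" for q k :: nat
    using that
  proof (induction q rule: dec_induct)
    case (step q)
    then show ?case using sub[of k "q * k"] by (simp add: algebra_simps)
  qed simp
  have "(\<lambda>n. a n / n) \<longlonglongrightarrow> L"
  proof (rule LIMSEQ_I)
    fix e :: real assume e: "0 < e"
    have "L < L + e / 2" using e by simp
    then obtain k :: nat where k: "k \<ge> 1" "a k / k < L + e / 2"
      unfolding L_def by (subst (asm) cINF_less_iff[OF _ bdd]) auto
    define B where "B = a 0 + (\<Sum>r<k. a r)"
    have Bn: "a n \<le> n * (a k / k) + B" for n
    proof -
      have "a (n mod k) \<le> (\<Sum>r<k. a r)"
        using k by (intro member_le_sum) (auto simp: nonneg)
      moreover have "a (n div k * k) \<le> (n div k) * a k + a 0"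
        using mult[of "n div k" k] nonneg[of 0] by (cases "n div k = 0") auto
      moreover have "a n \<le> a (n div k * k) + a (n mod k)"
        using sub[of "n div k * k" "n mod k"] by simp
      moreover have "real (n div k) * a k \<le> n * (a k / k)"
        using mult_right_mono[OF of_nat_div_le_of_nat[of n k] nonneg[of k]] by simp
      ultimately have "a n \<le> n * (a k / k) + a 0 + (\<Sum>r<k. a r)" by linarith
      then show ?thesis by (simp add: B_def)
    qed
    obtain N :: nat where N: "2 * B / e < N" using reals_Archimedean2 by blast
    show "\<exists>no. \<forall>n\<ge>no. norm (a n / n - L) < e"
    proof (intro exI allI impI)
      fix n assume n: "max 1 N \<le> n"
      have "2 * B / e < n" using N n by linarith
      then have "B / n < e / 2" using e n by (simp add: field_simps)
      moreover have "a n / n \<le> a k / k + B / n" using Bn[of n] n by (simp add: field_simps)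
      moreover have "L \<le> a n / n" unfolding L_def by (rule cINF_lower[OF bdd]) (use n in auto)
      ultimately show "norm (a n / n - L) < e"
        using k unfolding real_norm_def by linarith
    qed
  qed
  then show ?thesis by (rule convergentI)
qed

locale labelled_system = measure_preserving_system +
  fixes c :: "'a \<Rightarrow> 'b" and C :: "'b set"
  assumes finite_labels: "finite C" and label_measurable: "c \<in> measurable M (count_space C)"
begin

primrec itinerary :: "nat \<Rightarrow> 'a \<Rightarrow> 'b list" where
  "itinerary 0 x = []"
| "itinerary (Suc n) x = c x # itinerary n (T x)"

definition words :: "nat \<Rightarrow> 'b list set" where
  "words n = {w. set w \<subseteq> C \<and> length w = n}"

definition word_prob :: "'b list \<Rightarrow> real" where
  "word_prob w = measure M {x \<in> space M. itinerary (length w) x = w}"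

definition block_entropy :: "nat \<Rightarrow> real" where
  "block_entropy n = (\<Sum>w\<in>words n. word_prob w * - ln (word_prob w))"

definition entropy_rate :: real where
  "entropy_rate = lim (\<lambda>n. block_entropy n / n)"

lemma T_space: "x \<in> space M \<Longrightarrow> T x \<in> space M"
  using measurable_space[OF T_measurable] .

lemma label_in: "x \<in> space M \<Longrightarrow> c x \<in> C"
  using measurable_space[OF label_measurable] by simp

lemma labels_pos: "0 < card C"
  using not_empty label_in finite_labels by (auto simp: card_gt_0_iff)

lemma length_itinerary [simp]: "length (itinerary n x) = n"
  by (induction n arbitrary: x) auto

lemma itinerary_add: "itinerary (m + n) x = itinerary m x @ itinerary n ((T ^^ m) x)"
  by (induction m arbitrary: x) (auto simp: funpow_swap1)

lemma take_itinerary: "k \<le> n \<Longrightarrow> take k (itinerary n x) = itinerary k x"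
  using itinerary_add[of k "n - k" x] by simp

lemma drop_itinerary: "k \<le> n \<Longrightarrow> drop k (itinerary n x) = itinerary (n - k) ((T ^^ k) x)"
  using itinerary_add[of k "n - k" x] by simp

lemma nth_itinerary: "k < n \<Longrightarrow> itinerary n x ! k = c ((T ^^ k) x)"
  by (induction n arbitrary: x k) (auto simp: nth_Cons funpow_swap1 split: nat.split)

lemma itinerary_in_words: "x \<in> space M \<Longrightarrow> itinerary n x \<in> words n"
  by (induction n arbitrary: x) (auto simp: words_def label_in T_space)

lemma words_0: "words 0 = {[]}"
  by (auto simp: words_def)

lemma finite_words: "finite (words n)"
  unfolding words_def by (rule finite_lists_length_eq[OF finite_labels])

lemma sum_words_Suc: "(\<Sum>w\<in>words (Suc n). g w) = (\<Sum>v\<in>words n. \<Sum>a\<in>C. g (a # v))"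
proof -
  have "(\<Sum>w\<in>words (Suc n). g w) = (\<Sum>(v, a)\<in>words n \<times> C. g (a # v))"
    by (rule sum.reindex_bij_witness[where i="\<lambda>(v, a). a # v" and j="\<lambda>w. (tl w, hd w)"])
       (auto simp: words_def length_Suc_conv)
  then show ?thesis by (simp add: sum.cartesian_product)
qed

lemma sum_words_add: "(\<Sum>w\<in>words (m + n). g w) = (\<Sum>u\<in>words m. \<Sum>v\<in>words n. g (u @ v))"
proof -
  have "(\<Sum>w\<in>words (m + n). g w) = (\<Sum>(u, v)\<in>words m \<times> words n. g (u @ v))"
    by (rule sum.reindex_bij_witness[where i="\<lambda>(u, v). u @ v" and j="\<lambda>w. (take m w, drop m w)"])
       (auto simp: words_def dest!: in_set_takeD in_set_dropD)
  then show ?thesis by (simp add: sum.cartesian_product)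
qed

lemma pred_label: "Measurable.pred M (\<lambda>x. c x = a)"
proof (cases "a \<in> C")
  case True
  then have "c -` {a} \<inter> space M \<in> sets M"
    using label_measurable by (auto intro: measurable_sets)
  moreover have "c -` {a} \<inter> space M = {x \<in> space M. c x = a}" by auto
  ultimately show ?thesis by (simp add: pred_def)
next
  case False
  then have "{x \<in> space M. c x = a} = {}" using label_in by auto
  then show ?thesis unfolding pred_def by (simp only: sets.empty_sets)
qed

lemma pred_itinerary: "Measurable.pred M (\<lambda>x. itinerary n x = w)"
proof (induction n arbitrary: w)
  case (Suc n)
  show ?case
  proof (cases w)
    case (Cons a v)
    have "Measurable.pred M (\<lambda>x. itinerary n (T x) = v)"
      using measurable_compose[OF T_measurable Suc] .
    then show ?thesis using pred_label[of a] by (simp add: Cons)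
  qed simp
qed simp

lemma itinerary_measurable [measurable]: "itinerary n \<in> measurable M (count_space UNIV)"
proof -
  have "itinerary n \<in> measurable M (count_space (words n))"
  proof (subst measurable_count_space_eq2[OF finite_words], safe)
    show "itinerary n -` {w} \<inter> space M \<in> sets M" for w
      using pred_itinerary[of n w] by (simp add: pred_def vimage_def Int_def conj_commute)
  qed (rule itinerary_in_words)
  then show ?thesis by (rule measurable_compose[where g="\<lambda>w. w"]) simp
qed

lemma word_prob_nonneg [simp]: "0 \<le> word_prob w"
  by (simp add: word_prob_def)

lemma word_prob_le_1: "word_prob w \<le> 1"
  by (simp add: word_prob_def)

lemma word_prob_Nil [simp]: "word_prob [] = 1"
  by (simp add: word_prob_def prob_space)

lemma
  fixes g :: "'b list \<Rightarrow> real"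
  shows integrable_itinerary: "integrable M (\<lambda>x. g (itinerary n x))"
    and integral_itinerary: "(\<integral>x. g (itinerary n x) \<partial>M) = (\<Sum>w\<in>words n. word_prob w * g w)"
proof -
  let ?A = "\<lambda>w. {x \<in> space M. itinerary n x = w}"
  have eq: "g (itinerary n x) = (\<Sum>w\<in>words n. indicator (?A w) x * g w)" if "x \<in> space M" for x
  proof -
    have "(\<Sum>w\<in>words n. indicator (?A w) x * g w) = (\<Sum>w\<in>{itinerary n x}. indicator (?A w) x * g w)"
      by (rule sum.mono_neutral_right) (use that in \<open>auto simp: finite_words itinerary_in_words indicator_def\<close>)
    then show ?thesis using that by simp
  qed
  have A: "?A w \<in> sets M" for w by measurable
  have int: "integrable M (\<lambda>x. indicator (?A w) x * g w)" for w
    using A by (intro integrable_mult_left integrable_real_indicator) (auto simp: less_top[symmetric])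
  have "integrable M (\<lambda>x. \<Sum>w\<in>words n. indicator (?A w) x * g w)" using int by auto
  then show "integrable M (\<lambda>x. g (itinerary n x))"
    by (subst Bochner_Integration.integrable_cong[OF refl eq])
  have "(\<integral>x. g (itinerary n x) \<partial>M) = (\<integral>x. (\<Sum>w\<in>words n. indicator (?A w) x * g w) \<partial>M)"
    by (rule Bochner_Integration.integral_cong[OF refl eq])
  also have "\<dots> = (\<Sum>w\<in>words n. (\<integral>x. indicator (?A w) x * g w \<partial>M))"
    by (rule Bochner_Integration.integral_sum) (rule int)
  also have "\<dots> = (\<Sum>w\<in>words n. word_prob w * g w)"
  proof (rule sum.cong[OF refl])
    fix w assume "w \<in> words n"
    then show "(\<integral>x. indicator (?A w) x * g w \<partial>M) = word_prob w * g w"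
      using A[of w] by (simp add: word_prob_def words_def)
  qed
  finally show "(\<integral>x. g (itinerary n x) \<partial>M) = (\<Sum>w\<in>words n. word_prob w * g w)" .
qed

lemma sum_word_prob: "(\<Sum>w\<in>words n. word_prob w) = 1"
  using integral_itinerary[of "\<lambda>_. 1" n] by (simp add: prob_space)

lemma block_entropy_eq: "block_entropy n = (\<integral>x. - ln (word_prob (itinerary n x)) \<partial>M)"
  unfolding block_entropy_def by (rule integral_itinerary[symmetric])

lemma block_entropy_nonneg: "0 \<le> block_entropy n"
  unfolding block_entropy_def
proof (rule sum_nonneg)
  fix w
  have "ln (word_prob w) \<le> 0"
    using word_prob_le_1[of w] word_prob_nonneg[of w] by (cases "word_prob w = 0") (auto intro: ln_le_zero_iff[THEN iffD2] simp: less_le)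
  then show "0 \<le> word_prob w * - ln (word_prob w)"
    using mult_nonneg_nonpos[OF word_prob_nonneg[of w]] by simp
qed

lemma AE_word_prob_pos: "AE x in M. \<forall>n. 0 < word_prob (itinerary n x)"
proof -
  have "AE x in M. 0 < word_prob (itinerary n x)" for n
  proof -
    have "AE x in M. \<forall>w\<in>words n. word_prob w = 0 \<longrightarrow> itinerary n x \<noteq> w"
    proof (intro AE_finite_allI[OF finite_words] AE_impI)
      fix w assume w: "w \<in> words n" "word_prob w = 0"
      have "{x \<in> space M. itinerary n x = w} \<in> sets M" by measurable
      moreover have "measure M {x \<in> space M. itinerary n x = w} = 0"
        using w by (simp add: word_prob_def words_def)
      ultimately show "AE x in M. itinerary n x \<noteq> w"
        by (subst AE_iff_measurable[OF _ refl]) (auto simp: emeasure_eq_measure)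
    qed
    with AE_space show ?thesis
    proof eventually_elim
      case (elim x)
      then show ?case
        using itinerary_in_words[of x n] word_prob_nonneg[of "itinerary n x"] by (auto simp: less_le)
    qed
  qed
  then show ?thesis by (simp add: AE_all_countable)
qed

lemma word_prob_append_le:
  assumes "x \<in> space M"
  shows "word_prob (itinerary (m + n) x) \<le> word_prob (itinerary m x)"
    and "word_prob (itinerary (m + n) x) \<le> word_prob (itinerary n ((T ^^ m) x))"
proof -
  show "word_prob (itinerary (m + n) x) \<le> word_prob (itinerary m x)"
    unfolding word_prob_def by (rule finite_measure_mono) (auto simp: itinerary_add)
  let ?A = "{y \<in> space M. itinerary n y = itinerary n ((T ^^ m) x)}"
  have A: "?A \<in> sets M" by measurable
  have "word_prob (itinerary (m + n) x) \<le> measure M ((T ^^ m) -` ?A \<inter> space M)"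
    unfolding word_prob_def
    by (rule finite_measure_mono)
       (auto simp: itinerary_add measurable_space[OF funpow_measurable] intro: measurable_sets[OF _ A] simp del: funpow.simps)
  also have "\<dots> = measure M ?A" by (rule measure_vimage_funpow[OF A])
  finally show "word_prob (itinerary (m + n) x) \<le> word_prob (itinerary n ((T ^^ m) x))"
    by (simp add: word_prob_def)
qed

lemma sum_word_prob_Cons: "(\<Sum>a\<in>C. word_prob (a # u)) = word_prob u"
proof -
  let ?A = "\<lambda>a. {x \<in> space M. itinerary (Suc (length u)) x = a # u}"
  let ?B = "{x \<in> space M. itinerary (length u) x = u}"
  have "measure M (\<Union>a\<in>C. ?A a) = (\<Sum>a\<in>C. measure M (?A a))"
  proof (rule finite_measure_finite_Union[OF finite_labels])
    show "?A ` C \<subseteq> sets M" by (intro image_subsetI) measurable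
  qed (auto simp: disjoint_family_on_def)
  also have "(\<Union>a\<in>C. ?A a) = (T ^^ 1) -` ?B \<inter> space M"
    using label_in T_space by auto
  also have "measure M \<dots> = measure M ?B" by (rule measure_vimage_funpow) measurable
  finally show ?thesis by (simp add: word_prob_def)
qed

text \<open>Gibbs' inequality: coding with a wrong distribution \<open>q\<close> costs at least the entropy. Every
  upper bound for the block entropy below is an instance with a suitable \<open>q\<close>.\<close>

lemma block_entropy_le:
  assumes q: "\<And>w. w \<in> words n \<Longrightarrow> 0 \<le> q w" "(\<Sum>w\<in>words n. q w) \<le> 1"
    and pos: "\<And>w. w \<in> words n \<Longrightarrow> 0 < word_prob w \<Longrightarrow> 0 < q w"
  shows "block_entropy n \<le> (\<integral>x. - ln (q (itinerary n x)) \<partial>M)"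
proof -
  have "word_prob w * ln (q w) - word_prob w * ln (word_prob w) \<le> q w - word_prob w"
    if w: "w \<in> words n" for w
  proof (cases "word_prob w = 0")
    case False
    then have p: "0 < word_prob w" using word_prob_nonneg[of w] by linarith
    then have "0 < q w" using pos w by blast
    then have "ln (q w) - ln (word_prob w) \<le> q w / word_prob w - 1"
      using p ln_le_minus_one[of "q w / word_prob w"] by (simp add: ln_div)
    then have "word_prob w * (ln (q w) - ln (word_prob w)) \<le> word_prob w * (q w / word_prob w - 1)"
      by (intro mult_left_mono) auto
    then show ?thesis using p by (simp add: algebra_simps)
  qed (use q w in auto)
  then have "(\<Sum>w\<in>words n. word_prob w * ln (q w) - word_prob w * ln (word_prob w))
      \<le> (\<Sum>w\<in>words n. q w - word_prob w)"
    by (rule sum_mono)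
  also have "\<dots> \<le> 0" using q sum_word_prob[of n] by (simp add: sum_subtractf)
  finally show ?thesis
    unfolding block_entropy_def integral_itinerary[of "\<lambda>w. - ln (q w)"]
    by (simp add: sum_subtractf sum_negf)
qed

lemma block_entropy_subadditive: "block_entropy (m + n) \<le> block_entropy m + block_entropy n"
proof -
  let ?q = "\<lambda>w. word_prob (take m w) * word_prob (drop m w)"
  have i1: "integrable M (\<lambda>x. - ln (word_prob (itinerary m x)))"
    by (rule integrable_itinerary[of "\<lambda>w. - ln (word_prob w)"])
  have i2: "integrable M (\<lambda>x. - ln (word_prob (itinerary n ((T ^^ m) x))))"
    by (rule integrable_funpow[OF integrable_itinerary[of "\<lambda>w. - ln (word_prob w)"]])
  have "block_entropy (m + n) \<le> (\<integral>x. - ln (?q (itinerary (m + n) x)) \<partial>M)"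
  proof (rule block_entropy_le)
    have "(\<Sum>w\<in>words (m + n). ?q w) = (\<Sum>u\<in>words m. \<Sum>v\<in>words n. word_prob u * word_prob v)"
      unfolding sum_words_add by (intro sum.cong refl) (auto simp: words_def)
    then show "(\<Sum>w\<in>words (m + n). ?q w) \<le> 1"
      by (simp add: sum_distrib_left[symmetric] sum_word_prob)
  next
    fix w assume w: "w \<in> words (m + n)" "0 < word_prob w"
    then have "{x \<in> space M. itinerary (length w) x = w} \<noteq> {}"
      unfolding word_prob_def by (metis measure_empty less_irrefl)
    then obtain x where x: "x \<in> space M" "itinerary (m + n) x = w" using w by (auto simp: words_def)
    have "take m w = itinerary m x" "drop m w = itinerary n ((T ^^ m) x)"
      using x(2) by (auto simp: itinerary_add)
    then show "0 < ?q w"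
      using word_prob_append_le[OF x(1), of m n] w x by (auto intro!: mult_pos_pos)
  qed auto
  also have "\<dots> = (\<integral>x. - ln (word_prob (itinerary m x)) + - ln (word_prob (itinerary n ((T ^^ m) x))) \<partial>M)"
  proof (rule integral_cong_AE)
    show "AE x in M. - ln (?q (itinerary (m + n) x))
        = - ln (word_prob (itinerary m x)) + - ln (word_prob (itinerary n ((T ^^ m) x)))"
      using AE_word_prob_pos AE_funpow[OF AE_word_prob_pos]
    proof eventually_elim
      case (elim x)
      then have "0 < word_prob (itinerary m x)" "0 < word_prob (itinerary n ((T ^^ m) x))" by blast+
      then show ?case by (simp add: itinerary_add ln_mult_pos)
    qed
    show "(\<lambda>x. - ln (?q (itinerary (m + n) x))) \<in> borel_measurable M"
      by (rule borel_measurable_integrable[OF integrable_itinerary[of "\<lambda>w. - ln (?q w)"]])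
    show "(\<lambda>x. - ln (word_prob (itinerary m x)) + - ln (word_prob (itinerary n ((T ^^ m) x)))) \<in> borel_measurable M"
      by (rule borel_measurable_integrable[OF Bochner_Integration.integrable_add[OF i1 i2]])
  qed
  also have "\<dots> = block_entropy m + block_entropy n"
    by (subst Bochner_Integration.integral_add[OF i1 i2])
       (simp only: block_entropy_eq integral_funpow[OF integrable_itinerary[of "\<lambda>w. - ln (word_prob w)"]])
  finally show ?thesis .
qed

lemma block_entropy_tendsto: "(\<lambda>n. block_entropy n / n) \<longlonglongrightarrow> entropy_rate"
  unfolding entropy_rate_def
  using subadditive_convergent[of block_entropy] block_entropy_subadditive block_entropy_nonneg
  by (simp add: convergent_LIMSEQ_iff)

lemma entropy_rate_nonneg: "0 \<le> entropy_rate"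
  by (rule LIMSEQ_le_const[OF block_entropy_tendsto]) (auto simp: block_entropy_nonneg)

end

section \<open>The Shannon-McMillan-Breiman theorem\<close>

context labelled_system
begin

text \<open>Markov's inequality and the Borel-Cantelli lemma: no sequence of subprobabilities on words
  can exceed the true distribution by more than a polynomial factor along typical itineraries.\<close>

lemma AE_subprobability_le:
  assumes q: "\<And>w. 0 \<le> q w" "\<And>n. (\<Sum>w\<in>words n. q w) \<le> 1"
  shows "AE x in M. \<forall>\<^sub>F n in sequentially. q (itinerary n x) \<le> (real n)\<^sup>2 * word_prob (itinerary n x)"
proof -
  define A where "A n = {x \<in> space M. (real n)\<^sup>2 * word_prob (itinerary n x) < q (itinerary n x)}" for n
  have A [measurable]: "A n \<in> sets M" for n
    unfolding A_def
    using measurable_compose[OF itinerary_measurable, of "\<lambda>w. (real n)\<^sup>2 * word_prob w < q w" "count_space UNIV" n]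
    by (simp add: pred_def)
  have le: "measure M (A n) \<le> inverse ((real n)\<^sup>2)" if "n \<ge> 1" for n
  proof -
    let ?g = "\<lambda>w. of_bool ((real n)\<^sup>2 * word_prob w < q w) :: real"
    have "measure M (A n) = (\<integral>x. ?g (itinerary n x) \<partial>M)"
    proof -
      have "measure M (A n) = (\<integral>x. indicator (A n) x \<partial>M)" using A by simp
      also have "\<dots> = (\<integral>x. ?g (itinerary n x) \<partial>M)"
        by (intro Bochner_Integration.integral_cong) (auto simp: A_def indicator_def)
      finally show ?thesis .
    qed
    also have "\<dots> = (\<Sum>w\<in>words n. word_prob w * ?g w)" by (rule integral_itinerary)
    also have "\<dots> \<le> (\<Sum>w\<in>words n. inverse ((real n)\<^sup>2) * q w)"
      using that q(1) by (intro sum_mono) (auto simp: field_simps)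
    also have "\<dots> \<le> inverse ((real n)\<^sup>2)"
      using q(2)[of n] mult_left_mono[of "sum q (words n)" 1 "inverse ((real n)\<^sup>2)"]
      by (simp add: sum_distrib_left[symmetric])
    finally show ?thesis .
  qed
  have "summable (\<lambda>n. measure M (A n))"
  proof (rule summable_comparison_test_ev)
    show "\<forall>\<^sub>F n in sequentially. norm (measure M (A n)) \<le> inverse ((real n)\<^sup>2)"
      using le by (auto simp: eventually_sequentially intro: exI[of _ 1])
  qed (rule inverse_power_summable, simp)
  then have "AE x in M. \<forall>\<^sub>F n in sequentially. x \<in> space M - A n"
    by (intro borel_cantelli_AE1) (auto simp: less_top[symmetric])
  then show ?thesis
  proof eventually_elim
    case (elim x)
    then show ?case by eventually_elim (auto simp: A_def not_less)
  qed
qed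

text \<open>The law of the (reversed) Markov chain of order \<open>k\<close> whose transition probabilities are those
  of the labelled process.\<close>

primrec markov_prob :: "nat \<Rightarrow> 'b list \<Rightarrow> real" where
  "markov_prob k [] = 1"
| "markov_prob k (a # v) = (if length v < k then word_prob (a # v)
     else word_prob (a # take k v) / word_prob (take k v) * markov_prob k v)"

lemma markov_prob_nonneg: "0 \<le> markov_prob k w"
  by (induction w) auto

lemma sum_markov_prob: "(\<Sum>w\<in>words n. markov_prob k w) \<le> 1"
proof (induction n)
  case (Suc n)
  show ?case
  proof (cases "n < k")
    case True
    then have "(\<Sum>w\<in>words (Suc n). markov_prob k w) = (\<Sum>w\<in>words (Suc n). word_prob w)"
      by (intro sum.cong refl) (auto simp: words_def length_Suc_conv)
    then show ?thesis by (simp add: sum_word_prob)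
  next
    case False
    have "(\<Sum>w\<in>words (Suc n). markov_prob k w)
        = (\<Sum>v\<in>words n. \<Sum>a\<in>C. word_prob (a # take k v) / word_prob (take k v) * markov_prob k v)"
      unfolding sum_words_Suc using False by (intro sum.cong refl) (auto simp: words_def)
    also have "\<dots> = (\<Sum>v\<in>words n. word_prob (take k v) / word_prob (take k v) * markov_prob k v)"
      by (simp only: sum_distrib_right[symmetric] sum_divide_distrib[symmetric] sum_word_prob_Cons)
    also have "\<dots> \<le> (\<Sum>v\<in>words n. markov_prob k v)"
      by (intro sum_mono) (auto simp: markov_prob_nonneg)
    finally show ?thesis using Suc by simp
  qed
qed (simp add: words_0)

lemma markov_prob_short: "length w \<le> k \<Longrightarrow> markov_prob k w = word_prob w"
  by (cases w) auto

text \<open>The cost of the Markov code is a Birkhoff sum up to one boundary term, because every transition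
  probability depends only on a window of fixed length.\<close>

lemma ln_markov_prob:
  assumes "\<And>t n. 0 < word_prob (itinerary n ((T ^^ t) x))"
  shows "0 < markov_prob k (itinerary (n + k) x) \<and>
    - ln (markov_prob k (itinerary (n + k) x)) =
      birkhoff_sum (\<lambda>x. ln (word_prob (itinerary k (T x))) - ln (word_prob (itinerary (Suc k) x))) n x
      - ln (word_prob (itinerary k ((T ^^ n) x)))"
  using assms
proof (induction n arbitrary: x)
  case 0
  then show ?case using 0[of k 0] by (simp add: markov_prob_short birkhoff_sum_def)
next
  case (Suc n)
  have pos: "0 < word_prob (itinerary n ((T ^^ t) (T x)))" for t n
    using Suc.prems[of n "Suc t"] by (simp add: funpow_swap1)
  note IH = Suc.IH[OF pos]
  have p1: "0 < word_prob (itinerary (Suc k) x)" using Suc.prems[of "Suc k" 0] by simp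
  have p2: "0 < word_prob (itinerary k (T x))" using pos[of k 0] by simp
  have eq: "markov_prob k (itinerary (Suc n + k) x)
      = word_prob (itinerary (Suc k) x) / word_prob (itinerary k (T x)) * markov_prob k (itinerary (n + k) (T x))"
    by (simp add: take_itinerary)
  show ?case
    unfolding eq birkhoff_sum_Suc using IH p1 p2
    by (simp add: ln_mult_pos ln_div funpow_swap1 del: itinerary.simps)
qed

end

locale ergodic_labelled_system = labelled_system + ergodic_system
begin

text \<open>The Markov approximations of order \<open>k\<close> have entropy \<open>block_entropy (k + 1) - block_entropy k\<close>,
  and these increments cannot all exceed the entropy rate.\<close>

theorem word_prob_eventually_ge:
  fixes e :: real
  assumes e: "entropy_rate < e"
  shows "AE x in M. \<forall>\<^sub>F n in sequentially. exp (- e * n) \<le> word_prob (itinerary n x)"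
proof -
  obtain e1 where e1: "entropy_rate < e1" "e1 < e" using e dense by blast
  obtain k where k: "block_entropy (Suc k) - block_entropy k < e1"
  proof (rule ccontr)
    assume "\<not> thesis"
    then have ge: "e1 \<le> block_entropy (Suc k) - block_entropy k" for k
      using that not_less by blast
    have "e1 * n \<le> block_entropy n" for n
    proof (induction n)
      case (Suc n)
      then show ?case using ge[of n] by (simp add: algebra_simps)
    qed (simp add: block_entropy_nonneg)
    then have "e1 \<le> block_entropy n / n" if "n \<ge> 1" for n
      using that by (simp add: field_simps)
    then have "e1 \<le> entropy_rate"
      by (intro LIMSEQ_le_const[OF block_entropy_tendsto]) auto
    then show False using e1 by simp
  qed
  let ?l = "\<lambda>w. ln (word_prob w)"
  let ?f = "\<lambda>x. ?l (itinerary k (T x)) - ?l (itinerary (Suc k) x)"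
  define B where "B = (\<Sum>w\<in>words k. \<bar>?l w\<bar>)"
  have i1: "integrable M (\<lambda>x. ?l (itinerary k (T x)))"
    using integrable_funpow[where k=1, OF integrable_itinerary[of ?l k]] by simp
  have i2: "integrable M (\<lambda>x. ?l (itinerary (Suc k) x))"
    by (rule integrable_itinerary)
  have "(\<integral>x. ?f x \<partial>M) = (\<integral>x. ?l (itinerary k (T x)) \<partial>M) - (\<integral>x. ?l (itinerary (Suc k) x) \<partial>M)"
    by (rule Bochner_Integration.integral_diff[OF i1 i2])
  also have "\<dots> = block_entropy (Suc k) - block_entropy k"
    using integral_funpow[where k=1, OF integrable_itinerary[of ?l k]]
    by (simp add: block_entropy_eq)
  finally have "(\<integral>x. ?f x \<partial>M) < e1" using k by simp
  then have birk: "AE x in M. \<forall>\<^sub>F n in sequentially. birkhoff_sum ?f n x < e1 * n"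
    by (intro birkhoff_upper Bochner_Integration.integrable_diff i1 i2)
  have markov: "AE x in M. \<forall>\<^sub>F n in sequentially.
      markov_prob k (itinerary n x) \<le> (real n)\<^sup>2 * word_prob (itinerary n x)"
    by (rule AE_subprobability_le) (rule markov_prob_nonneg sum_markov_prob)+
  have growth: "\<forall>\<^sub>F n in sequentially. B + 2 * ln (real (n + k)) \<le> (e - e1) * n"
    using e1 by real_asymp
  show ?thesis
    using birk markov AE_funpow[OF AE_word_prob_pos] AE_space
  proof eventually_elim
    case (elim x)
    have pos: "0 < word_prob (itinerary n ((T ^^ t) x))" for n t using elim(3) by blast
    have "\<forall>\<^sub>F n in sequentially. markov_prob k (itinerary (n + k) x)
        \<le> (real (n + k))\<^sup>2 * word_prob (itinerary (n + k) x)"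
      using elim(2) by (rule eventually_compose_filterlim[OF _ filterlim_add_const_nat_at_top])
    then have "\<forall>\<^sub>F n in sequentially. exp (- e * real (n + k)) \<le> word_prob (itinerary (n + k) x)"
      using elim(1) growth eventually_ge_at_top[of 1]
    proof eventually_elim
      case (elim n)
      have "itinerary k ((T ^^ n) x) \<in> words k"
        using \<open>x \<in> space M\<close> by (intro itinerary_in_words measurable_space[OF funpow_measurable])
      then have B: "- ?l (itinerary k ((T ^^ n) x)) \<le> B"
        unfolding B_def using member_le_sum[of "itinerary k ((T ^^ n) x)" "words k" "\<lambda>w. \<bar>?l w\<bar>"] finite_words[of k] by auto
      have "ln (markov_prob k (itinerary (n + k) x)) \<le> ln ((real (n + k))\<^sup>2 * word_prob (itinerary (n + k) x))"
        using elim ln_markov_prob[OF pos, where n=n and k=k] by (intro ln_mono) auto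
      also have "\<dots> = 2 * ln (real (n + k)) + ?l (itinerary (n + k) x)"
        using elim pos[of _ 0] by (subst ln_mult_pos) (auto simp: ln_realpow simp del: of_nat_add)
      finally have "- ?l (itinerary (n + k) x) \<le> e1 * n + (B + 2 * ln (real (n + k)))"
        using elim B ln_markov_prob[OF pos, where n=n and k=k] by linarith
      also have "\<dots> \<le> e * n" using elim by (simp add: algebra_simps)
      also have "\<dots> \<le> e * (n + k)" using entropy_rate_nonneg e by (intro mult_left_mono) auto
      finally have "- e * real (n + k) \<le> ?l (itinerary (n + k) x)" by simp
      then show ?case using pos[of "n + k" 0] by (metis exp_le_cancel_iff exp_ln funpow_0)
    qed
    then show ?case by (subst (asm) eventually_sequentially_seg)
  qed
qed

end

context labelled_system
begin

text \<open>A random concatenation: with probability one half a uniformly distributed letter comes next,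
  and otherwise a block of length \<open>l > L\<close>, chosen with weight \<open>exp (- e * l)\<close> and distributed
  according to \<open>word_prob\<close>.\<close>

function parse_prob :: "nat \<Rightarrow> real \<Rightarrow> 'b list \<Rightarrow> real" where
  "parse_prob L e [] = 1"
| "parse_prob L e (a # v) = parse_prob L e v / (2 * card C) +
     (\<Sum>l\<in>{Suc L..Suc (length v)}.
        exp (- (e::real) * real l) * word_prob (take l (a # v)) * parse_prob L e (drop l (a # v)))"
  by pat_completeness auto
termination by (relation "Wellfounded.measure (\<lambda>(L, e, w). length w)") auto

lemma parse_prob_nonneg: "0 \<le> parse_prob L e w"
  by (induction L e w rule: parse_prob.induct) (auto intro!: add_nonneg_nonneg sum_nonneg)

lemma parse_prob_letter: "parse_prob L e v / (2 * card C) \<le> parse_prob L e (a # v)"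
  unfolding parse_prob.simps by (intro le_add_same_cancel1[THEN iffD2] sum_nonneg) (auto simp: parse_prob_nonneg)

lemma parse_prob_block:
  fixes e :: real
  assumes "L < l" "l \<le> length w"
  shows "exp (- e * l) * word_prob (take l w) * parse_prob L e (drop l w) \<le> parse_prob L e w"
proof (cases w)
  case (Cons a v)
  let ?g = "\<lambda>l. exp (- e * l) * word_prob (take l w) * parse_prob L e (drop l w)"
  have "?g l \<le> (\<Sum>l\<in>{Suc L..Suc (length v)}. ?g l)"
    using assms Cons by (intro member_le_sum) (auto simp: parse_prob_nonneg)
  also have "\<dots> \<le> parse_prob L e w"
    unfolding Cons parse_prob.simps by (simp add: parse_prob_nonneg del: sum.cl_ivl_Suc)
  finally show ?thesis .
qed (use assms in simp)

lemma sum_parse_prob: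
  fixes e :: real
  assumes L: "\<And>n. (\<Sum>l\<in>{Suc L..n}. exp (- e * real l)) \<le> 1 / 2"
  shows "(\<Sum>w\<in>words n. parse_prob L e w) \<le> 1"
proof (induction n rule: less_induct)
  case (less n)
  show ?case
  proof (cases n)
    case (Suc m)
    let ?g = "\<lambda>l w. exp (- e * real l) * word_prob (take l w) * parse_prob L e (drop l w)"
    have "(\<Sum>w\<in>words n. parse_prob L e w)
        = (\<Sum>w\<in>words n. parse_prob L e (tl w) / (2 * card C) + (\<Sum>l\<in>{Suc L..n}. ?g l w))"
      by (intro sum.cong refl) (auto simp: words_def Suc length_Suc_conv simp del: take_Suc_Cons sum.cl_ivl_Suc)
    also have "\<dots> = (\<Sum>w\<in>words n. parse_prob L e (tl w) / (2 * card C)) + (\<Sum>w\<in>words n. \<Sum>l\<in>{Suc L..n}. ?g l w)"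
      by (rule sum.distrib)
    also have "(\<Sum>w\<in>words n. parse_prob L e (tl w) / (2 * card C)) = (\<Sum>v\<in>words m. parse_prob L e v) / 2"
      unfolding Suc sum_words_Suc using labels_pos by (simp add: sum_divide_distrib)
    also have "\<dots> \<le> 1 / 2" using less[of m] Suc by simp
    also have "(\<Sum>w\<in>words n. \<Sum>l\<in>{Suc L..n}. ?g l w) = (\<Sum>l\<in>{Suc L..n}. \<Sum>w\<in>words n. ?g l w)"
      by (rule sum.swap)
    also have "\<dots> \<le> (\<Sum>l\<in>{Suc L..n}. exp (- e * real l))"
    proof (rule sum_mono)
      fix l assume l: "l \<in> {Suc L..n}"
      have "(\<Sum>w\<in>words n. ?g l w) = (\<Sum>w\<in>words (l + (n - l)). ?g l w)" using l by simp
      also have "\<dots> = (\<Sum>u\<in>words l. \<Sum>v\<in>words (n - l). exp (- e * real l) * word_prob u * parse_prob L e v)"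
        unfolding sum_words_add by (intro sum.cong refl) (auto simp: words_def)
      also have "\<dots> = exp (- e * real l) * ((\<Sum>u\<in>words l. word_prob u) * (\<Sum>v\<in>words (n - l). parse_prob L e v))"
        unfolding sum_product unfolding sum_distrib_left by (simp add: mult.assoc)
      also have "\<dots> \<le> exp (- e * real l) * 1"
        using less[of "n - l"] l by (intro mult_left_mono) (auto simp: sum_word_prob)
      finally show "(\<Sum>w\<in>words n. ?g l w) \<le> exp (- e * real l)" by simp
    qed
    also have "\<dots> \<le> 1 / 2" by (rule L)
    finally show ?thesis by simp
  qed (simp add: words_0)
qed

lemma parse_prob_ge: "exp (- ln (2 * card C) * length w) \<le> parse_prob L e w"
proof (induction w)
  case (Cons a v)
  have "- ln (2 * card C) * length (a # v) = - ln (2 * card C) * length v - ln (2 * card C)"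
    by (simp add: algebra_simps)
  then have "exp (- ln (2 * card C) * length (a # v)) = exp (- ln (2 * card C) * length v) / exp (ln (2 * card C))"
    by (simp only: exp_diff)
  also have "\<dots> = exp (- ln (2 * card C) * length v) / (2 * card C)"
    using labels_pos by (subst exp_ln) auto
  also have "\<dots> \<le> parse_prob L e v / (2 * card C)" by (intro divide_right_mono Cons) auto
  also have "\<dots> \<le> parse_prob L e (a # v)" by (rule parse_prob_letter)
  finally show ?case .
qed simp

lemma parse_prob_pos: "0 < parse_prob L e w"
  using parse_prob_ge less_le_trans exp_gt_zero by blast

text \<open>Parse the itinerary greedily: a block is used wherever a likely one of length at most \<open>K\<close>
  starts, and a single letter elsewhere. Only the letters cost more than the target rate.\<close>

lemma ln_parse_prob:
  fixes a e :: real and K L :: nat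
  assumes "0 \<le> a" "0 \<le> e" "x \<in> space M"
  defines "bad \<equiv> (\<lambda>x. of_bool (\<not> (\<exists>l\<in>{Suc L..K}. exp (- a * l) \<le> word_prob (itinerary l x))) :: real)"
  shows "- ln (parse_prob L e (itinerary n x)) \<le> (a + e) * n + ln (2 * card C) * (birkhoff_sum bad n x + K)"
  using assms(3)
proof (induction n arbitrary: x rule: less_induct)
  case (less n)
  let ?k = "ln (2 * card C)"
  have k: "0 \<le> ?k" using labels_pos by (intro ln_ge_zero) auto
  have bad: "0 \<le> bad x" for x by (simp add: bad_def)
  have sum_bad: "0 \<le> birkhoff_sum bad n x" for n x
    by (auto simp: birkhoff_sum_def bad intro: sum_nonneg)
  show ?case
  proof (cases "n < K")
    case True
    have "exp (- ?k * n) \<le> parse_prob L e (itinerary n x)" using parse_prob_ge[of "itinerary n x"] by simp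
    then have "ln (exp (- ?k * n)) \<le> ln (parse_prob L e (itinerary n x))" by (intro ln_mono) auto
    then have "- ln (parse_prob L e (itinerary n x)) \<le> ?k * n" by simp
    also have "\<dots> \<le> ?k * (birkhoff_sum bad n x + K)"
      using True sum_bad[of n x] k by (intro mult_left_mono) auto
    also have "\<dots> \<le> (a + e) * n + ?k * (birkhoff_sum bad n x + K)" using assms by simp
    finally show ?thesis .
  next
    case False
    show ?thesis
    proof (cases "\<exists>l\<in>{Suc L..K}. exp (- a * l) \<le> word_prob (itinerary l x)")
      case True
      then obtain l where l: "L < l" "l \<le> K" "exp (- a * l) \<le> word_prob (itinerary l x)"
        by (auto simp: Suc_le_eq)
      let ?y = "(T ^^ l) x"
      have ln: "l \<le> n" "n - l < n" using l False by auto
      have y: "?y \<in> space M" using measurable_space[OF funpow_measurable less.prems] .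
      have "exp (- e * l) * exp (- a * l) * parse_prob L e (itinerary (n - l) ?y) \<le> parse_prob L e (itinerary n x)"
      proof (rule order_trans[OF _ parse_prob_block[of L l]])
        show "exp (- e * l) * exp (- a * l) * parse_prob L e (itinerary (n - l) ?y)
          \<le> exp (- e * l) * word_prob (take l (itinerary n x)) * parse_prob L e (drop l (itinerary n x))"
          unfolding drop_itinerary[OF ln(1)] take_itinerary[OF ln(1)]
          by (intro mult_right_mono mult_left_mono l parse_prob_nonneg) auto
      qed (use l ln in auto)
      then have "ln (exp (- e * l) * exp (- a * l) * parse_prob L e (itinerary (n - l) ?y))
          \<le> ln (parse_prob L e (itinerary n x))"
        by (intro ln_mono) (auto intro!: mult_pos_pos parse_prob_pos)
      then have "- ln (parse_prob L e (itinerary n x)) \<le> (a + e) * l - ln (parse_prob L e (itinerary (n - l) ?y))"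
        using parse_prob_pos[of L e "itinerary (n - l) ?y"]
        by (simp add: ln_mult_pos mult_exp_exp algebra_simps)
      also have "\<dots> \<le> (a + e) * l + ((a + e) * (n - l) + ?k * (birkhoff_sum bad (n - l) ?y + K))"
        using less.IH[OF ln(2) y] ln by (simp add: of_nat_diff)
      also have "\<dots> \<le> (a + e) * n + ?k * (birkhoff_sum bad n x + K)"
      proof -
        have "birkhoff_sum bad (n - l) ?y = (\<Sum>t\<in>{l..<n}. bad ((T ^^ t) x))"
          unfolding birkhoff_sum_def using ln
          by (intro sum.reindex_bij_witness[where i="\<lambda>t. t - l" and j="\<lambda>t. t + l"]) (auto simp: funpow_add)
        also have "\<dots> \<le> birkhoff_sum bad n x"
          unfolding birkhoff_sum_def by (intro sum_mono2) (auto simp: bad)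
        finally have "?k * (birkhoff_sum bad (n - l) ?y + K) \<le> ?k * (birkhoff_sum bad n x + K)"
          using k by (intro mult_left_mono) auto
        then show ?thesis using ln by (simp add: of_nat_diff algebra_simps)
      qed
      finally show ?thesis .
    next
      case badx: False
      then have b: "bad x = 1" by (simp add: bad_def)
      show ?thesis
      proof (cases n)
        case 0
        then show ?thesis using k by (simp add: birkhoff_sum_def)
      next
        case (Suc m)
        have "parse_prob L e (itinerary m (T x)) / (2 * card C) \<le> parse_prob L e (itinerary n x)"
          unfolding Suc itinerary.simps by (rule parse_prob_letter)
        then have "ln (parse_prob L e (itinerary m (T x)) / (2 * card C)) \<le> ln (parse_prob L e (itinerary n x))"
          using labels_pos by (intro ln_mono) (auto intro!: divide_pos_pos parse_prob_pos)
        then have "- ln (parse_prob L e (itinerary n x)) \<le> - ln (parse_prob L e (itinerary m (T x))) + ?k"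
          using labels_pos parse_prob_pos[of L e "itinerary m (T x)"] by (simp add: ln_div)
        also have "\<dots> \<le> (a + e) * m + ?k * (birkhoff_sum bad m (T x) + K) + ?k"
          using less.IH[of m "T x"] Suc T_space[OF less.prems] by simp
        also have "\<dots> \<le> (a + e) * n + ?k * (birkhoff_sum bad n x + K)"
          using assms(1,2) by (simp add: Suc birkhoff_sum_Suc b algebra_simps)
        finally show ?thesis .
      qed
    qed
  qed
qed

text \<open>For large \<open>K\<close> the greedy parsing leaves few single letters, so the mean cost per letter is close
  to \<open>a\<close>, and Gibbs' inequality applies.\<close>

lemma entropy_rate_le_of_recurrent_blocks:
  fixes a :: real
  assumes a: "0 \<le> a"
    and rec: "AE x in M. \<exists>\<^sub>F n in sequentially. exp (- a * n) \<le> word_prob (itinerary n x)"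
  shows "entropy_rate \<le> a"
proof (rule field_le_epsilon)
  fix e' :: real assume "0 < e'"
  define e where "e = e' / 2"
  have e: "0 < e" using \<open>0 < e'\<close> by (simp add: e_def)
  let ?k = "ln (2 * card C)"
  have k: "0 \<le> ?k" using labels_pos by (intro ln_ge_zero) auto
  have "summable (\<lambda>l. exp (- e) ^ l)" using e by (intro summable_geometric) auto
  then have sm: "summable (\<lambda>l. exp (- e * real l))"
    by (simp add: exp_of_nat_mult[symmetric] mult.commute)
  \<comment> \<open>The blocks have to be long for their weights to sum to at most one half; only then is the bound
    \<open>K\<close> on their lengths chosen. The cost \<open>?k\<close> of a letter does not depend on either.\<close>
  obtain L where L: "\<And>n. (\<Sum>l\<in>{Suc L..n}. exp (- e * real l)) \<le> 1 / 2"
  proof -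
    obtain L where L: "\<And>m n. L \<le> m \<Longrightarrow> norm (\<Sum>l\<in>{m..<n}. exp (- e * real l)) < 1 / 2"
      using sm[unfolded summable_Cauchy] by (metis half_gt_zero zero_less_one)
    show thesis
    proof (rule that[of L])
      fix n
      have "{Suc L..n} = {Suc L..<Suc n}" by auto
      then show "(\<Sum>l\<in>{Suc L..n}. exp (- e * real l)) \<le> 1 / 2" using L[of "Suc L" "Suc n"] by simp
    qed
  qed
  define P where "P K x \<longleftrightarrow> (\<exists>l\<in>{Suc L..K}. exp (- a * real l) \<le> word_prob (itinerary l x))" for K x
  have P [measurable]: "Measurable.pred M (P K)" for K
    unfolding P_def[abs_def] by measurable
  have "AE x in M. \<exists>K. P K x"
    using rec
  proof eventually_elim
    case (elim x)
    then obtain n where "n \<ge> Suc L" "exp (- a * n) \<le> word_prob (itinerary n x)"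
      by (auto simp: frequently_sequentially)
    then show ?case by (auto simp: P_def intro!: exI[of _ n] bexI[of _ n])
  qed
  then have "measure M {x \<in> space M. \<exists>K. P K x} = 1"
    by (subst prob_Collect_eq_1) auto
  moreover have "{x \<in> space M. \<exists>K. P K x} = (\<Union>K. {x \<in> space M. P K x})" by auto
  ultimately have "measure M (\<Union>K. {x \<in> space M. P K x}) = 1" by simp
  moreover have "(\<lambda>K. measure M {x \<in> space M. P K x}) \<longlonglongrightarrow> measure M (\<Union>K. {x \<in> space M. P K x})"
    by (rule finite_Lim_measure_incseq) (auto simp: incseq_def P_def intro: order_trans)
  ultimately have "(\<lambda>K. measure M {x \<in> space M. P K x}) \<longlonglongrightarrow> 1" by simp
  then have "(\<lambda>K. ?k * (1 - measure M {x \<in> space M. P K x})) \<longlonglongrightarrow> ?k * (1 - 1)"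
    by (intro tendsto_intros)
  then obtain K where K: "?k * (1 - measure M {x \<in> space M. P K x}) < e"
    using order_tendstoD(2)[of _ "?k * (1 - 1)" sequentially e] e by (force simp: eventually_sequentially)
  define bad where "bad x = (of_bool (\<not> P K x) :: real)" for x
  have bad_int: "integrable M bad"
    by (rule integrable_const_bound[of _ 1]) (auto simp: bad_def[abs_def])
  have "(\<integral>x. bad x \<partial>M) = measure M (space M - {x \<in> space M. P K x})"
  proof -
    have "measure M (space M - {x \<in> space M. P K x}) = (\<integral>x. indicator (space M - {x \<in> space M. P K x}) x \<partial>M)"
      by (simp del: sets.Diff)
    also have "\<dots> = (\<integral>x. bad x \<partial>M)"
      by (intro Bochner_Integration.integral_cong) (auto simp: bad_def indicator_def)
    finally show ?thesis by simp
  qed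
  then have bad: "(\<integral>x. bad x \<partial>M) = 1 - measure M {x \<in> space M. P K x}" by (simp add: prob_compl)
  have bs: "integrable M (birkhoff_sum bad n)" "(\<integral>x. birkhoff_sum bad n x \<partial>M) = n * (\<integral>x. bad x \<partial>M)" for n
    unfolding birkhoff_sum_def[abs_def]
    using integrable_funpow[OF bad_int] integral_funpow[OF bad_int]
    by (auto intro!: Bochner_Integration.integrable_sum)
  have le: "block_entropy n \<le> (a + e) * n + e * n + ?k * K" for n
  proof -
    have "block_entropy n \<le> (\<integral>x. - ln (parse_prob L e (itinerary n x)) \<partial>M)"
      by (rule block_entropy_le) (auto simp: parse_prob_nonneg parse_prob_pos intro!: sum_parse_prob L)
    also have "\<dots> \<le> (\<integral>x. (a + e) * n + ?k * (birkhoff_sum bad n x + K) \<partial>M)"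
    proof (rule integral_mono)
      show "integrable M (\<lambda>x. - ln (parse_prob L e (itinerary n x)))"
        by (rule integrable_itinerary[of "\<lambda>w. - ln (parse_prob L e w)"])
      show "- ln (parse_prob L e (itinerary n x)) \<le> (a + e) * n + ?k * (birkhoff_sum bad n x + K)"
        if "x \<in> space M" for x
        using ln_parse_prob[of a e x L n K] a e that unfolding bad_def[abs_def] P_def by simp
    qed (use bs in auto)
    also have "\<dots> = (a + e) * n + ?k * (n * (\<integral>x. bad x \<partial>M) + K)"
      using bs by (simp add: prob_space)
    also have "\<dots> = (a + e) * n + (?k * (\<integral>x. bad x \<partial>M)) * n + ?k * K" by (simp add: algebra_simps)
    also have "\<dots> \<le> (a + e) * n + e * n + ?k * K"
      using K unfolding bad by (intro add_mono mult_right_mono) auto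
    finally show ?thesis .
  qed
  have "block_entropy n / n \<le> a + e' + ?k * K / n" if "n \<ge> 1" for n
    using le[of n] that by (simp add: e_def field_simps)
  moreover have "(\<lambda>n. a + e' + ?k * K / real n) \<longlonglongrightarrow> a + e'"
    by real_asymp
  ultimately show "entropy_rate \<le> a + e'"
    by (intro LIMSEQ_le[OF block_entropy_tendsto]) auto
qed

end

context ergodic_labelled_system
begin

text \<open>The event that initial blocks are infinitely often too likely is forward invariant, hence null or
  almost sure by ergodicity; in the second case the entropy rate would be smaller.\<close>

theorem word_prob_eventually_le:
  fixes b :: real
  assumes b: "0 \<le> b" "b < entropy_rate"
  shows "AE x in M. \<forall>\<^sub>F n in sequentially. word_prob (itinerary n x) < exp (- b * n)"
proof -
  obtain a where a: "b < a" "a < entropy_rate" using b dense by blast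
  \<comment> \<open>Shifting a point costs a little of the rate, so the rates below \<open>a\<close> are taken together; for a
    fixed rate the event would not be forward invariant.\<close>
  define r where "r j = a - 1 / (real j + 1)" for j :: nat
  define P where "P x \<longleftrightarrow> (\<exists>j. \<exists>\<^sub>F n in sequentially. exp (- r j * real n) \<le> word_prob (itinerary n x))" for x
  have "(AE x in M. P x) \<or> (AE x in M. \<not> P x)"
  proof (rule AE_forward_invariant_cases)
    show "Measurable.pred M P"
      unfolding P_def[abs_def] frequently_sequentially by measurable
  next
    fix x assume x: "x \<in> space M" "P x"
    then obtain j where j: "\<exists>\<^sub>F n in sequentially. exp (- r j * real n) \<le> word_prob (itinerary n x)"
      by (auto simp: P_def)
    have d: "0 < r (Suc j) - r j" by (simp add: r_def frac_less2)
    obtain N0 :: nat where N0: "r (Suc j) / (r (Suc j) - r j) < N0" using reals_Archimedean2 by blast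
    have "\<exists>n\<ge>N. exp (- r (Suc j) * real n) \<le> word_prob (itinerary n (T x))" for N
    proof -
      obtain n where n: "n \<ge> Suc (N + N0)" "exp (- r j * real n) \<le> word_prob (itinerary n x)"
        using j by (auto simp: frequently_sequentially)
      then obtain m where m: "n = 1 + m" "m \<ge> N" by (cases n) auto
      have "r (Suc j) / (r (Suc j) - r j) < n" using N0 n by linarith
      then have "r (Suc j) < n * (r (Suc j) - r j)" using d by (simp add: field_simps)
      then have "exp (- r (Suc j) * real m) \<le> exp (- r j * real n)" by (simp add: m algebra_simps)
      also have "\<dots> \<le> word_prob (itinerary (1 + m) x)" using n m by simp
      also have "\<dots> \<le> word_prob (itinerary m (T x))" using word_prob_append_le(2)[OF x(1), of 1 m] by simp
      finally show ?thesis using m by blast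
    qed
    then show "P (T x)" unfolding P_def frequently_sequentially by blast
  qed
  then show ?thesis
  proof
    assume "AE x in M. P x"
    then have "AE x in M. \<exists>\<^sub>F n in sequentially. exp (- a * n) \<le> word_prob (itinerary n x)"
    proof eventually_elim
      case (elim x)
      then obtain j where j: "\<exists>\<^sub>F n in sequentially. exp (- r j * real n) \<le> word_prob (itinerary n x)"
        by (auto simp: P_def)
      show ?case
      proof (rule frequently_mono[OF _ j], intro allI impI)
        fix n :: nat
        have "r j * n \<le> a * n" by (intro mult_right_mono) (auto simp: r_def)
        then have "exp (- a * n) \<le> exp (- r j * n)" by simp
        then show "exp (- r j * n) \<le> word_prob (itinerary n x) \<Longrightarrow> exp (- a * n) \<le> word_prob (itinerary n x)"
          by linarith
      qed
    qed
    then have "entropy_rate \<le> a" using a b by (intro entropy_rate_le_of_recurrent_blocks) auto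
    then show ?thesis using a by simp
  next
    assume "AE x in M. \<not> P x"
    then show ?thesis
    proof eventually_elim
      case (elim x)
      obtain j :: nat where "1 / (real j + 1) < a - b"
        using reals_Archimedean[of "a - b"] a by (auto simp: inverse_eq_divide add.commute)
      then have j: "b \<le> r j" by (simp add: r_def)
      have "\<forall>\<^sub>F n in sequentially. word_prob (itinerary n x) < exp (- r j * n)"
        using elim by (simp add: P_def not_frequently not_le)
      then show ?case
      proof eventually_elim
        case (elim n)
        have "b * n \<le> r j * n" using j by (intro mult_right_mono) auto
        then have "exp (- r j * n) \<le> exp (- b * n)" by simp
        then show ?case using elim by linarith
      qed
    qed
  qed
qed

end

section \<open>The Kolmogorov-Sinai theorem\<close>

context labelled_system
begin

lemma itinerary_eq_iff:
  "itinerary n x = w \<longleftrightarrow> length w = n \<and> (\<forall>k<n. c ((T ^^ k) x) = w ! k)"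
  by (auto simp: list_eq_iff_nth_eq nth_itinerary)

lemma iterated_join_eq:
  "iterated_join M T ((\<lambda>a. {x \<in> space M. c x = a}) ` C) n = (\<lambda>w. {x \<in> space M. itinerary n x = w}) ` words n"
  (is "iterated_join M T ?P n = ?R")
proof
  have Tk: "(T ^^ k) x \<in> space M" if "x \<in> space M" for k x
    using measurable_space[OF funpow_measurable that] .
  show "iterated_join M T ?P n \<subseteq> ?R"
  proof
    fix A assume "A \<in> iterated_join M T ?P n"
    then obtain F where F: "F \<in> (\<Pi>\<^sub>E k\<in>{..<n}. ?P)" "A = {x \<in> space M. \<forall>k<n. (T ^^ k) x \<in> F k}"
      by (auto simp: iterated_join_def)
    then have "\<forall>k\<in>{..<n}. \<exists>a. a \<in> C \<and> F k = {x \<in> space M. c x = a}" by (auto simp: PiE_iff image_iff)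
    from bchoice[OF this] obtain a
      where "\<forall>k\<in>{..<n}. a k \<in> C \<and> F k = {x \<in> space M. c x = a k}" by blast
    then have a: "\<And>k. k < n \<Longrightarrow> a k \<in> C" "\<And>k. k < n \<Longrightarrow> F k = {x \<in> space M. c x = a k}"
      by auto
    let ?w = "map a [0..<n]"
    have "?w \<in> words n" using a by (auto simp: words_def)
    moreover have "A = {x \<in> space M. itinerary n x = ?w}"
      using F(2) a(2) Tk by (auto simp: itinerary_eq_iff)
    ultimately show "A \<in> ?R" by blast
  qed
  show "?R \<subseteq> iterated_join M T ?P n"
  proof
    fix A assume "A \<in> ?R"
    then obtain w where w: "w \<in> words n" "A = {x \<in> space M. itinerary n x = w}" by blast
    define F where "F = (\<lambda>k\<in>{..<n}. {x \<in> space M. c x = w ! k})"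
    have "w ! k \<in> C" if "k < n" for k using w that by (auto simp: words_def dest: nth_mem)
    then have "F \<in> (\<Pi>\<^sub>E k\<in>{..<n}. ?P)" by (auto simp: F_def)
    moreover have "A = {x \<in> space M. \<forall>k<n. (T ^^ k) x \<in> F k}"
      using w Tk by (auto simp: F_def itinerary_eq_iff words_def)
    ultimately show "A \<in> iterated_join M T ?P n" unfolding iterated_join_def by blast
  qed
qed

lemma partition_entropy_iterated_join:
  "partition_entropy M (iterated_join M T ((\<lambda>a. {x \<in> space M. c x = a}) ` C) n) = block_entropy n"
proof -
  let ?h = "\<lambda>w. {x \<in> space M. itinerary n x = w}"
  let ?g = "\<lambda>A. measure M A * ln (measure M A)"
  have "sum ?g (?h ` words n) = sum (?g \<circ> ?h) (words n)"
  proof (rule sum.reindex_nontrivial[OF finite_words])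
    fix v w assume "v \<noteq> w" "?h v = ?h w"
    then have "?h v = {}" by auto
    then show "?g (?h v) = 0" by (simp only: measure_empty mult_zero_left)
  qed
  also have "\<dots> = - block_entropy n"
    unfolding block_entropy_def sum_negf[symmetric]
    by (intro sum.cong refl) (auto simp: words_def word_prob_def)
  finally show ?thesis by (simp add: partition_entropy_def iterated_join_eq)
qed

lemma entropy_wrt_label_partition:
  "entropy_wrt_partition M T ((\<lambda>a. {x \<in> space M. c x = a}) ` C) = entropy_rate"
  by (simp add: entropy_wrt_partition_def partition_entropy_iterated_join entropy_rate_def)

text \<open>An observer of the letter \<open>b'\<close> reports a wrong letter with total weight at most \<open>\<delta>\<close>, spread
  uniformly. Every letter keeps a positive weight, so that coding with it has finite cost.\<close>

definition noise :: "real \<Rightarrow> 'b \<Rightarrow> 'b \<Rightarrow> real" where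
  "noise \<delta> b' b = (if b = b' then 1 - \<delta> else \<delta> / card C)"

lemma sum_noise: "0 \<le> \<delta> \<Longrightarrow> \<delta> \<le> 1 \<Longrightarrow> (\<Sum>b\<in>C. noise \<delta> b' b) \<le> 1"
proof -
  assume d: "0 \<le> \<delta>" "\<delta> \<le> 1"
  have "(\<Sum>b\<in>C. noise \<delta> b' b) \<le> (\<Sum>b\<in>C. (if b = b' then 1 - \<delta> else 0) + \<delta> / card C)"
    using d by (intro sum_mono) (auto simp: noise_def)
  also have "\<dots> \<le> 1" using d finite_labels labels_pos by (simp add: sum.distrib)
  finally show ?thesis .
qed

text \<open>The letters that the noisy observer sees are \<open>g\<close> applied to the successive windows of length
  \<open>k\<close> of \<open>v\<close>; this is the conditional distribution of the report.\<close>

primrec noisy_word :: "real \<Rightarrow> nat \<Rightarrow> ('c list \<Rightarrow> 'b) \<Rightarrow> 'b list \<Rightarrow> 'c list \<Rightarrow> real" where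
  "noisy_word \<delta> k g [] v = 1"
| "noisy_word \<delta> k g (b # w) v = noise \<delta> (g (take k v)) b * noisy_word \<delta> k g w (tl v)"

lemma noisy_word_pos: "0 < \<delta> \<Longrightarrow> \<delta> < 1 \<Longrightarrow> 0 < noisy_word \<delta> k g w v"
  using labels_pos by (induction w arbitrary: v) (auto simp: noise_def)

lemma sum_noisy_word:
  assumes "0 < \<delta>" "\<delta> < 1" shows "(\<Sum>w\<in>words n. noisy_word \<delta> k g w v) \<le> 1"
proof (induction n arbitrary: v)
  case (Suc n)
  have "(\<Sum>w\<in>words (Suc n). noisy_word \<delta> k g w v)
      = (\<Sum>b\<in>C. noise \<delta> (g (take k v)) b) * (\<Sum>w\<in>words n. noisy_word \<delta> k g w (tl v))"
    unfolding sum_words_Suc noisy_word.simps sum_product by (rule sum.swap)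
  also have "\<dots> \<le> 1 * 1"
    using assms by (intro mult_mono sum_noise Suc sum_nonneg) (auto simp: less_imp_le[OF noisy_word_pos])
  finally show ?case by simp
qed (simp add: words_0)

text \<open>The code transmits the itinerary of the other labelling and then corrects the guesses that \<open>g\<close>
  makes from its windows of length \<open>k\<close>. The corrections cost little, because a wrong guess occurs
  with probability at most \<open>\<epsilon>\<close>.\<close>

lemma block_entropy_le_other:
  fixes c' :: "'a \<Rightarrow> 'c" and \<delta> :: real
  assumes "labelled_system M T c' C'"
    and \<delta>: "0 < \<delta>" "\<delta> < 1"
  defines "it \<equiv> labelled_system.itinerary T c'"
  assumes g: "measure M {x \<in> space M. c x \<noteq> g (it k x)} \<le> \<epsilon>"
  shows "block_entropy n \<le> labelled_system.block_entropy M T c' C' (n + k) +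
    n * (- ln (1 - \<delta>) + \<epsilon> * ln (card C / \<delta>))"
proof -
  interpret O: labelled_system M T c' C' by fact
  note g = g[unfolded it_def]
  have card: "1 \<le> real (card C)" using labels_pos by simp
  then have ln_card: "0 \<le> ln (card C / \<delta>)" using \<delta> by (intro ln_ge_zero) (auto simp: field_simps)
  define q where "q w = (\<Sum>v\<in>O.words (n + k). O.word_prob v * noisy_word \<delta> k g w v)" for w
  define F where "F x = - ln (1 - \<delta>) + of_bool (c x \<noteq> g (O.itinerary k x)) * ln (card C / \<delta>)" for x
  have [measurable]: "Measurable.pred M (\<lambda>x. c x \<noteq> g (O.itinerary k x))"
  proof -
    have "Measurable.pred M (\<lambda>x. \<exists>v\<in>O.words k. O.itinerary k x = v \<and> c x \<noteq> g v)"
      using O.finite_words O.pred_itinerary pred_label by (intro pred_intros_finite pred_intros_logic) auto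
    then show ?thesis
      by (rule measurable_cong[THEN iffD1, rotated]) (auto simp: O.itinerary_in_words)
  qed
  have bad_int: "integrable M (\<lambda>x. of_bool (c x \<noteq> g (O.itinerary k x)) :: real)"
    by (rule integrable_const_bound[of _ 1]) auto
  have F_int: "integrable M F"
    unfolding F_def using bad_int by auto
  have "(\<integral>x. of_bool (c x \<noteq> g (O.itinerary k x)) \<partial>M) = measure M {x \<in> space M. c x \<noteq> g (O.itinerary k x)}"
  proof -
    have "measure M {x \<in> space M. c x \<noteq> g (O.itinerary k x)} = (\<integral>x. indicator {x \<in> space M. c x \<noteq> g (O.itinerary k x)} x \<partial>M)"
      by (simp add: Int_def conj_commute)
    also have "\<dots> = (\<integral>x. of_bool (c x \<noteq> g (O.itinerary k x)) \<partial>M)"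
      by (intro Bochner_Integration.integral_cong) (auto simp: indicator_def)
    finally show ?thesis by simp
  qed
  then have F_le: "(\<integral>x. F x \<partial>M) \<le> - ln (1 - \<delta>) + \<epsilon> * ln (card C / \<delta>)"
    unfolding F_def
    by (subst Bochner_Integration.integral_add)
       (use g ln_card bad_int in \<open>auto simp: prob_space intro!: mult_right_mono\<close>)
  have noise_F: "- ln (noise \<delta> (g (O.itinerary k x)) (c x)) \<le> F x" for x
    using \<delta> card by (auto simp: noise_def F_def ln_div)
  have noisy_F: "- ln (noisy_word \<delta> k g (itinerary n x) (O.itinerary (n + k) x)) \<le> birkhoff_sum F n x" for n x
  proof (induction n arbitrary: x)
    case 0
    then show ?case by (simp add: birkhoff_sum_def)
  next
    case (Suc n)
    have "0 < noise \<delta> (g (O.itinerary k x)) (c x)" using \<delta> card by (auto simp: noise_def)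
    then show ?case
      using Suc[of "T x"] noise_F[of x] noisy_word_pos[OF \<delta>, of k g "itinerary n (T x)" "O.itinerary (n + k) (T x)"]
        O.take_itinerary[of k "Suc (n + k)" x]
      by (simp add: birkhoff_sum_Suc ln_mult_pos)
  qed
  have bs: "integrable M (birkhoff_sum F n)" "(\<integral>x. birkhoff_sum F n x \<partial>M) = n * (\<integral>x. F x \<partial>M)"
    unfolding birkhoff_sum_def[abs_def]
    using integrable_funpow[OF F_int] integral_funpow[OF F_int] by auto
  have info: "integrable M (\<lambda>x. - ln (O.word_prob (O.itinerary (n + k) x)))"
    by (rule O.integrable_itinerary[of "\<lambda>v. - ln (O.word_prob v)"])
  have "block_entropy n \<le> (\<integral>x. - ln (q (itinerary n x)) \<partial>M)"
  proof (rule block_entropy_le)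
    fix w
    show "0 \<le> q w" unfolding q_def
      using noisy_word_pos[OF \<delta>, of k g w] by (intro sum_nonneg mult_nonneg_nonneg) (auto intro: less_imp_le)
    have "0 \<noteq> q w"
    proof
      assume "0 = q w"
      then have "\<forall>v\<in>O.words (n + k). O.word_prob v * noisy_word \<delta> k g w v = 0"
        unfolding q_def using noisy_word_pos[OF \<delta>, of k g w]
        by (subst (asm) eq_commute, subst (asm) sum_nonneg_eq_0_iff[OF O.finite_words])
           (auto intro!: mult_nonneg_nonneg intro: less_imp_le)
      then have "\<forall>v\<in>O.words (n + k). O.word_prob v = 0"
        using noisy_word_pos[OF \<delta>, of k g w] by (metis less_irrefl mult_eq_0_iff)
      then show False using O.sum_word_prob[of "n + k"] by simp
    qed
    then show "0 < q w" using \<open>0 \<le> q w\<close> by simp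
  next
    have "(\<Sum>w\<in>words n. q w) = (\<Sum>v\<in>O.words (n + k). O.word_prob v * (\<Sum>w\<in>words n. noisy_word \<delta> k g w v))"
      unfolding q_def sum_distrib_left by (rule sum.swap)
    also have "\<dots> \<le> (\<Sum>v\<in>O.words (n + k). O.word_prob v * 1)"
      by (intro sum_mono mult_left_mono sum_noisy_word \<delta>) auto
    also have "\<dots> = 1" using O.sum_word_prob by simp
    finally show "(\<Sum>w\<in>words n. q w) \<le> 1" .
  qed
  also have "\<dots> \<le> (\<integral>x. - ln (O.word_prob (O.itinerary (n + k) x)) + birkhoff_sum F n x \<partial>M)"
  proof (rule integral_mono_AE)
    show "integrable M (\<lambda>x. - ln (q (itinerary n x)))"
      by (rule integrable_itinerary[of "\<lambda>w. - ln (q w)"])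
    show "AE x in M. - ln (q (itinerary n x)) \<le> - ln (O.word_prob (O.itinerary (n + k) x)) + birkhoff_sum F n x"
      using O.AE_word_prob_pos AE_space
    proof eventually_elim
      case (elim x)
      let ?v = "O.itinerary (n + k) x"
      have p: "0 < O.word_prob ?v" using elim by auto
      have r: "0 < noisy_word \<delta> k g (itinerary n x) ?v" by (rule noisy_word_pos[OF \<delta>])
      have "O.word_prob ?v * noisy_word \<delta> k g (itinerary n x) ?v \<le> q (itinerary n x)"
        unfolding q_def using elim noisy_word_pos[OF \<delta>, of k g "itinerary n x"]
        by (intro member_le_sum[of ?v "O.words (n + k)" "\<lambda>v. O.word_prob v * noisy_word \<delta> k g (itinerary n x) v"])
           (auto simp: O.itinerary_in_words O.finite_words less_imp_le)
      then have "ln (O.word_prob ?v * noisy_word \<delta> k g (itinerary n x) ?v) \<le> ln (q (itinerary n x))"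
        using p r by (intro ln_mono) auto
      then show ?case using p r noisy_F[of n x] by (simp add: ln_mult_pos)
    qed
  qed (intro Bochner_Integration.integrable_add info bs)
  also have "\<dots> = O.block_entropy (n + k) + n * (\<integral>x. F x \<partial>M)"
    unfolding Bochner_Integration.integral_add[OF info bs(1)] bs(2) O.block_entropy_eq ..
  also have "\<dots> \<le> O.block_entropy (n + k) + n * (- ln (1 - \<delta>) + \<epsilon> * ln (card C / \<delta>))"
    by (intro add_left_mono mult_left_mono F_le) auto
  finally show ?thesis .
qed

definition approximable :: "'a set \<Rightarrow> bool" where
  "approximable A \<longleftrightarrow> A \<in> sets M \<and>
     (\<forall>e>0. \<exists>k S. measure M {x \<in> space M. (x \<in> A) \<noteq> (itinerary k x \<in> S)} < e)"

lemma sets_approx_error: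
  assumes "A \<in> sets M"
  shows "{x \<in> space M. (x \<in> A) \<noteq> (itinerary k x \<in> S)} \<in> sets M"
proof -
  let ?B = "itinerary k -` S \<inter> space M"
  have "?B \<in> sets M" by (rule measurable_sets[OF itinerary_measurable]) simp
  then have "(A - ?B) \<union> (?B - A) \<in> sets M" using assms by blast
  also have "(A - ?B) \<union> (?B - A) = {x \<in> space M. (x \<in> A) \<noteq> (itinerary k x \<in> S)}"
    using sets.sets_into_space[OF assms] by blast
  finally show ?thesis .
qed

lemma approximable_common_length:
  fixes A :: "'i \<Rightarrow> 'a set"
  assumes I: "finite I" and A: "\<And>i. i \<in> I \<Longrightarrow> approximable (A i)" and e: "0 < e"
  obtains k S where "measure M (\<Union>i\<in>I. {x \<in> space M. (x \<in> A i) \<noteq> (itinerary k x \<in> S i)}) < e"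
proof -
  have "\<exists>kS. i \<in> I \<longrightarrow> measure M {x \<in> space M. (x \<in> A i) \<noteq> (itinerary (fst kS) x \<in> snd kS)} < e / (card I + 1)" for i
      proof (cases "i \<in> I")
    case True
    then have "\<exists>k S. measure M {x \<in> space M. (x \<in> A i) \<noteq> (itinerary k x \<in> S)} < e / (card I + 1)"
      using A[OF True] e unfolding approximable_def by simp
    then show ?thesis by force
  qed simp
  then have "\<forall>i. \<exists>kS. i \<in> I \<longrightarrow> measure M {x \<in> space M. (x \<in> A i) \<noteq> (itinerary (fst kS) x \<in> snd kS)} < e / (card I + 1)"
    by blast
  from choice[OF this] obtain kS where kS: "\<And>i. i \<in> I \<Longrightarrow>
      measure M {x \<in> space M. (x \<in> A i) \<noteq> (itinerary (fst (kS i)) x \<in> snd (kS i))} < e / (card I + 1)"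
    by blast
  let ?E = "\<lambda>i. {x \<in> space M. (x \<in> A i) \<noteq> (itinerary (fst (kS i)) x \<in> snd (kS i))}"
  define k where "k = (\<Sum>i\<in>I. fst (kS i))"
  have k: "fst (kS i) \<le> k" if "i \<in> I" for i
    unfolding k_def using I that by (intro member_le_sum) auto
  have "measure M (\<Union>i\<in>I. ?E i) \<le> (\<Sum>i\<in>I. measure M (?E i))"
    using A by (intro finite_measure_subadditive_finite I image_subsetI sets_approx_error) (simp add: approximable_def)
  also have "\<dots> \<le> (\<Sum>i\<in>I. e / (card I + 1))" by (intro sum_mono less_imp_le kS)
  also have "\<dots> < e" using e by (simp add: field_simps)
  finally have "measure M (\<Union>i\<in>I. ?E i) < e" .
  moreover have "(\<Union>i\<in>I. ?E i) =
      (\<Union>i\<in>I. {x \<in> space M. (x \<in> A i) \<noteq> (itinerary k x \<in> {w. take (fst (kS i)) w \<in> snd (kS i)})})"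
    using k by (auto simp: take_itinerary)
  ultimately show thesis by (intro that[of k "\<lambda>i. {w. take (fst (kS i)) w \<in> snd (kS i)}"]) simp
qed

lemma approximable_compl:
  assumes "approximable A" shows "approximable (space M - A)"
proof -
  have "\<exists>k S. measure M {x \<in> space M. (x \<in> space M - A) \<noteq> (itinerary k x \<in> S)} < e" if "e > 0" for e
  proof -
    have "\<exists>k S. measure M {x \<in> space M. (x \<in> A) \<noteq> (itinerary k x \<in> S)} < e"
      using assms that unfolding approximable_def by blast
    then obtain k S where "measure M {x \<in> space M. (x \<in> A) \<noteq> (itinerary k x \<in> S)} < e" by blast
    moreover have "{x \<in> space M. (x \<in> A) \<noteq> (itinerary k x \<in> S)} =
        {x \<in> space M. (x \<in> space M - A) \<noteq> (itinerary k x \<in> - S)}" by auto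
    ultimately show ?thesis by (intro exI[of _ k] exI[of _ "- S"]) (simp only:)
  qed
  then show ?thesis using assms by (auto simp: approximable_def)
qed

lemma approximable_UN:
  fixes A :: "nat \<Rightarrow> 'a set"
  assumes A: "\<And>i. approximable (A i)" shows "approximable (\<Union>i. A i)"
proof -
  have sets [measurable]: "A i \<in> sets M" for i using A by (simp add: approximable_def)
  have "\<exists>k S. measure M {x \<in> space M. (x \<in> (\<Union>i. A i)) \<noteq> (itinerary k x \<in> S)} < e" if e: "e > 0" for e
  proof -
    have "(\<lambda>n. measure M (\<Union>i<n. A i)) \<longlonglongrightarrow> measure M (\<Union>n. \<Union>i<n. A i)"
    proof (rule finite_Lim_measure_incseq)
      show "incseq (\<lambda>n. \<Union>i<n. A i)" by (rule incseq_SucI, rule UN_mono) auto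
    qed auto
    moreover have "(\<Union>n. \<Union>i<n. A i) = (\<Union>i. A i)" by auto
    ultimately have "(\<lambda>n. measure M (\<Union>i<n. A i)) \<longlonglongrightarrow> measure M (\<Union>i. A i)" by simp
    then have "\<forall>\<^sub>F n in sequentially. measure M (\<Union>i. A i) - e / 2 < measure M (\<Union>i<n. A i)"
      by (rule order_tendstoD) (use e in simp)
    then obtain n where n: "measure M (\<Union>i. A i) - e / 2 < measure M (\<Union>i<n. A i)"
      by (auto simp: eventually_sequentially)
    obtain k S where S: "measure M (\<Union>i\<in>{..<n}. {x \<in> space M. (x \<in> A i) \<noteq> (itinerary k x \<in> S i)}) < e / 2"
      by (rule approximable_common_length[of "{..<n}" A "e / 2"]) (use A e in auto)
    let ?E = "\<Union>i\<in>{..<n}. {x \<in> space M. (x \<in> A i) \<noteq> (itinerary k x \<in> S i)}"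
    let ?D = "(\<Union>i. A i) - (\<Union>i<n. A i)"
    have E: "?E \<in> sets M" by (intro sets.finite_UN sets_approx_error) auto
    have D: "measure M ?D < e / 2" using n by (subst finite_measure_Diff) auto
    have "measure M {x \<in> space M. (x \<in> (\<Union>i. A i)) \<noteq> (itinerary k x \<in> (\<Union>i<n. S i))} \<le> measure M (?E \<union> ?D)"
      by (rule finite_measure_mono) (use E in auto)
    also have "\<dots> \<le> measure M ?E + measure M ?D" using E by (intro measure_Un_le) auto
    also have "\<dots> < e" using S D by linarith
    finally show ?thesis by blast
  qed
  then show ?thesis by (auto simp: approximable_def)
qed

lemma approximable_letter: "approximable {x \<in> space M. c ((T ^^ k) x) \<in> A}"
proof -
  let ?A = "{x \<in> space M. c ((T ^^ k) x) \<in> A}" and ?S = "{w. w ! k \<in> A}"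
  have eq: "itinerary (Suc k) x \<in> ?S \<longleftrightarrow> c ((T ^^ k) x) \<in> A" for x
    by (simp add: nth_itinerary del: itinerary.simps)
  have "itinerary (Suc k) -` ?S \<inter> space M \<in> sets M"
    by (rule measurable_sets[OF itinerary_measurable]) simp
  also have "itinerary (Suc k) -` ?S \<inter> space M = ?A" using eq by blast
  finally have "?A \<in> sets M" .
  moreover have "{x \<in> space M. (x \<in> ?A) \<noteq> (itinerary (Suc k) x \<in> ?S)} = {}" using eq by blast
  ultimately have "measure M {x \<in> space M. (x \<in> ?A) \<noteq> (itinerary (Suc k) x \<in> ?S)} = 0"
    by (simp only: measure_empty)
  then show ?thesis
    unfolding approximable_def using \<open>?A \<in> sets M\<close>
    by (intro conjI allI impI exI[of _ "Suc k"] exI[of _ ?S]) simp_all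
qed

text \<open>Every event is approximated by cylinders of the generating labelling, so any other label is a
  function of a long itinerary up to a small error, and correcting it costs little.\<close>

lemma entropy_rate_le_generator:
  fixes c' :: "'a \<Rightarrow> 'c"
  assumes O: "labelled_system M T c' C'"
    and gen: "\<And>A. A \<in> sets M \<Longrightarrow> labelled_system.approximable M T c' A"
  shows "entropy_rate \<le> labelled_system.entropy_rate M T c' C'"
proof (rule field_le_epsilon)
  fix e :: real assume e: "0 < e"
  interpret O: labelled_system M T c' C' by fact
  \<comment> \<open>The noise level is fixed first, so that correct letters cost \<open>e / 2\<close>; then the error set is made so
    small that the wrong letters cost at most another \<open>e / 2\<close>.\<close>
  define \<delta> where "\<delta> = 1 - exp (- e / 2)"
  have \<delta>: "0 < \<delta>" "\<delta> < 1" using e by (auto simp: \<delta>_def)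
  have l: "0 \<le> ln (card C / \<delta>)"
    using \<delta> labels_pos by (intro ln_ge_zero) (auto simp: field_simps intro: order_trans[of _ 1])
  define \<epsilon> where "\<epsilon> = (e / 2) / (1 + ln (card C / \<delta>))"
  have "0 < \<epsilon>" using e l by (simp add: \<epsilon>_def)
  have "O.approximable {x \<in> space M. c x = a}" for a
    using pred_label[of a] by (intro gen) (simp add: pred_def)
  then obtain k S where S: "measure M (\<Union>a\<in>C. {x \<in> space M. (x \<in> {x \<in> space M. c x = a}) \<noteq> (O.itinerary k x \<in> S a)}) < \<epsilon>"
    using O.approximable_common_length[OF finite_labels, of "\<lambda>a. {x \<in> space M. c x = a}" \<epsilon>] \<open>0 < \<epsilon>\<close> by metis
  define g where "g w = (SOME a. a \<in> C \<and> w \<in> S a)" for w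
  have "measure M {x \<in> space M. c x \<noteq> g (O.itinerary k x)}
      \<le> measure M (\<Union>a\<in>C. {x \<in> space M. (x \<in> {x \<in> space M. c x = a}) \<noteq> (O.itinerary k x \<in> S a)})"
  proof (rule finite_measure_mono)
    show "{x \<in> space M. c x \<noteq> g (O.itinerary k x)}
      \<subseteq> (\<Union>a\<in>C. {x \<in> space M. (x \<in> {x \<in> space M. c x = a}) \<noteq> (O.itinerary k x \<in> S a)})"
    proof (rule ccontr)
      assume "\<not> ?thesis"
      then obtain x where x: "x \<in> space M" "c x \<noteq> g (O.itinerary k x)"
        "\<And>a. a \<in> C \<Longrightarrow> c x = a \<longleftrightarrow> O.itinerary k x \<in> S a" by auto
      have "g (O.itinerary k x) = c x"
        unfolding g_def using x(3) label_in[OF x(1)] by (intro some_equality) auto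
      then show False using x(2) by simp
    qed
    show "(\<Union>a\<in>C. {x \<in> space M. (x \<in> {x \<in> space M. c x = a}) \<noteq> (O.itinerary k x \<in> S a)}) \<in> sets M"
      using pred_label by (intro sets.finite_UN finite_labels O.sets_approx_error) (simp add: pred_def)
  qed
  then have g: "measure M {x \<in> space M. c x \<noteq> g (O.itinerary k x)} \<le> \<epsilon>" using S by linarith
  have "- ln (1 - \<delta>) + \<epsilon> * ln (card C / \<delta>) \<le> e / 2 + e / 2"
  proof (rule add_mono)
    show "\<epsilon> * ln (card C / \<delta>) \<le> e / 2"
      unfolding \<epsilon>_def using e l by (simp add: field_simps)
  qed (simp add: \<delta>_def)
  then have le: "block_entropy n \<le> O.block_entropy (n + k) + n * e" for n
    using block_entropy_le_other[OF O \<delta> g, of n] mult_left_mono[of _ "e" "real n"]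
    by (smt (verit) field_sum_of_halves of_nat_0_le_iff)
  have lim: "(\<lambda>n. O.block_entropy (n + k) / (n + k) * ((n + k) / n) + e) \<longlonglongrightarrow> O.entropy_rate * 1 + e"
  proof (intro tendsto_intros)
    show "(\<lambda>n. O.block_entropy (n + k) / (n + k)) \<longlonglongrightarrow> O.entropy_rate"
      using LIMSEQ_ignore_initial_segment[OF O.block_entropy_tendsto, of k] by simp
    show "(\<lambda>n. real (n + k) / real n) \<longlonglongrightarrow> 1" by real_asymp
  qed
  have "block_entropy n / n \<le> O.block_entropy (n + k) / (n + k) * ((n + k) / n) + e" if "n \<ge> 1" for n
  proof -
    have "O.block_entropy (n + k) / (n + k) * ((n + k) / n) = O.block_entropy (n + k) / n"
      using that by simp
    moreover have "block_entropy n / n \<le> (O.block_entropy (n + k) + n * e) / n"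
      by (intro divide_right_mono le) auto
    ultimately show ?thesis using that by (simp add: add_divide_distrib)
  qed
  then show "entropy_rate \<le> O.entropy_rate + e"
    by (intro LIMSEQ_le[OF block_entropy_tendsto lim[unfolded mult_1_right]] exI[of _ 1]) blast
qed

theorem ks_entropy_generator:
  assumes gen: "\<And>A. A \<in> sets M \<Longrightarrow> approximable A" and surj: "c ` space M = C"
  shows "ks_entropy M T = entropy_rate"
proof (rule antisym)
  let ?P = "(\<lambda>a. {x \<in> space M. c x = a}) ` C"
  have "partition_on (space M) ?P"
    using surj by (auto simp: partition_on_def disjoint_def)
  moreover have "?P \<subseteq> sets M" using pred_label by (auto simp: pred_def)
  ultimately show "ereal entropy_rate \<le> ks_entropy M T"
    unfolding ks_entropy_def using finite_labels
    by (intro SUP_upper2[of ?P]) (auto simp: entropy_wrt_label_partition)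
  show "ks_entropy M T \<le> ereal entropy_rate"
    unfolding ks_entropy_def
  proof (rule SUP_least, clarsimp)
    fix P assume P: "finite P" "P \<subseteq> sets M" "partition_on (space M) P"
    define b where "b x = (THE B. B \<in> P \<and> x \<in> B)" for x
    have b: "b x = B" if "x \<in> B" "B \<in> P" for x B
      unfolding b_def using P(3) that by (intro the_equality) (auto simp: partition_on_def disjoint_def)
    have cover: "\<exists>B\<in>P. x \<in> B" if "x \<in> space M" for x
      using P(3) that by (auto simp: partition_on_def)
    have level: "{x \<in> space M. b x = B} = B" if "B \<in> P" for B
      using P(3) that b cover by (force simp: partition_on_def)
    interpret B: labelled_system M T b P
    proof
      show "b \<in> measurable M (count_space P)"
      proof (subst measurable_count_space_eq2[OF P(1)], safe)
        fix x assume "x \<in> space M"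
        then show "b x \<in> P" using cover b by metis
      next
        fix B assume "B \<in> P"
        then show "b -` {B} \<inter> space M \<in> sets M"
          using level[of B] P(2) by (auto simp: vimage_def Int_def conj_commute)
      qed
    qed (fact P)
    have "entropy_wrt_partition M T P = B.entropy_rate"
    proof -
      have "(\<lambda>a. {x \<in> space M. b x = a}) ` P = P" using level by auto
      then show ?thesis using B.entropy_wrt_label_partition by simp
    qed
    also have "\<dots> \<le> entropy_rate"
      by (rule B.entropy_rate_le_generator[OF labelled_system_axioms gen])
    finally show "entropy_wrt_partition M T P \<le> entropy_rate" .
  qed
qed

end

section \<open>Bounds for the Hausdorff dimension of a measure\<close>

lemma hausdorff_content_le_nn_integral:
  fixes U :: "'i::countable \<Rightarrow> 'a::metric_space set"
  assumes cover: "A \<subseteq> (\<Union>i. U i)" and U: "\<And>i. bounded (U i)" "\<And>i. diameter (U i) \<le> \<delta>" and "0 \<le> \<delta>"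
  shows "hausdorff_content \<delta> s A \<le> (\<integral>\<^sup>+i. ennreal (diam_power s (U i)) \<partial>count_space UNIV)"
proof -
  let ?e = "to_nat :: 'i \<Rightarrow> nat"
  define V where "V k = (if k \<in> range ?e then U (from_nat k) else {})" for k
  have "hausdorff_content \<delta> s A \<le> (\<Sum>k. ennreal (diam_power s (V k)))"
    unfolding hausdorff_content_def
  proof (rule INF_lower, safe)
    fix x assume "x \<in> A"
    then obtain i where "x \<in> U i" using cover by blast
    then have "x \<in> V (to_nat i)" by (simp add: V_def)
    then show "x \<in> (\<Union>k. V k)" by blast
  qed (use U \<open>0 \<le> \<delta>\<close> in \<open>auto simp: V_def\<close>)
  also have "\<dots> = (\<integral>\<^sup>+k. ennreal (diam_power s (V k)) \<partial>count_space UNIV)"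
    by (rule nn_integral_count_space_nat[symmetric])
  also have "\<dots> = (\<integral>\<^sup>+k. ennreal (diam_power s (V k)) \<partial>count_space (range ?e))"
    by (subst nn_integral_count_space_indicator[of "range ?e"])
       (auto intro!: nn_integral_cong simp: V_def diam_power_def indicator_def)
  also have "\<dots> = (\<integral>\<^sup>+i. ennreal (diam_power s (V (?e i))) \<partial>count_space UNIV)"
    by (rule nn_integral_bij_count_space[symmetric]) (simp add: inj_on_imp_bij_betw inj_to_nat)
  finally show ?thesis by (simp add: V_def)
qed

text \<open>At every scale in a summable sequence of covers one may drop the first covers; the remaining
  ones still cover the points that lie in all but finitely many of them.\<close>

lemma measure_hausdorff_dim_le:
  fixes \<nu> :: "'a::metric_space measure" and V :: "nat \<Rightarrow> 'i::countable \<Rightarrow> 'a set"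
  assumes W: "\<And>n. finite (W n)"
    and V: "\<And>n w. w \<in> W n \<Longrightarrow> bounded (V n w)" "\<And>n w. w \<in> W n \<Longrightarrow> diameter (V n w) \<le> r n"
    and r: "\<And>n. 0 < r n" "r \<longlonglongrightarrow> 0"
    and s: "0 < s" and sum: "summable (\<lambda>n. card (W n) * r n powr s)"
    and AE: "AE x in \<nu>. \<forall>\<^sub>F n in sequentially. \<exists>w\<in>W n. x \<in> V n w"
  shows "measure_hausdorff_dim \<nu> \<le> ereal s"
proof -
  define A where "A = {x. \<forall>\<^sub>F n in sequentially. \<exists>w\<in>W n. x \<in> V n w}"
  have content: "hausdorff_content \<delta> s A \<le> ennreal e" if \<delta>: "0 < \<delta>" and e: "0 < e" for \<delta> e
  proof -
    have "\<forall>\<^sub>F n in sequentially. r n < \<delta>" using r(2) \<delta> by (rule order_tendstoD)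
    then obtain N1 where N1: "\<And>n. n \<ge> N1 \<Longrightarrow> r n < \<delta>" by (auto simp: eventually_sequentially)
    obtain N2 where N2: "\<And>n. n \<ge> N2 \<Longrightarrow> norm (\<Sum>i. card (W (i + n)) * r (i + n) powr s) < e"
      using suminf_exist_split[OF e sum] by auto
    define N where "N = max N1 N2"
    define U where "U = (\<lambda>(n, w). if n \<ge> N \<and> w \<in> W n then V n w else {})"
    let ?b = "\<lambda>n. if n < N then 0 else card (W n) * r n powr s"
    have "hausdorff_content \<delta> s A \<le> (\<integral>\<^sup>+p. ennreal (diam_power s (U p)) \<partial>count_space UNIV)"
    proof (rule hausdorff_content_le_nn_integral)
      show "A \<subseteq> (\<Union>p. U p)"
      proof
        fix x assume "x \<in> A"
        then obtain n0 where "\<And>n. n \<ge> n0 \<Longrightarrow> \<exists>w\<in>W n. x \<in> V n w"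
          by (auto simp: A_def eventually_sequentially)
        then obtain w where "w \<in> W (max n0 N)" "x \<in> V (max n0 N) w" by (metis max.cobounded1)
        then have "x \<in> U (max n0 N, w)" by (simp add: U_def)
        then show "x \<in> (\<Union>p. U p)" by blast
      qed
      show "bounded (U p)" for p using V by (auto simp: U_def split: prod.split)
      show "diameter (U p) \<le> \<delta>" for p
      proof (cases p)
        case (Pair n w)
        show ?thesis
        proof (cases "n \<ge> N \<and> w \<in> W n")
          case True
          then have "diameter (V n w) \<le> \<delta>" using V(2)[of w n] N1[of n] by (simp add: N_def)
          then show ?thesis using True Pair by (simp add: U_def)
        qed (use \<delta> Pair in \<open>auto simp: U_def\<close>)
      qed
    qed (use \<delta> in simp)
    also have "\<dots> = (\<integral>\<^sup>+n. \<integral>\<^sup>+w. ennreal (diam_power s (U (n, w))) \<partial>count_space UNIV \<partial>count_space UNIV)"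
      by (rule nn_integral_fst_count_space[symmetric])
    also have "\<dots> \<le> (\<integral>\<^sup>+n. ennreal (?b n) \<partial>count_space UNIV)"
    proof (rule nn_integral_mono)
      fix n :: nat
      show "(\<integral>\<^sup>+w. ennreal (diam_power s (U (n, w))) \<partial>count_space UNIV) \<le> ennreal (?b n)"
      proof (cases "n < N")
        case True
        then show ?thesis by (simp add: U_def diam_power_def)
      next
        case False
        have "ennreal (diam_power s (U (n, w))) \<le> ennreal (r n powr s) * indicator (W n) w" for w
        proof (cases "w \<in> W n")
          case True
          have "diameter (V n w) powr s \<le> r n powr s"
            using V[OF True] s by (intro powr_mono2) (auto simp: diameter_ge_0)
          then show ?thesis using True False s by (auto simp: U_def diam_power_def intro!: ennreal_leI)
        qed (simp add: U_def diam_power_def)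
        then have "(\<integral>\<^sup>+w. ennreal (diam_power s (U (n, w))) \<partial>count_space UNIV)
            \<le> (\<integral>\<^sup>+w. ennreal (r n powr s) * indicator (W n) w \<partial>count_space UNIV)"
          by (rule nn_integral_mono)
        also have "\<dots> = ennreal (r n powr s) * card (W n)"
          using W by (simp add: nn_integral_cmult_indicator ennreal_of_nat_eq_real_of_nat)
        also have "\<dots> = ennreal (?b n)"
          using False by (simp add: ennreal_mult'' ennreal_of_nat_eq_real_of_nat mult.commute)
        finally show ?thesis .
      qed
    qed
    also have "\<dots> = (\<Sum>n. ennreal (?b n))" by (rule nn_integral_count_space_nat)
    also have "\<dots> = ennreal (\<Sum>n. ?b n)"
    proof (rule suminf_ennreal2)
      show "summable ?b"
        by (rule summable_comparison_test'[OF sum]) auto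
    qed auto
    also have "(\<Sum>n. ?b n) = (\<Sum>i. card (W (i + N)) * r (i + N) powr s)"
    proof -
      have "summable ?b" by (rule summable_comparison_test'[OF sum]) auto
      then have "(\<Sum>n. ?b n) = (\<Sum>i. ?b (i + N)) + (\<Sum>i<N. ?b i)"
        by (rule suminf_split_initial_segment)
      then show ?thesis by simp
    qed
    also have "ennreal \<dots> \<le> ennreal e" using N2[of N] by (intro ennreal_leI) (auto simp: N_def)
    finally show ?thesis .
  qed
  have "hausdorff_measure s A = 0"
  proof -
    have "hausdorff_content \<delta> s A \<le> 0" if \<delta>: "\<delta> \<in> {0<..}" for \<delta>
      by (rule ennreal_le_epsilon) (use content[of \<delta>] \<delta> in simp)
    then have "hausdorff_measure s A \<le> 0" unfolding hausdorff_measure_def by (rule SUP_least)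
    then show ?thesis by simp
  qed
  then have "hausdorff_dim A \<le> ereal s"
    unfolding hausdorff_dim_def using s by (intro INF_lower) auto
  moreover have "measure_hausdorff_dim \<nu> \<le> hausdorff_dim A"
    unfolding measure_hausdorff_dim_def using AE by (intro INF_lower) (auto simp: A_def)
  ultimately show ?thesis by (rule order_trans[rotated])
qed

lemma measure_hausdorff_dim_nonneg: "0 \<le> measure_hausdorff_dim \<nu>"
  unfolding measure_hausdorff_dim_def hausdorff_dim_def by (intro INF_greatest) auto

text \<open>The mass distribution principle. A set of small diameter that meets the set of points with a
  given constant \<open>C\<close> lies in a ball around such a point, so its measure is bounded by a
  multiple of its term in the Hausdorff sum.\<close>

lemma measure_hausdorff_dim_ge:
  fixes \<nu> :: "'a::metric_space measure"
  assumes "prob_space \<nu>" and sets: "sets \<nu> = sets borel" and s: "0 < s"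
    and local: "AE x in \<nu>. \<exists>C::nat. \<forall>k::nat. measure \<nu> (ball x (1 / 2 ^ k)) \<le> C * (1 / 2 ^ k) powr s"
  shows "ereal s \<le> measure_hausdorff_dim \<nu>"
proof -
  interpret prob_space \<nu> by fact
  have [measurable_cong]: "sets \<nu> = sets borel" by (rule sets)
  have space: "space \<nu> = UNIV" using sets_eq_imp_space_eq[OF sets] by simp
  define F where "F C = {x. \<forall>k::nat. measure \<nu> (ball x (1 / 2 ^ k)) \<le> C * (1 / 2 ^ k) powr s}" for C :: real
  have "s \<le> t" if A: "AE x in \<nu>. x \<in> A" and t: "0 \<le> t" "hausdorff_measure t A = 0" for A t
  proof (rule ccontr)
    assume "\<not> s \<le> t"
    then have ts: "t < s" by simp
    have content: "hausdorff_content (1 / 2) t A = 0"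
      using t(2) unfolding hausdorff_measure_def SUP_eq_iff
      by (metis SUP_upper greaterThan_iff half_gt_zero_iff le_zero_eq t(2) hausdorff_measure_def zero_less_one)
    have "AE x in \<nu>. \<not> (x \<in> A \<and> x \<in> F (real C))" for C :: nat
    proof -
      have "\<exists>B\<in>sets \<nu>. A \<inter> F C \<subseteq> B \<and> emeasure \<nu> B \<le> ennreal (1 / Suc j)" for j :: nat
      proof -
        define K where "K = (real C + 1) * 2 powr s"
        have K: "0 < K" by (simp add: K_def)
        have "hausdorff_content (1 / 2) t A < ennreal (1 / Suc j / K)"
          unfolding content using K by simp
        then obtain U where U: "A \<subseteq> (\<Union>n. U n)" "\<And>n. bounded (U n)" "\<And>n. diameter (U n) \<le> 1 / 2"
            "(\<Sum>n. ennreal (diam_power t (U n))) < ennreal (1 / Suc j / K)"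
          unfolding hausdorff_content_def INF_less_iff by (auto 0 3)
        have "\<exists>B. B \<in> sets \<nu> \<and> U n \<inter> F C \<subseteq> B \<and> emeasure \<nu> B \<le> ennreal K * ennreal (diam_power t (U n))" for n
        proof (cases "U n \<inter> F C = {}")
          case True
          then show ?thesis by (intro exI[of _ "{}"]) simp
        next
          case False
          then obtain x where x: "x \<in> U n" "x \<in> F C" by blast
          let ?d = "diameter (U n)"
          have d: "0 \<le> ?d" using U(2) by (rule diameter_ge_0)
          have sub: "dist x y \<le> ?d" if "y \<in> U n" for y
            using diameter_bounded_bound[OF U(2) x(1) that] .
          have ball: "measure \<nu> (ball x (1 / 2 ^ k)) \<le> C * (1 / 2 ^ k) powr s" for k :: nat
            using x(2) by (simp add: F_def)
          show ?thesis
          proof (cases "?d = 0")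
            \<comment> \<open>The set is a single point, which has measure zero because \<open>s\<close> is positive.\<close>
            case True
            then have "U n \<subseteq> {x}" using sub by force
            moreover have "measure \<nu> {x} \<le> 0"
            proof (rule LIMSEQ_le_const)
              show "(\<lambda>k. real C * (1 / 2 ^ k) powr s) \<longlonglongrightarrow> 0"
                using s by real_asymp
              have "measure \<nu> {x} \<le> measure \<nu> (ball x (1 / 2 ^ k))" for k :: nat
                by (rule finite_measure_mono) auto
              then show "\<exists>N. \<forall>k\<ge>N. measure \<nu> {x} \<le> real C * (1 / 2 ^ k) powr s"
                using ball order_trans by blast
            qed
            ultimately show ?thesis
              by (intro exI[of _ "{x}"]) (auto simp: emeasure_eq_measure ennreal_neg)
          next
            case False
            then have d: "0 < ?d" "?d \<le> 1 / 2" using d U(3)[of n] by auto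
            obtain k :: nat where k: "?d < 1 / 2 ^ k" "1 / 2 ^ k \<le> 2 * ?d"
            proof -
              let ?P = "\<lambda>k::nat. 1 / 2 ^ k \<le> ?d"
              have "\<exists>k. ?P k"
                using real_arch_pow_inv[of ?d "1 / 2"] d by (auto simp: power_one_over intro: less_imp_le)
              then have L: "?P (LEAST k. ?P k)" by (rule LeastI_ex)
              then obtain k where "(LEAST k. ?P k) = Suc k" using d by (cases "LEAST k. ?P k") auto
              moreover from this have "\<not> ?P k" using not_less_Least[of k ?P] by simp
              ultimately show thesis using L by (intro that[of k]) (auto simp: field_simps)
            qed
            have "(1 / 2 ^ k) powr s \<le> (1 / 2 ^ k) powr t"
              using ts by (intro powr_mono') auto
            also have "\<dots> \<le> (2 * ?d) powr t" using k t by (intro powr_mono2) auto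
            also have "\<dots> = 2 powr t * ?d powr t" using d by (simp add: powr_mult)
            also have "\<dots> \<le> 2 powr s * ?d powr t" using ts by (intro mult_right_mono powr_mono) auto
            finally have "real C * (1 / 2 ^ k) powr s \<le> K * ?d powr t"
              unfolding K_def mult.assoc by (intro mult_mono) auto
            also have "\<dots> = K * diam_power t (U n)" using x(1) d by (auto simp: diam_power_def)
            finally have "measure \<nu> (ball x (1 / 2 ^ k)) \<le> K * diam_power t (U n)"
              using ball[of k] by linarith
            then have "emeasure \<nu> (ball x (1 / 2 ^ k)) \<le> ennreal K * ennreal (diam_power t (U n))"
              using K by (subst ennreal_mult[symmetric]) (auto simp: emeasure_eq_measure diam_power_def intro!: ennreal_leI)
            moreover have "U n \<subseteq> ball x (1 / 2 ^ k)" using le_less_trans[OF sub k(1)] by auto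
            ultimately show ?thesis by (intro exI[of _ "ball x (1 / 2 ^ k)"]) auto
          qed
        qed
        then have "\<forall>n. \<exists>B. B \<in> sets \<nu> \<and> U n \<inter> F C \<subseteq> B \<and> emeasure \<nu> B \<le> ennreal K * ennreal (diam_power t (U n))"
          by blast
        from choice[OF this] obtain B where B: "\<And>n. B n \<in> sets \<nu>" "\<And>n. U n \<inter> F C \<subseteq> B n"
            "\<And>n. emeasure \<nu> (B n) \<le> ennreal K * ennreal (diam_power t (U n))" by blast
        have "emeasure \<nu> (\<Union>n. B n) \<le> (\<Sum>n. emeasure \<nu> (B n))"
          using B(1) by (intro emeasure_subadditive_countably) auto
        also have "\<dots> \<le> (\<Sum>n. ennreal K * ennreal (diam_power t (U n)))"
          by (intro suminf_le B(3)) auto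
        also have "\<dots> = ennreal K * (\<Sum>n. ennreal (diam_power t (U n)))" by simp
        also have "\<dots> \<le> ennreal K * ennreal (1 / Suc j / K)"
          using U(4) by (intro mult_left_mono) auto
        also have "\<dots> = ennreal (1 / Suc j)"
          using K by (subst ennreal_mult[symmetric]) auto
        finally have "emeasure \<nu> (\<Union>n. B n) \<le> ennreal (1 / Suc j)" .
        moreover have "A \<inter> F C \<subseteq> (\<Union>n. B n)" using U(1) B(2) by blast
        ultimately show ?thesis using B(1) by blast
      qed
      then have "\<forall>j. \<exists>B. B \<in> sets \<nu> \<and> A \<inter> F C \<subseteq> B \<and> emeasure \<nu> B \<le> ennreal (1 / Suc j)" by blast
      from choice[OF this] obtain B where B: "\<And>j. B j \<in> sets \<nu>" "\<And>j. A \<inter> F C \<subseteq> B j"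
          "\<And>j. emeasure \<nu> (B j) \<le> ennreal (1 / Suc j)" by blast
      have "emeasure \<nu> (\<Inter>j. B j) \<le> 0"
      proof (rule LIMSEQ_le_const)
        have "(\<lambda>j. 1 / real (Suc j)) \<longlonglongrightarrow> 0" by real_asymp
        then have "(\<lambda>j. ennreal (1 / real (Suc j))) \<longlonglongrightarrow> ennreal 0" by (rule tendsto_ennrealI)
        then show "(\<lambda>j. ennreal (1 / real (Suc j))) \<longlonglongrightarrow> 0" by simp
        have "emeasure \<nu> (\<Inter>j. B j) \<le> emeasure \<nu> (B j)" for j using B(1) by (intro emeasure_mono) auto
        then show "\<exists>N. \<forall>j\<ge>N. emeasure \<nu> (\<Inter>j. B j) \<le> ennreal (1 / real (Suc j))"
          using B(3) order_trans by blast
      qed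
      then have "(\<Inter>j. B j) \<in> null_sets \<nu>" using B(1) by (auto simp: null_sets_def)
      then show ?thesis using B(2) by (intro AE_I'[of "\<Inter>j. B j"]) auto
    qed
    then have "AE x in \<nu>. \<forall>C::nat. \<not> (x \<in> A \<and> x \<in> F (real C))"
      by (intro AE_all_countable[THEN iffD2] allI)
    with A local have "AE x in \<nu>. False"
    proof eventually_elim
      case (elim x)
      then show False unfolding F_def by blast
    qed
    then show False by simp
  qed
  then show ?thesis
    unfolding measure_hausdorff_dim_def hausdorff_dim_def by (intro INF_greatest) auto
qed

section \<open>A criterion for absolute continuity\<close>

lemma measurable_emeasure_ball:
  fixes \<nu> :: "real measure"
  assumes "finite_measure \<nu>" and sets: "sets \<nu> = sets borel"
  shows "(\<lambda>x. emeasure \<nu> (ball x r)) \<in> borel_measurable borel"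
proof -
  interpret finite_measure \<nu> by fact
  have "open {p :: real \<times> real. dist (fst p) (snd p) < r}"
    by (intro open_Collect_less continuous_intros)
  then have "{p :: real \<times> real. dist (fst p) (snd p) < r} \<in> sets (borel \<Otimes>\<^sub>M \<nu>)"
    unfolding sets_pair_measure_cong[OF refl sets] borel_prod by simp
  from measurable_emeasure_Pair[OF this] show ?thesis
    by (simp add: ball_def vimage_def)
qed

text \<open>With \<open>f\<close> the average of \<open>\<nu>\<close> over balls of radius \<open>\<rho> / 2\<close>, the hypothesis bounds
  \<open>\<integral> f\<^sup>2\<close> by \<open>K\<close>. For an open set \<open>U\<close> the integral of \<open>f\<close> over \<open>U\<close> is at least
  the measure of the points of \<open>U\<close> that are far from the boundary, and \<open>2 f \<le> c f\<^sup>2 + 1 / c\<close>.\<close>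

lemma emeasure_inner_le:
  fixes \<nu> :: "real measure"
  assumes "finite_measure \<nu>" and sets: "sets \<nu> = sets borel" and \<rho>: "0 < \<rho>" and K: "0 \<le> K"
    and E: "(\<integral>\<^sup>+u. emeasure \<nu> (ball u \<rho>) \<partial>\<nu>) \<le> ennreal (K * \<rho>)"
    and U: "U \<in> sets borel" and c: "0 < c"
  shows "emeasure \<nu> {u. ball u \<rho> \<subseteq> U} \<le> ennreal (c / 2 * K) + ennreal (1 / (2 * c)) * emeasure lborel U"
proof -
  interpret finite_measure \<nu> by fact
  interpret P: pair_sigma_finite lborel \<nu> ..
  have [measurable_cong]: "sets \<nu> = sets borel" by (rule sets)
  have space: "space \<nu> = UNIV" using sets_eq_imp_space_eq[OF sets] by simp
  note [measurable] = measurable_emeasure_ball[OF \<open>finite_measure \<nu>\<close> sets] U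
  let ?r = "\<rho> / 2"
  define g where "g x = measure \<nu> (ball x ?r)" for x
  have g: "emeasure \<nu> (ball x ?r) = ennreal (g x)" for x by (simp add: g_def emeasure_eq_measure)
  have [measurable]: "g \<in> borel_measurable borel"
    using measurable_emeasure_ball[OF \<open>finite_measure \<nu>\<close> sets, of ?r] unfolding g_def[abs_def] measure_def by measurable
  have g0: "0 \<le> g x" for x by (simp add: g_def)
  have ind: "emeasure \<nu> (ball x ?r) = (\<integral>\<^sup>+u. indicator (ball u ?r) x \<partial>\<nu>)" for x
  proof -
    have "(\<integral>\<^sup>+u. indicator (ball u ?r) x \<partial>\<nu>) = (\<integral>\<^sup>+u. indicator (ball x ?r) u \<partial>\<nu>)"
      by (intro nn_integral_cong) (simp add: indicator_def dist_commute)
    also have "\<dots> = emeasure \<nu> (ball x ?r)" by (rule nn_integral_indicator) simp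
    finally show ?thesis ..
  qed
  have [measurable]: "(\<lambda>(x, u). indicator (ball u ?r) x :: ennreal) \<in> borel_measurable (lborel \<Otimes>\<^sub>M \<nu>)"
    unfolding indicator_def ball_def by measurable
  have len: "(\<integral>\<^sup>+x. indicator (ball u ?r) x \<partial>lborel) = ennreal \<rho>" for u :: real
    using \<rho> by (simp add: ball_eq_greaterThanLessThan)
  have sq: "(\<integral>\<^sup>+x. ennreal ((g x)\<^sup>2) \<partial>lborel) \<le> ennreal (K * \<rho> * \<rho>)"
  proof -
    have "(\<integral>\<^sup>+x. ennreal ((g x)\<^sup>2) \<partial>lborel) \<le> (\<integral>\<^sup>+x. \<integral>\<^sup>+u. indicator (ball u ?r) x * emeasure \<nu> (ball u \<rho>) \<partial>\<nu> \<partial>lborel)"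
    proof (rule nn_integral_mono)
      fix x :: real
      have "ennreal ((g x)\<^sup>2) = (\<integral>\<^sup>+u. indicator (ball u ?r) x \<partial>\<nu>) * ennreal (g x)"
        unfolding ind[symmetric] g by (simp add: power2_eq_square ennreal_mult' g0)
      also have "\<dots> = (\<integral>\<^sup>+u. indicator (ball u ?r) x * ennreal (g x) \<partial>\<nu>)"
        by (rule nn_integral_multc[symmetric]) measurable
      also have "\<dots> \<le> (\<integral>\<^sup>+u. indicator (ball u ?r) x * emeasure \<nu> (ball u \<rho>) \<partial>\<nu>)"
      proof (rule nn_integral_mono)
        fix u
        show "indicator (ball u ?r) x * ennreal (g x) \<le> indicator (ball u ?r) x * emeasure \<nu> (ball u \<rho>)"
        proof (cases "x \<in> ball u ?r")
          case True
          have "ball x ?r \<subseteq> ball u \<rho>"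
          proof
            fix z assume "z \<in> ball x ?r"
            then show "z \<in> ball u \<rho>" using True dist_triangle[of u z x] by simp
          qed
          then show ?thesis using True unfolding g[symmetric] by (simp add: emeasure_mono)
        qed simp
      qed
      finally show "ennreal ((g x)\<^sup>2) \<le> (\<integral>\<^sup>+u. indicator (ball u ?r) x * emeasure \<nu> (ball u \<rho>) \<partial>\<nu>)" .
    qed
    also have "\<dots> = (\<integral>\<^sup>+u. \<integral>\<^sup>+x. indicator (ball u ?r) x * emeasure \<nu> (ball u \<rho>) \<partial>lborel \<partial>\<nu>)"
      by (rule P.Fubini'[symmetric]) measurable
    also have "\<dots> = (\<integral>\<^sup>+u. ennreal \<rho> * emeasure \<nu> (ball u \<rho>) \<partial>\<nu>)"
      by (intro nn_integral_cong) (subst nn_integral_multc, auto simp: len)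
    also have "\<dots> = ennreal \<rho> * (\<integral>\<^sup>+u. emeasure \<nu> (ball u \<rho>) \<partial>\<nu>)"
      by (rule nn_integral_cmult) measurable
    also have "\<dots> \<le> ennreal \<rho> * ennreal (K * \<rho>)" by (intro mult_left_mono E) auto
    also have "\<dots> = ennreal (K * \<rho> * \<rho>)" using \<rho> K by (simp add: ennreal_mult'[symmetric] mult.commute)
    finally show ?thesis .
  qed
  have inner: "{u. ball u \<rho> \<subseteq> U} \<in> sets \<nu>"
  proof -
    have "{u. ball u \<rho> \<subseteq> U} = - (\<Union>v\<in>-U. ball v \<rho>)" by (auto simp: dist_commute)
    then have "closed {u. ball u \<rho> \<subseteq> U}" by (auto intro!: closed_INT closed_Compl)
    then show ?thesis by (simp add: sets)
  qed
  have "emeasure \<nu> {u. ball u \<rho> \<subseteq> U} \<le> (\<integral>\<^sup>+u. \<integral>\<^sup>+x. ennreal (1 / \<rho>) * (indicator U x * indicator (ball u ?r) x) \<partial>lborel \<partial>\<nu>)"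
  proof (subst nn_integral_indicator[OF inner, symmetric], rule nn_integral_mono)
    fix u
    show "indicator {u. ball u \<rho> \<subseteq> U} u \<le> (\<integral>\<^sup>+x. ennreal (1 / \<rho>) * (indicator U x * indicator (ball u ?r) x) \<partial>lborel)"
    proof (cases "ball u \<rho> \<subseteq> U")
      case True
      moreover have "ball u ?r \<subseteq> ball u \<rho>" using \<rho> by auto
      ultimately have "ball u ?r \<subseteq> U" by blast
      then have "(\<integral>\<^sup>+x. ennreal (1 / \<rho>) * (indicator U x * indicator (ball u ?r) x) \<partial>lborel) =
          (\<integral>\<^sup>+x. ennreal (1 / \<rho>) * indicator (ball u ?r) x \<partial>lborel)"
        by (intro nn_integral_cong) (auto simp: indicator_def)
      also have "\<dots> = ennreal (1 / \<rho>) * ennreal \<rho>"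
      proof -
        have "(indicator (ball u ?r) :: real \<Rightarrow> ennreal) \<in> borel_measurable lborel"
          by (rule borel_measurable_indicator) simp
        then show ?thesis by (simp only: nn_integral_cmult len)
      qed
      also have "\<dots> = 1" using \<rho> by (simp add: ennreal_mult'[symmetric])
      finally show ?thesis using True by simp
    qed simp
  qed
  also have "\<dots> = (\<integral>\<^sup>+x. \<integral>\<^sup>+u. ennreal (1 / \<rho>) * (indicator U x * indicator (ball u ?r) x) \<partial>\<nu> \<partial>lborel)"
    by (rule P.Fubini') measurable
  also have "\<dots> = (\<integral>\<^sup>+x. ennreal (g x / \<rho>) * indicator U x \<partial>lborel)"
  proof (rule nn_integral_cong)
    fix x :: real
    have "(\<integral>\<^sup>+u. ennreal (1 / \<rho>) * (indicator U x * indicator (ball u ?r) x) \<partial>\<nu>)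
        = (\<integral>\<^sup>+u. (ennreal (1 / \<rho>) * indicator U x) * indicator (ball u ?r) x \<partial>\<nu>)"
      by (simp add: mult.assoc)
    also have "\<dots> = ennreal (1 / \<rho>) * indicator U x * (\<integral>\<^sup>+u. indicator (ball u ?r) x \<partial>\<nu>)"
      by (rule nn_integral_cmult) measurable
    also have "\<dots> = ennreal (g x / \<rho>) * indicator U x"
      unfolding ind[symmetric] g using \<rho> g0[of x]
      by (auto simp: indicator_def ennreal_mult'[symmetric])
    finally show "(\<integral>\<^sup>+u. ennreal (1 / \<rho>) * (indicator U x * indicator (ball u ?r) x) \<partial>\<nu>)
        = ennreal (g x / \<rho>) * indicator U x" .
  qed
  also have "\<dots> \<le> (\<integral>\<^sup>+x. ennreal (c / 2 / \<rho>\<^sup>2) * ennreal ((g x)\<^sup>2) + ennreal (1 / (2 * c)) * indicator U x \<partial>lborel)"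
  proof (rule nn_integral_mono)
    fix x :: real
    have "g x / \<rho> \<le> c / 2 / \<rho>\<^sup>2 * (g x)\<^sup>2 + 1 / (2 * c)"
    proof -
      have "0 \<le> (c * (g x / \<rho>) - 1)\<^sup>2" by simp
      then have "2 * c * (g x / \<rho>) \<le> c * c * (g x / \<rho>)\<^sup>2 + 1" by (simp add: power2_eq_square algebra_simps)
      then have "2 * c * (g x / \<rho>) / (2 * c) \<le> (c * c * (g x / \<rho>)\<^sup>2 + 1) / (2 * c)"
        using c by (intro divide_right_mono) auto
      then show ?thesis using c by (simp add: add_divide_distrib power_divide mult.commute)
    qed
    then show "ennreal (g x / \<rho>) * indicator U x \<le> ennreal (c / 2 / \<rho>\<^sup>2) * ennreal ((g x)\<^sup>2) + ennreal (1 / (2 * c)) * indicator U x"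
      using c by (cases "x \<in> U") (auto simp: ennreal_mult'[symmetric] ennreal_plus[symmetric] simp del: ennreal_plus intro!: ennreal_leI)
  qed
  also have "\<dots> = ennreal (c / 2 / \<rho>\<^sup>2) * (\<integral>\<^sup>+x. ennreal ((g x)\<^sup>2) \<partial>lborel) + ennreal (1 / (2 * c)) * emeasure lborel U"
    by (simp add: nn_integral_add nn_integral_cmult)
  also have "\<dots> \<le> ennreal (c / 2 / \<rho>\<^sup>2) * ennreal (K * \<rho> * \<rho>) + ennreal (1 / (2 * c)) * emeasure lborel U"
    by (intro add_right_mono mult_left_mono sq) auto
  also have "ennreal (c / 2 / \<rho>\<^sup>2) * ennreal (K * \<rho> * \<rho>) = ennreal (c / 2 * K)"
    using \<rho> c K by (subst ennreal_mult[symmetric]) (auto simp: power2_eq_square)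
  finally show ?thesis .
qed

lemma absolutely_continuous_of_energy:
  fixes \<nu> :: "real measure"
  assumes fin: "finite_measure \<nu>" and sets: "sets \<nu> = sets borel" and K: "0 \<le> K"
    and E: "\<exists>\<^sub>F k in sequentially. (\<integral>\<^sup>+u. emeasure \<nu> (ball u (1 / 2 ^ k)) \<partial>\<nu>) \<le> ennreal (K * (1 / 2 ^ k))"
  shows "absolutely_continuous lborel \<nu>"
proof -
  interpret finite_measure \<nu> by fact
  have [measurable_cong]: "sets \<nu> = sets borel" by (rule sets)
  have open_le: "emeasure \<nu> U \<le> ennreal (c / 2 * K) + ennreal (1 / (2 * c)) * emeasure lborel U"
    if U: "open U" and c: "0 < c" for U c
  proof -
    define I where "I k = {u. ball u (1 / 2 ^ k) \<subseteq> U}" for k :: nat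
    have inc: "I k \<subseteq> I j" if "k \<le> j" for k j
    proof -
      have "ball u (1 / 2 ^ j) \<subseteq> ball u (1 / 2 ^ k)" for u :: real
        using that by (intro subset_ball) (simp add: power_increasing field_simps)
      then show ?thesis unfolding I_def by blast
    qed
    have "U = (\<Union>k. I k)"
    proof
      show "U \<subseteq> (\<Union>k. I k)"
      proof
        fix u assume "u \<in> U"
        then obtain e where e: "0 < e" "ball u e \<subseteq> U" using U by (meson open_contains_ball)
        obtain k :: nat where "1 / 2 ^ k < e"
          using real_arch_pow_inv[of e "1 / 2"] e by (auto simp: power_one_over)
        then have "ball u (1 / 2 ^ k) \<subseteq> ball u e" by (intro subset_ball) auto
        then show "u \<in> (\<Union>k. I k)" using e by (auto simp: I_def)
      qed
      show "(\<Union>k. I k) \<subseteq> U" by (auto simp: I_def)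
    qed
    moreover have I: "I k \<in> sets \<nu>" for k
    proof -
      have "I k = - (\<Union>v\<in>-U. ball v (1 / 2 ^ k))" by (auto simp: dist_commute I_def)
      then have "closed (I k)" by (auto intro!: closed_INT closed_Compl)
      then show ?thesis by (simp add: sets)
    qed
    moreover have "incseq I" using inc by (auto simp: incseq_def)
    ultimately have "emeasure \<nu> U = (SUP k. emeasure \<nu> (I k))"
      using SUP_emeasure_incseq[of I \<nu>] by (simp add: image_subset_iff)
    also have "\<dots> \<le> ennreal (c / 2 * K) + ennreal (1 / (2 * c)) * emeasure lborel U"
    proof (rule SUP_least)
      fix k
      obtain j where j: "j \<ge> k" "(\<integral>\<^sup>+u. emeasure \<nu> (ball u (1 / 2 ^ j)) \<partial>\<nu>) \<le> ennreal (K * (1 / 2 ^ j))"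
        using E by (auto simp: frequently_sequentially)
      have "emeasure \<nu> (I k) \<le> emeasure \<nu> (I j)" using inc[OF j(1)] I by (intro emeasure_mono)
      also have "\<dots> \<le> ennreal (c / 2 * K) + ennreal (1 / (2 * c)) * emeasure lborel U"
        unfolding I_def by (rule emeasure_inner_le[OF fin sets _ K j(2) _ c]) (use U in auto)
      finally show "emeasure \<nu> (I k) \<le> ennreal (c / 2 * K) + ennreal (1 / (2 * c)) * emeasure lborel U" .
    qed
    finally show ?thesis .
  qed
  show ?thesis
    unfolding absolutely_continuous_def
  proof
    fix N :: "real set" assume N: "N \<in> null_sets lborel"
    then have "N \<in> sets borel" by auto
    have "emeasure \<nu> N \<le> 0"
    proof (rule ennreal_le_epsilon)
      fix e :: real assume e: "0 < e"
      define c where "c = e / (K + 1)"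
      have c: "0 < c" using e K by (simp add: c_def)
      obtain U where U: "open U" "N \<subseteq> U" "emeasure lborel (U - N) < ennreal (c * e)"
        using outer_regular_lborel[OF \<open>N \<in> sets borel\<close>, of "c * e"] c e by auto
      have "emeasure lborel U = emeasure lborel (U - N)"
        using N U by (subst emeasure_Diff_null_set) auto
      then have "emeasure lborel U \<le> ennreal (c * e)" using U by simp
      then have "emeasure \<nu> U \<le> ennreal (c / 2 * K) + ennreal (1 / (2 * c)) * ennreal (c * e)"
        by (intro order_trans[OF open_le[OF U(1) c]] add_left_mono mult_left_mono) auto
      also have "\<dots> = ennreal (c / 2 * K + e / 2)"
        using c e K by (simp add: ennreal_mult[symmetric] ennreal_plus[symmetric] del: ennreal_plus)
      also have "\<dots> \<le> ennreal e"
      proof (rule ennreal_leI)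
        have "c * K \<le> e" using e K by (simp add: c_def field_simps)
        then show "c / 2 * K + e / 2 \<le> e" by simp
      qed
      finally have "emeasure \<nu> U \<le> ennreal e" .
      moreover have "emeasure \<nu> N \<le> emeasure \<nu> U" using U by (intro emeasure_mono) (auto simp: sets)
      ultimately show "emeasure \<nu> N \<le> 0 + ennreal e" by simp
    qed
    then show "N \<in> null_sets \<nu>" using N by (auto simp: null_sets_def sets)
  qed
qed

section \<open>Transversality\<close>

lemma funpow_shift [simp]: "(shift ^^ n) x = (\<lambda>k. x (n + k))"
  by (induction n arbitrary: x) (auto simp: shift_def funpow_swap1)

definition projection_summable ::
    "(nat \<Rightarrow> real) \<Rightarrow> (nat \<Rightarrow> real) \<Rightarrow> (nat \<Rightarrow> nat) \<Rightarrow> (nat \<Rightarrow> real) \<Rightarrow> bool" where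
  "projection_summable d lam i y \<longleftrightarrow>
     summable (\<lambda>n. d (i (Suc n)) * (\<Prod>k\<le>n. lam (i k)) * (\<Prod>k\<le>n. y k))"

lemma projection_step:
  assumes sum: "projection_summable d lam i y" and pos: "0 < lam (i 0)" "0 < y 0"
  shows "natural_projection d lam i y = d (i 0) + lam (i 0) * y 0 * natural_projection d lam (shift i) (shift y)"
    and "projection_summable d lam (shift i) (shift y)"
proof -
  let ?t = "\<lambda>i y n. d (i (Suc n)) * (\<Prod>k\<le>n. lam (i k)) * (\<Prod>k\<le>n. y k)"
  have t: "?t i y (Suc n) = lam (i 0) * y 0 * ?t (shift i) (shift y) n" for n
    by (simp add: prod.atMost_Suc_shift shift_def mult_ac del: prod.atMost_Suc)
  have s: "summable (?t i y)" using sum by (simp add: projection_summable_def)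
  then have "summable (\<lambda>n. lam (i 0) * y 0 * ?t (shift i) (shift y) n)"
    by (subst (asm) summable_Suc_iff[symmetric]) (simp only: t)
  then have s': "summable (?t (shift i) (shift y))"
    by (subst (asm) summable_cmult_iff) (use pos in auto)
  then show "projection_summable d lam (shift i) (shift y)" by (simp add: projection_summable_def)
  have "suminf (?t i y) = ?t i y 0 + (\<Sum>n. ?t i y (Suc n))" 
    using suminf_split_head[OF s] by linarith
  then show "natural_projection d lam i y = d (i 0) + lam (i 0) * y 0 * natural_projection d lam (shift i) (shift y)"
    unfolding t suminf_mult[OF s'] by (simp add: natural_projection_def shift_def algebra_simps)
qed

lemma projection_summable_funpow:
  assumes "projection_summable d lam i y" "\<And>k. 0 < lam (i k)" "\<And>k. 0 < y k"
  shows "projection_summable d lam (\<lambda>k. i (n + k)) (\<lambda>k. y (n + k))"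
proof (induction n)
  case (Suc n)
  then show ?case using projection_step(2)[OF Suc] assms by (simp add: shift_def)
qed (use assms in simp)

lemma projection_diff_common_prefix:
  assumes "projection_summable d lam i y" "projection_summable d lam j y"
    and "\<And>k. 0 < lam (i k)" "\<And>k. 0 < lam (j k)" "\<And>k. 0 < y k" and "\<And>k. k < n \<Longrightarrow> i k = j k"
  shows "natural_projection d lam i y - natural_projection d lam j y
    = (\<Prod>k<n. lam (i k)) * (\<Prod>k<n. y k) *
      (natural_projection d lam (\<lambda>k. i (n + k)) (\<lambda>k. y (n + k)) - natural_projection d lam (\<lambda>k. j (n + k)) (\<lambda>k. y (n + k)))"
  using assms(6)
proof (induction n)
  case (Suc n)
  define p where "p n i = natural_projection d lam (\<lambda>k. i (n + k)) (\<lambda>k. y (n + k))" for n i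
  have step: "p n i = d (i n) + lam (i n) * y n * p (Suc n) i"
    if "projection_summable d lam i y" "\<And>k. 0 < lam (i k)" for i
    using projection_step(1)[OF projection_summable_funpow[OF that assms(5), of n]] that assms(5)
    by (simp add: shift_def p_def)
  have "natural_projection d lam i y - natural_projection d lam j y
      = (\<Prod>k<n. lam (i k)) * (\<Prod>k<n. y k) * (p n i - p n j)"
    using Suc by (simp add: p_def)
  also have "p n i - p n j = lam (i n) * y n * (p (Suc n) i - p (Suc n) j)"
    using Suc.prems[of n] assms by (simp add: step algebra_simps)
  finally show ?case unfolding p_def by (simp add: mult_ac)
qed simp

text \<open>Dividing by the common prefix leaves two series that start with different translations or, if all
  translations equal \<open>1\<close> and one more step is expanded, with different contractions. Whatever
  multiplies \<open>y k\<close> afterwards involves only later coordinates.\<close>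

lemma projection_diff_affine:
  assumes n: "\<And>k. k < n \<Longrightarrow> i k = j k" "i n \<noteq> j n" and ij: "\<And>k. i k \<in> {1..m}" "\<And>k. j k \<in> {1..m}"
    and lam: "\<And>a. a \<in> {1..m} \<Longrightarrow> 0 < lam a"
    and sep: "inj_on d {1..m} \<or> ((\<forall>a\<in>{1..m}. d a = 1) \<and> inj_on lam {1..m})"
  obtains D k Z where "D \<in> {d a - d b | a b. a \<in> {1..m} \<and> b \<in> {1..m}} \<union> {lam a - lam b | a b. a \<in> {1..m} \<and> b \<in> {1..m}}"
    "D \<noteq> 0" "k = n \<or> k = Suc n" "\<And>y x. Z (y(k := x)) = Z y"
    "\<And>y. projection_summable d lam i y \<Longrightarrow> projection_summable d lam j y \<Longrightarrow> (\<And>k. 0 < y k) \<Longrightarrow>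
       natural_projection d lam i y - natural_projection d lam j y
         = (\<Prod>l<n. lam (i l)) * (\<Prod>l<k. y l) * (D + y k * Z y)"
proof -
  define p where "p n i y = natural_projection d lam (\<lambda>k. i (n + k)) (\<lambda>k. y (n + k))" for n i and y :: "nat \<Rightarrow> real"
  have step: "p n i y = d (i n) + lam (i n) * y n * p (Suc n) i y"
    if "projection_summable d lam i y" "\<And>k. i k \<in> {1..m}" "\<And>k. 0 < y k" for i y n
    using projection_step(1)[OF projection_summable_funpow[OF that(1) _ that(3), of n]] that lam
    by (simp add: shift_def p_def)
  have upd: "p (Suc k) i (y(k := x)) = p (Suc k) i y" for k i y x by (simp add: p_def)
  have diff: "natural_projection d lam i y - natural_projection d lam j y
      = (\<Prod>l<n. lam (i l)) * (\<Prod>l<n. y l) * (p n i y - p n j y)"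
    if "projection_summable d lam i y" "projection_summable d lam j y" "\<And>k. 0 < y k" for y
    unfolding p_def using that lam ij n by (intro projection_diff_common_prefix) auto
  from sep show thesis
  proof
    assume d: "inj_on d {1..m}"
    show thesis
    proof (rule that[of "d (i n) - d (j n)" n "\<lambda>y. lam (i n) * p (Suc n) i y - lam (j n) * p (Suc n) j y"])
      show "d (i n) - d (j n) \<in> {d a - d b | a b. a \<in> {1..m} \<and> b \<in> {1..m}} \<union> {lam a - lam b | a b. a \<in> {1..m} \<and> b \<in> {1..m}}"
        using ij by blast
      show "d (i n) - d (j n) \<noteq> 0" using d n(2) ij by (auto dest: inj_onD)
    next
      fix y :: "nat \<Rightarrow> real"
      assume y: "projection_summable d lam i y" "projection_summable d lam j y" "\<And>k. 0 < y k"
      show "natural_projection d lam i y - natural_projection d lam j y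
         = (\<Prod>l<n. lam (i l)) * (\<Prod>l<n. y l) *
           (d (i n) - d (j n) + y n * (lam (i n) * p (Suc n) i y - lam (j n) * p (Suc n) j y))"
        unfolding diff[OF y] step[OF y(1) ij(1) y(3), of n] step[OF y(2) ij(2) y(3), of n] by (simp add: algebra_simps)
    qed (auto simp: upd)
  next
    assume d: "(\<forall>a\<in>{1..m}. d a = 1) \<and> inj_on lam {1..m}"
    let ?N = "Suc n"
    show thesis
    proof (rule that[of "lam (i n) - lam (j n)" ?N
          "\<lambda>y. lam (i n) * lam (i ?N) * p (Suc ?N) i y - lam (j n) * lam (j ?N) * p (Suc ?N) j y"])
      show "lam (i n) - lam (j n) \<in> {d a - d b | a b. a \<in> {1..m} \<and> b \<in> {1..m}} \<union> {lam a - lam b | a b. a \<in> {1..m} \<and> b \<in> {1..m}}"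
        using ij by blast
      show "lam (i n) - lam (j n) \<noteq> 0" using d n(2) ij by (auto dest: inj_onD)
    next
      fix y :: "nat \<Rightarrow> real"
      assume y: "projection_summable d lam i y" "projection_summable d lam j y" "\<And>k. 0 < y k"
      have d1: "d (i n) = 1" "d (j n) = 1" "d (i ?N) = 1" "d (j ?N) = 1" using d ij by blast+
      show "natural_projection d lam i y - natural_projection d lam j y
         = (\<Prod>l<n. lam (i l)) * (\<Prod>l<?N. y l) * (lam (i n) - lam (j n) + y ?N *
            (lam (i n) * lam (i ?N) * p (Suc ?N) i y - lam (j n) * lam (j ?N) * p (Suc ?N) j y))"
        unfolding diff[OF y] step[OF y(1) ij(1) y(3), of n] step[OF y(2) ij(2) y(3), of n]
          step[OF y(1) ij(1) y(3), of ?N] step[OF y(2) ij(2) y(3), of ?N] d1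
        by (simp add: algebra_simps)
    qed (auto simp: upd)
  qed
qed

text \<open>The scale-invariant density bound makes the constant independent of the slope \<open>Z\<close>: on the set
  in question \<open>1 / x\<close> is at most of order \<open>\<bar>Z\<bar>\<close>, whereas the set is an interval of length
  \<open>2 * \<rho> / \<bar>Z\<bar>\<close>.\<close>

lemma emeasure_affine_small:
  assumes "prob_space \<Omega>" and dist: "distributed \<Omega> lborel Y f" and C1: "0 < C1"
    and f: "\<And>x. 0 < x \<Longrightarrow> f x \<le> ennreal (C1 / x)" and D: "D \<noteq> 0" and \<rho>: "0 < \<rho>"
  shows "emeasure (distr \<Omega> borel Y) {x. 0 < x \<and> \<bar>D + x * Z\<bar> < \<rho>} \<le> ennreal ((4 * C1 + 2) / \<bar>D\<bar> * \<rho>)"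
proof -
  have "Y \<in> measurable \<Omega> lborel" using dist by (simp add: distributed_def)
  then have Y: "Y \<in> borel_measurable \<Omega>" by simp
  interpret \<eta>: prob_space "distr \<Omega> borel Y" using \<open>prob_space \<Omega>\<close> Y by (rule prob_space.prob_space_distr)
  let ?S = "{x. 0 < x \<and> \<bar>D + x * Z\<bar> < \<rho>}"
  have S [measurable]: "?S \<in> sets borel" by measurable
  show ?thesis
  proof (cases "\<rho> \<le> \<bar>D\<bar> / 2")
    case False
    then have "1 \<le> 2 / \<bar>D\<bar> * \<rho>" using D by (simp add: field_simps)
    also have "\<dots> \<le> (4 * C1 + 2) / \<bar>D\<bar> * \<rho>" using C1 \<rho> by (intro mult_right_mono divide_right_mono) auto
    finally have "ennreal 1 \<le> ennreal ((4 * C1 + 2) / \<bar>D\<bar> * \<rho>)" by (rule ennreal_leI)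
    moreover have "emeasure (distr \<Omega> borel Y) ?S \<le> ennreal 1" using \<eta>.measure_le_1 by simp
    ultimately show ?thesis by (rule order_trans[rotated])
  next
    case True
    have large: "\<bar>D\<bar> / 2 \<le> x * \<bar>Z\<bar>" if "x \<in> ?S" for x
    proof -
      have "\<bar>x * Z\<bar> = x * \<bar>Z\<bar>" using that by (simp add: abs_mult)
      then have "\<bar>D\<bar> \<le> \<bar>D + x * Z\<bar> + x * \<bar>Z\<bar>" by linarith
      then show ?thesis using that True by simp
    qed
    show ?thesis
    proof (cases "Z = 0")
      case True
      then have "x \<notin> ?S" for x using large[of x] D by auto
      then have "?S = {}" by blast
      then show ?thesis by (simp only: emeasure_empty) simp
    next
      case Z: False
      have dens: "f x \<le> ennreal (2 * C1 * \<bar>Z\<bar> / \<bar>D\<bar>)" if "x \<in> ?S" for x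
      proof -
        have "f x \<le> ennreal (C1 / x)" using f that by simp
        also have "C1 / x \<le> 2 * C1 * \<bar>Z\<bar> / \<bar>D\<bar>"
          using large[OF that] that D C1 by (simp add: field_simps)
        finally show ?thesis by (simp add: ennreal_leI)
      qed
      have "?S \<subseteq> {- D / Z - \<rho> / \<bar>Z\<bar>..- D / Z + \<rho> / \<bar>Z\<bar>}"
      proof
        fix x assume "x \<in> ?S"
        then have "\<bar>D + x * Z\<bar> / \<bar>Z\<bar> \<le> \<rho> / \<bar>Z\<bar>" by (intro divide_right_mono) auto
        also have "\<bar>D + x * Z\<bar> / \<bar>Z\<bar> = \<bar>D / Z + x\<bar>" using Z by (simp add: abs_divide[symmetric] add_divide_distrib)
        finally show "x \<in> {- D / Z - \<rho> / \<bar>Z\<bar>..- D / Z + \<rho> / \<bar>Z\<bar>}" by (auto simp: abs_le_iff)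
      qed
      then have "emeasure lborel ?S \<le> emeasure lborel {- D / Z - \<rho> / \<bar>Z\<bar>..- D / Z + \<rho> / \<bar>Z\<bar>}"
        by (intro emeasure_mono) auto
      also have "\<dots> = ennreal (2 * \<rho> / \<bar>Z\<bar>)" using \<rho> by simp
      finally have len: "emeasure lborel ?S \<le> ennreal (2 * \<rho> / \<bar>Z\<bar>)" .
      have "emeasure (distr \<Omega> borel Y) ?S = emeasure (distr \<Omega> lborel Y) ?S"
        using Y by (simp add: emeasure_distr)
      also have "\<dots> = emeasure (density lborel f) ?S" using dist by (simp add: distributed_def)
      also have "\<dots> = (\<integral>\<^sup>+x. f x * indicator ?S x \<partial>lborel)"
        using dist S by (intro emeasure_density) (auto simp: distributed_def)
      also have "\<dots> \<le> (\<integral>\<^sup>+x. ennreal (2 * C1 * \<bar>Z\<bar> / \<bar>D\<bar>) * indicator ?S x \<partial>lborel)"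
        by (intro nn_integral_mono) (auto simp: indicator_def intro!: dens)
      also have "\<dots> = ennreal (2 * C1 * \<bar>Z\<bar> / \<bar>D\<bar>) * emeasure lborel ?S"
        by (rule nn_integral_cmult_indicator) simp
      also have "\<dots> \<le> ennreal (2 * C1 * \<bar>Z\<bar> / \<bar>D\<bar>) * ennreal (2 * \<rho> / \<bar>Z\<bar>)"
        by (intro mult_left_mono len) auto
      also have "\<dots> = ennreal (4 * C1 / \<bar>D\<bar> * \<rho>)"
        using C1 \<rho> Z by (subst ennreal_mult[symmetric]) auto
      also have "\<dots> \<le> ennreal ((4 * C1 + 2) / \<bar>D\<bar> * \<rho>)"
        using \<rho> by (intro ennreal_leI mult_right_mono divide_right_mono) auto
      finally show ?thesis .
    qed
  qed
qed

text \<open>Kolmogorov's zero-one law: an invariant event is determined by the coordinates from \<open>n\<close> on,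
  for every \<open>n\<close>.\<close>

lemma ergodic_shift_PiM:
  fixes \<eta> :: "'a measure"
  assumes "prob_space \<eta>"
  shows "ergodic (\<Pi>\<^sub>M n\<in>(UNIV :: nat set). \<eta>) shift"
proof -
  let ?Q = "\<Pi>\<^sub>M n\<in>(UNIV :: nat set). \<eta>"
  interpret Q: prob_space ?Q by (rule prob_space_PiM) (rule assms)
  have shift_meas: "shift \<in> measurable ?Q ?Q"
    unfolding shift_def[abs_def] by (rule measurable_PiM_single') (auto simp: space_PiM)
  have "distr ?Q ?Q (\<lambda>\<omega>. \<lambda>n\<in>UNIV. \<omega> (Suc n)) = ?Q"
    using distr_PiM_reindex[of UNIV "\<lambda>_. \<eta>" Suc UNIV] assms by simp
  then have inv: "measure_invariant ?Q shift"
    unfolding measure_invariant_def using shift_meas by (simp add: shift_def[abs_def] restrict_def)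
  have comp: "distr ?Q \<eta> (\<lambda>x. x n) = \<eta>" for n
    using distr_PiM_component[of UNIV "\<lambda>_. \<eta>" n] assms by simp
  have indep: "Q.indep_vars (\<lambda>_. \<eta>) (\<lambda>n x. x n) UNIV"
  proof (subst Q.indep_vars_iff_distr_eq_PiM)
    show "distr ?Q ?Q (\<lambda>x. \<lambda>n\<in>UNIV. x n) = (\<Pi>\<^sub>M n\<in>UNIV. distr ?Q \<eta> (\<lambda>x. x n))"
      unfolding comp by (simp add: restrict_def distr_id[unfolded id_def])
  qed auto
  define F where "F n = sigma_sets (space ?Q) {(\<lambda>x. x n) -` A \<inter> space ?Q | A. A \<in> sets \<eta>}" for n :: nat
  have F: "Q.indep_sets F UNIV"
    using indep unfolding Q.indep_vars_def F_def by simp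
  have F_space: "F n \<subseteq> Pow (space ?Q)" for n
  proof -
    have "{(\<lambda>x. x n) -` A \<inter> space ?Q | A. A \<in> sets \<eta>} \<subseteq> Pow (space ?Q)" by auto
    from sigma_sets_into_sp[OF this] show ?thesis unfolding F_def by blast
  qed
  have "emeasure ?Q A = 0 \<or> emeasure ?Q (space ?Q - A) = 0"
    if A: "A \<in> sets ?Q" "shift -` A \<inter> space ?Q = A" for A
  proof -
    have An: "(\<lambda>x k. x (n + k)) -` A \<inter> space ?Q = A" for n
    proof (induction n)
      case 0
      show ?case using sets.sets_into_space[OF A(1)] by auto
    next
      case (Suc n)
      have sh: "shift z \<in> A \<longleftrightarrow> z \<in> A" if "z \<in> space ?Q" for z using A(2) that by blast
      have "(\<lambda>k. x (Suc n + k)) \<in> A \<longleftrightarrow> (\<lambda>k. x (n + k)) \<in> A" if "x \<in> space ?Q" for x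
      proof -
        have "(\<lambda>k. x (n + k)) \<in> space ?Q" using that by (auto simp: space_PiM)
        from sh[OF this] show ?thesis by (simp add: shift_def)
      qed
      then show ?case using Suc by blast
    qed
    have "A \<in> Q.tail_events F"
      unfolding Q.tail_events_def
    proof
      fix n :: nat
      let ?S = "sigma (space ?Q) (\<Union> (F ` {n..}))"
      have sub: "\<Union> (F ` {n..}) \<subseteq> Pow (space ?Q)" using F_space by blast
      have "(\<lambda>x k. x (n + k)) \<in> measurable ?S ?Q"
      proof (rule measurable_PiM_single')
        fix k :: nat
        show "(\<lambda>x. x (n + k)) \<in> measurable ?S \<eta>"
        proof (rule measurableI)
          fix x assume "x \<in> space ?S"
          then show "x (n + k) \<in> space \<eta>" using sub by (auto simp: space_measure_of space_PiM)
        next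
          fix B assume "B \<in> sets \<eta>"
          then have "(\<lambda>x. x (n + k)) -` B \<inter> space ?Q \<in> F (n + k)"
            unfolding F_def by blast
          then have "(\<lambda>x. x (n + k)) -` B \<inter> space ?Q \<in> sigma_sets (space ?Q) (\<Union> (F ` {n..}))"
            by (intro sigma_sets.Basic) auto
          then show "(\<lambda>x. x (n + k)) -` B \<inter> space ?S \<in> sets ?S"
            using sub by (auto simp: space_measure_of sets_measure_of)
        qed
      qed (use sub in \<open>auto simp: space_measure_of space_PiM\<close>)
      from measurable_sets[OF this A(1)] show "A \<in> sigma_sets (space ?Q) (\<Union> (F ` {n..}))"
        using sub An by (simp add: space_measure_of sets_measure_of)
    qed
    then have "Q.prob A = 0 \<or> Q.prob A = 1"
      by (rule Q.kolmogorov_0_1_law[OF _ F, rotated]) (auto simp: F_def intro!: sigma_algebra_sigma_sets)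
    then show ?thesis using A(1) by (auto simp: Q.emeasure_eq_measure Q.prob_compl)
  qed
  then show ?thesis unfolding ergodic_def using inv by blast
qed

text \<open>Resampling a single coordinate preserves the product measure, so a bound that holds
  conditionally on all other coordinates holds unconditionally.\<close>

lemma emeasure_PiM_le_coordinate:
  fixes \<eta> :: "real measure"
  assumes "prob_space \<eta>" and S: "S \<in> sets (\<Pi>\<^sub>M n\<in>(UNIV :: nat set). \<eta>)"
    and le: "\<And>y. emeasure \<eta> {x \<in> space \<eta>. y(k := x) \<in> S} \<le> c"
  shows "emeasure (\<Pi>\<^sub>M n\<in>(UNIV :: nat set). \<eta>) S \<le> c"
proof -
  interpret \<eta>: prob_space \<eta> by fact
  let ?I = "UNIV - {k}"
  let ?P = "\<Pi>\<^sub>M n\<in>?I. \<eta>" and ?Q = "\<Pi>\<^sub>M n\<in>(UNIV :: nat set). \<eta>"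
  let ?g = "\<lambda>(x, X). X(k := x)"
  interpret P: prob_space ?P by (rule prob_space_PiM) (rule assms)
  interpret pair_sigma_finite \<eta> ?P ..
  have ins: "insert k ?I = UNIV" by auto
  have Q: "distr (\<eta> \<Otimes>\<^sub>M ?P) ?Q ?g = ?Q"
    using distr_pair_PiM_eq_PiM[where i'=k and I="?I" and M="\<lambda>_. \<eta>"] \<open>prob_space \<eta>\<close> unfolding ins by simp
  have g: "?g \<in> measurable (\<eta> \<Otimes>\<^sub>M ?P) ?Q"
    using measurable_fun_upd[where I=UNIV and J="?I" and i=k and f=snd and h=fst and N="\<eta> \<Otimes>\<^sub>M ?P" and M="\<lambda>_. \<eta>"]
    unfolding split_beta' by auto
  have "emeasure ?Q S = emeasure (distr (\<eta> \<Otimes>\<^sub>M ?P) ?Q ?g) S" by (simp only: Q)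
  also have "\<dots> = emeasure (\<eta> \<Otimes>\<^sub>M ?P) (?g -` S \<inter> space (\<eta> \<Otimes>\<^sub>M ?P))"
    by (rule emeasure_distr[OF g S])
  also have "\<dots> = (\<integral>\<^sup>+X. emeasure \<eta> ((\<lambda>x. (x, X)) -` (?g -` S \<inter> space (\<eta> \<Otimes>\<^sub>M ?P))) \<partial>?P)"
    by (rule emeasure_pair_measure_alt2[OF measurable_sets[OF g S]])
  also have "\<dots> \<le> (\<integral>\<^sup>+X. c \<partial>?P)"
  proof (rule nn_integral_mono)
    fix X assume "X \<in> space ?P"
    then have "(\<lambda>x. (x, X)) -` (?g -` S \<inter> space (\<eta> \<Otimes>\<^sub>M ?P)) = {x \<in> space \<eta>. X(k := x) \<in> S}"
      by (auto simp: space_pair_measure)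
    then show "emeasure \<eta> ((\<lambda>x. (x, X)) -` (?g -` S \<inter> space (\<eta> \<Otimes>\<^sub>M ?P))) \<le> c" using le by simp
  qed
  also have "\<dots> = c" by (simp add: P.emeasure_space_1)
  finally show ?thesis .
qed

section \<open>The random iterated function system\<close>

text \<open>The two series agree up to the index \<open>n\<close>, and beyond it both are dominated by one geometric
  series.\<close>

lemma
  fixes d lam :: "nat \<Rightarrow> real" and y :: "nat \<Rightarrow> real" and i j :: "nat \<Rightarrow> nat"
  assumes D: "\<And>k. \<bar>d (i k)\<bar> \<le> D" "\<And>k. \<bar>d (j k)\<bar> \<le> D" and \<beta>: "0 < \<beta>"
    and eq: "\<And>k. k \<le> n \<Longrightarrow> i k = j k"
    and small: "\<And>k. n < k \<Longrightarrow> \<bar>(\<Prod>l<k. lam (i l)) * (\<Prod>l<k. y l)\<bar> \<le> exp (- \<beta> * real k)"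
      "\<And>k. n < k \<Longrightarrow> \<bar>(\<Prod>l<k. lam (j l)) * (\<Prod>l<k. y l)\<bar> \<le> exp (- \<beta> * real k)"
  shows projection_summable_geometric: "projection_summable d lam i y"
    and projection_close: "\<bar>natural_projection d lam i y - natural_projection d lam j y\<bar>
      \<le> 2 * D / (1 - exp (- \<beta>)) * exp (- \<beta> * real (Suc n))"
proof -
  let ?t = "\<lambda>i k. d (i (Suc k)) * (\<Prod>l\<le>k. lam (i l)) * (\<Prod>l\<le>k. y l)"
  have q: "0 < exp (- \<beta>)" "exp (- \<beta>) < 1" using \<beta> by auto
  have D0: "0 \<le> D" using D(1)[of 0] by linarith
  have bound: "\<bar>?t i (k + n)\<bar> \<le> D * exp (- \<beta> * Suc n) * exp (- \<beta>) ^ k"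
    if i: "\<And>k. \<bar>d (i k)\<bar> \<le> D" "\<And>k. n < k \<Longrightarrow> \<bar>(\<Prod>l<k. lam (i l)) * (\<Prod>l<k. y l)\<bar> \<le> exp (- \<beta> * real k)" for i k
  proof -
    have "\<bar>?t i (k + n)\<bar> = \<bar>d (i (Suc (k + n)))\<bar> * \<bar>(\<Prod>l<Suc (k + n). lam (i l)) * (\<Prod>l<Suc (k + n). y l)\<bar>"
      unfolding lessThan_Suc_atMost by (simp add: abs_mult mult.assoc)
    also have "\<dots> \<le> D * exp (- \<beta> * Suc (k + n))"
      by (rule mult_mono[OF i(1) i(2)]) (use D0 in simp_all)
    also have "exp (- \<beta> * Suc (k + n)) = exp (- \<beta> * Suc n) * exp (- \<beta>) ^ k"
      by (simp add: exp_of_nat_mult[symmetric] exp_add[symmetric] algebra_simps)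
    finally show ?thesis by simp
  qed
  have geo: "summable (\<lambda>k. D * exp (- \<beta> * Suc n) * exp (- \<beta>) ^ k)"
    using q by (intro summable_mult summable_geometric) auto
  have sum: "summable (?t i)"
    if i: "\<And>k. \<bar>d (i k)\<bar> \<le> D" "\<And>k. n < k \<Longrightarrow> \<bar>(\<Prod>l<k. lam (i l)) * (\<Prod>l<k. y l)\<bar> \<le> exp (- \<beta> * real k)" for i
  proof -
    have "summable (\<lambda>k. ?t i (k + n))"
      by (rule summable_comparison_test'[OF geo, of 0]) (use bound[OF i] in simp)
    then show ?thesis by (rule summable_iff_shift[of "?t i" n, THEN iffD1])
  qed
  have si: "summable (?t i)" and sj: "summable (?t j)" using sum D small by blast+
  show "projection_summable d lam i y" using si by (simp add: projection_summable_def)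
  let ?u = "\<lambda>k. ?t i k - ?t j k"
  have su: "summable ?u" by (rule summable_diff[OF si sj])
  have "(\<Sum>k. ?u k) = (\<Sum>k. ?u (k + n)) + (\<Sum>k<n. ?u k)" by (rule suminf_split_initial_segment[OF su])
  moreover have "(\<Sum>k<n. ?u k) = 0" using eq by (intro sum.neutral) auto
  moreover have "natural_projection d lam i y - natural_projection d lam j y = (\<Sum>k. ?u k)"
    unfolding natural_projection_def using eq[of 0] suminf_diff[OF si sj] by simp
  ultimately have "natural_projection d lam i y - natural_projection d lam j y = (\<Sum>k. ?u (k + n))" by simp
  also have "\<bar>\<dots>\<bar> \<le> (\<Sum>k. 2 * (D * exp (- \<beta> * Suc n) * exp (- \<beta>) ^ k))"
  proof (rule norm_suminf_le[where 'a=real, unfolded real_norm_def])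
    fix k
    show "\<bar>?u (k + n)\<bar> \<le> 2 * (D * exp (- \<beta> * Suc n) * exp (- \<beta>) ^ k)"
      using bound[of i k, OF D(1) small(1)] bound[of j k, OF D(2) small(2)] by linarith
  qed (intro summable_mult geo)
  also have "\<dots> = 2 * (D * exp (- \<beta> * Suc n) * (\<Sum>k. exp (- \<beta>) ^ k))"
  proof -
    have "summable (\<lambda>k. exp (- \<beta>) ^ k)" using q by (intro summable_geometric) auto
    then show ?thesis by (simp only: suminf_mult[OF geo] suminf_mult)
  qed
  also have "\<dots> = 2 * D / (1 - exp (- \<beta>)) * exp (- \<beta> * Suc n)"
    using q by (subst suminf_geometric) (auto simp: field_simps)
  finally show "\<bar>natural_projection d lam i y - natural_projection d lam j y\<bar>
      \<le> 2 * D / (1 - exp (- \<beta>)) * exp (- \<beta> * real (Suc n))" .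
qed

locale random_ifs =
  fixes \<Omega> :: "'w measure" and Y :: "'w \<Rightarrow> real" and f :: "real \<Rightarrow> ennreal" and C1 :: real
    and m :: nat and d lam :: "nat \<Rightarrow> real" and \<mu> :: "(nat \<Rightarrow> nat) measure"
  assumes prob_\<Omega>: "prob_space \<Omega>"
    and Y_pos: "\<And>\<omega>. \<omega> \<in> space \<Omega> \<Longrightarrow> 0 < Y \<omega>"
    and Y_density: "distributed \<Omega> lborel Y f" and C1: "0 < C1"
    and density_le: "\<And>x. 0 < x \<Longrightarrow> f x \<le> ennreal (C1 / x)"
    and ln_Y: "integrable \<Omega> (\<lambda>\<omega>. ln (Y \<omega>))"
    and lam_pos: "\<And>j. j \<in> {1..m} \<Longrightarrow> 0 < lam j"
    and prob_\<mu>: "prob_space \<mu>" and sets_\<mu>: "sets \<mu> = sets (symbolic_space m)"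
    and ergodic_\<mu>: "ergodic \<mu> shift"
    and separated: "inj_on d {1..m} \<or> ((\<forall>j\<in>{1..m}. d j = 1) \<and> inj_on lam {1..m})"
begin

definition \<eta> :: "real measure" where "\<eta> = distr \<Omega> borel Y"

definition eta_inf :: "(nat \<Rightarrow> real) measure" where "eta_inf = (\<Pi>\<^sub>M n\<in>(UNIV :: nat set). \<eta>)"

abbreviation proj :: "(nat \<Rightarrow> nat) \<Rightarrow> (nat \<Rightarrow> real) \<Rightarrow> real" where
  "proj \<equiv> natural_projection d lam"

abbreviation \<nu> :: "(nat \<Rightarrow> real) \<Rightarrow> real measure" where
  "\<nu> \<equiv> projected_measure d lam \<mu>"

abbreviation close_mass :: "real \<Rightarrow> (nat \<Rightarrow> real) \<Rightarrow> (nat \<Rightarrow> nat) \<Rightarrow> ennreal" where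
  "close_mass r y i \<equiv> emeasure \<mu> {j \<in> space \<mu>. \<bar>proj i y - proj j y\<bar> < r}"

definition lam_prod :: "nat \<Rightarrow> (nat \<Rightarrow> nat) \<Rightarrow> real" where "lam_prod n i = (\<Prod>k<n. lam (i k))"

definition y_prod :: "nat \<Rightarrow> (nat \<Rightarrow> real) \<Rightarrow> real" where "y_prod n y = (\<Prod>k<n. y k)"

definition mean_ln_lam :: real where "mean_ln_lam = (\<integral>i. ln (lam (i 0)) \<partial>\<mu>)"

definition mean_ln_Y :: real where "mean_ln_Y = (\<integral>\<omega>. ln (Y \<omega>) \<partial>\<Omega>)"

lemma space_\<mu>: "space \<mu> = {i. \<forall>n. i n \<in> {1..m}}"
  using sets_eq_imp_space_eq[OF sets_\<mu>] by (auto simp: symbolic_space_def space_PiM)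

lemma Y_measurable [measurable]: "Y \<in> borel_measurable \<Omega>"
  using Y_density by (simp add: distributed_def)

lemma prob_\<eta>: "prob_space \<eta>"
  unfolding \<eta>_def using prob_\<Omega> Y_measurable by (rule prob_space.prob_space_distr)

lemma space_\<eta> [simp]: "space \<eta> = UNIV" and sets_\<eta> [simp, measurable_cong]: "sets \<eta> = sets borel"
  by (simp_all add: \<eta>_def)

lemma space_eta_inf [simp]: "space eta_inf = UNIV"
  by (simp add: eta_inf_def space_PiM)

lemma ergodic_eta_inf: "ergodic eta_inf shift"
  unfolding eta_inf_def by (rule ergodic_shift_PiM[OF prob_\<eta>])

sublocale Q: ergodic_system eta_inf shift
proof -
  interpret prob_space eta_inf
    unfolding eta_inf_def by (rule prob_space_PiM) (rule prob_\<eta>)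
  show "ergodic_system eta_inf shift"
  proof unfold_locales
    show "measure_invariant eta_inf shift" using ergodic_eta_inf unfolding ergodic_def by blast
  qed (rule ergodic_eta_inf)
qed

lemma letter_measurable [measurable]: "(\<lambda>i. i n) \<in> measurable \<mu> (count_space {1..m})"
proof -
  have "(\<lambda>i. i n) \<in> measurable (symbolic_space m) (count_space {1..m})"
    unfolding symbolic_space_def by (rule measurable_component_singleton) simp
  then show ?thesis using measurable_cong_sets[OF sets_\<mu> refl] by blast
qed

lemma coordinate_measurable [measurable]: "(\<lambda>y. y n) \<in> borel_measurable eta_inf"
proof -
  have "(\<lambda>y. y n) \<in> measurable eta_inf \<eta>"
    unfolding eta_inf_def by (rule measurable_component_singleton) simp
  then show ?thesis using measurable_cong_sets[OF refl sets_\<eta>] by blast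
qed

sublocale S: ergodic_labelled_system \<mu> shift "\<lambda>i. i 0" "{1..m}"
proof -
  interpret prob_space \<mu> by (rule prob_\<mu>)
  show "ergodic_labelled_system \<mu> shift (\<lambda>i. i 0) {1..m}"
  proof unfold_locales
    show "measure_invariant \<mu> shift" using ergodic_\<mu> unfolding ergodic_def by blast
  qed (rule ergodic_\<mu> letter_measurable finite_atLeastAtMost)+
qed

lemma itinerary_eq: "S.itinerary n i = map i [0..<n]"
  by (simp add: S.itinerary_eq_iff)

lemma itinerary_eq_itinerary: "S.itinerary n i = S.itinerary n j \<longleftrightarrow> (\<forall>k<n. i k = j k)"
  by (auto simp: itinerary_eq)

text \<open>The letters generate the product \<open>\<sigma>\<close>-algebra under the shift.\<close>

lemma ks_entropy_eq: "ks_entropy \<mu> shift = ereal S.entropy_rate"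
proof (rule S.ks_entropy_generator)
  have app: "S.approximable A"
    if "A \<in> sigma_sets (\<Pi>\<^sub>E n\<in>UNIV. space (count_space {1..m}))
      {{i \<in> \<Pi>\<^sub>E n\<in>UNIV. space (count_space {1..m}). i n \<in> A} | n A. n \<in> (UNIV :: nat set) \<and> A \<in> sets (count_space {1..m})}" for A
    using that
  proof (induction A rule: sigma_sets.induct)
    case (Basic A)
    then obtain n B where A: "A = {i \<in> \<Pi>\<^sub>E n\<in>UNIV. space (count_space {1..m}). i n \<in> B}" by blast
    have "A = {i \<in> space \<mu>. (shift ^^ n) i 0 \<in> B}" unfolding A by (auto simp: space_\<mu>)
    then show ?case using S.approximable_letter by simp
  next
    case Empty
    have "S.approximable {i \<in> space \<mu>. (shift ^^ 0) i 0 \<in> {}}" by (rule S.approximable_letter)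
    then show ?case by simp
  next
    case (Compl A)
    have "(\<Pi>\<^sub>E n\<in>UNIV. space (count_space {1..m})) = space \<mu>" by (auto simp: space_\<mu>)
    then show ?case using S.approximable_compl[OF Compl.IH] by simp
  next
    case (Union A)
    then show ?case by (intro S.approximable_UN)
  qed
  show "S.approximable A" if "A \<in> sets \<mu>" for A
    using that unfolding sets_\<mu> symbolic_space_def sets_PiM_single by (rule app)
  show "(\<lambda>i. i 0) ` space \<mu> = {1..m}"
  proof
    show "{1..m} \<subseteq> (\<lambda>i. i 0) ` space \<mu>"
    proof
      fix a assume "a \<in> {1..m}"
      then have "(\<lambda>_. a) \<in> space \<mu>" by (auto simp: space_\<mu>)
      then show "a \<in> (\<lambda>i. i 0) ` space \<mu>" by force
    qed
  qed (auto simp: space_\<mu>)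
qed

lemma lam_prod_pos: "i \<in> space \<mu> \<Longrightarrow> 0 < lam_prod n i"
  unfolding lam_prod_def using lam_pos by (intro prod_pos) (auto simp: space_\<mu>)

lemma lam_prod_measurable [measurable]: "lam_prod n \<in> borel_measurable \<mu>"
proof -
  have [measurable]: "(\<lambda>i. lam (i k)) \<in> borel_measurable \<mu>" for k
    by (rule measurable_compose[OF letter_measurable]) simp
  show ?thesis unfolding lam_prod_def[abs_def] by measurable
qed

lemma y_prod_measurable [measurable]: "y_prod n \<in> borel_measurable eta_inf"
  unfolding y_prod_def[abs_def] by measurable

lemma AE_coordinates_pos: "AE y in eta_inf. \<forall>k. 0 < y k"
proof -
  have "AE x in \<eta>. 0 < x"
    unfolding \<eta>_def by (subst AE_distr_iff) (use Y_pos in auto)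
  then have "AE y in eta_inf. 0 < y k" for k
    unfolding eta_inf_def by (intro AE_PiM_component prob_\<eta>) auto
  then show ?thesis by (simp add: AE_all_countable)
qed

lemma integrable_ln_lam: "integrable \<mu> (\<lambda>i. ln (lam (i 0)))"
  using S.integrable_itinerary[of "\<lambda>w. ln (lam (hd w))" 1] by simp

lemma
  fixes c :: real
  shows AE_lam_prod_less: "mean_ln_lam < c \<Longrightarrow> AE i in \<mu>. \<forall>\<^sub>F n in sequentially. lam_prod n i < exp (c * n)"
    and AE_lam_prod_greater: "c < mean_ln_lam \<Longrightarrow> AE i in \<mu>. \<forall>\<^sub>F n in sequentially. exp (c * n) < lam_prod n i"
proof -
  have "AE i in \<mu>. 0 < lam (i 0)" using lam_pos by (intro AE_I2) (auto simp: space_\<mu>)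
  note this [simp] integrable_ln_lam [simp]
  show "mean_ln_lam < c \<Longrightarrow> AE i in \<mu>. \<forall>\<^sub>F n in sequentially. lam_prod n i < exp (c * n)"
    using S.prod_eventually_less[of "\<lambda>i. lam (i 0)" c] by (simp add: mean_ln_lam_def lam_prod_def)
  show "c < mean_ln_lam \<Longrightarrow> AE i in \<mu>. \<forall>\<^sub>F n in sequentially. exp (c * n) < lam_prod n i"
    using S.prod_eventually_greater[of "\<lambda>i. lam (i 0)" c] by (simp add: mean_ln_lam_def lam_prod_def)
qed

lemma distr_coordinate: "distr eta_inf \<eta> (\<lambda>y. y 0) = \<eta>"
  unfolding eta_inf_def by (rule distr_PiM_component) (auto simp: prob_\<eta>)

lemma
  shows integrable_ln_coordinate: "integrable eta_inf (\<lambda>y. ln (y 0))"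
    and integral_ln_coordinate: "(\<integral>y. ln (y 0) \<partial>eta_inf) = mean_ln_Y"
proof -
  have c: "(\<lambda>y. y 0) \<in> measurable eta_inf \<eta>"
    using coordinate_measurable measurable_cong_sets[OF refl sets_\<eta>] by blast
  have ln: "integrable \<eta> (\<lambda>x. ln x)"
    unfolding \<eta>_def using ln_Y by (subst integrable_distr_eq) auto
  then show "integrable eta_inf (\<lambda>y. ln (y 0))"
    using integrable_distr[OF c, of ln] by (simp add: distr_coordinate)
  have "(\<integral>y. ln (y 0) \<partial>eta_inf) = (\<integral>x. ln x \<partial>distr eta_inf \<eta> (\<lambda>y. y 0))"
  proof (rule integral_distr[OF c, symmetric])
    have "(ln :: real \<Rightarrow> real) \<in> borel_measurable borel" by measurable
    then show "(ln :: real \<Rightarrow> real) \<in> borel_measurable \<eta>" using measurable_cong_sets[OF sets_\<eta> refl] by blast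
  qed
  also have "\<dots> = mean_ln_Y"
    unfolding distr_coordinate unfolding \<eta>_def mean_ln_Y_def by (subst integral_distr) auto
  finally show "(\<integral>y. ln (y 0) \<partial>eta_inf) = mean_ln_Y" .
qed

lemma
  fixes c :: real
  shows AE_y_prod_less: "mean_ln_Y < c \<Longrightarrow> AE y in eta_inf. \<forall>\<^sub>F n in sequentially. y_prod n y < exp (c * n)"
    and AE_y_prod_greater: "c < mean_ln_Y \<Longrightarrow> AE y in eta_inf. \<forall>\<^sub>F n in sequentially. exp (c * n) < y_prod n y"
proof -
  have "AE y in eta_inf. 0 < y 0" using AE_coordinates_pos by eventually_elim simp
  note this [simp] integrable_ln_coordinate [simp]
  show "mean_ln_Y < c \<Longrightarrow> AE y in eta_inf. \<forall>\<^sub>F n in sequentially. y_prod n y < exp (c * n)"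
    using Q.prod_eventually_less[of "\<lambda>y. y 0" c] by (simp add: integral_ln_coordinate y_prod_def)
  show "c < mean_ln_Y \<Longrightarrow> AE y in eta_inf. \<forall>\<^sub>F n in sequentially. exp (c * n) < y_prod n y"
    using Q.prod_eventually_greater[of "\<lambda>y. y 0" c] by (simp add: integral_ln_coordinate y_prod_def)
qed

lemma proj_measurable [measurable (raw)]:
  assumes F [measurable]: "F \<in> measurable N \<mu>" and G [measurable]: "G \<in> measurable N eta_inf"
  shows "(\<lambda>x. proj (F x) (G x)) \<in> borel_measurable N"
proof -
  have [measurable]: "(\<lambda>x. g (F x n)) \<in> borel_measurable N" for g :: "nat \<Rightarrow> real" and n
    by (rule measurable_compose[OF measurable_compose[OF F letter_measurable]]) simp
  have [measurable]: "(\<lambda>x. G x n) \<in> borel_measurable N" for n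
    by (rule measurable_compose[OF G coordinate_measurable])
  show ?thesis unfolding natural_projection_def by measurable
qed

definition d_max :: real where "d_max = (\<Sum>a\<in>{1..m}. \<bar>d a\<bar>)"

lemma d_le_d_max: "i \<in> space \<mu> \<Longrightarrow> \<bar>d (i k)\<bar> \<le> d_max"
  unfolding d_max_def by (intro member_le_sum) (auto simp: space_\<mu>)

lemma projected_measure_prob: "prob_space (\<nu> y)"
  unfolding projected_measure_def
  by (intro S.prob_space_distr natural_projection_measurable[OF sets_\<mu>])

subsection \<open>The upper bound for the dimension\<close>

text \<open>The likely cylinders of length \<open>n\<close> number at most \<open>exp (\<alpha> * n)\<close> for any \<open>\<alpha>\<close> above the entropy,
  and the images of their typical points have diameter of order \<open>exp (- \<beta> * n)\<close>.\<close>

lemma projected_measure_dim_le: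
  assumes neg: "mean_ln_lam + mean_ln_Y < 0" and s: "S.entropy_rate < s * - (mean_ln_lam + mean_ln_Y)"
  shows "AE y in eta_inf. measure_hausdorff_dim (\<nu> y) \<le> ereal s"
proof -
  define X where "X = - (mean_ln_lam + mean_ln_Y)"
  have X: "0 < X" "S.entropy_rate < s * X" using neg s by (auto simp: X_def)
  have s0: "0 < s" using X S.entropy_rate_nonneg by (smt (verit) zero_less_mult_pos2)
  have "S.entropy_rate / s < X" using X s0 by (simp add: field_simps)
  then obtain \<beta> where \<beta>: "S.entropy_rate / s < \<beta>" "\<beta> < X" using dense by blast
  have \<beta>0: "0 < \<beta>" using \<beta>(1) S.entropy_rate_nonneg s0 by (smt (verit) divide_nonneg_pos)
  have "S.entropy_rate < s * \<beta>" using \<beta> s0 by (simp add: field_simps)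
  then obtain \<alpha> where \<alpha>: "S.entropy_rate < \<alpha>" "\<alpha> < s * \<beta>" using dense by blast
  define c1 where "c1 = mean_ln_lam + (X - \<beta>) / 2"
  define c2 where "c2 = mean_ln_Y + (X - \<beta>) / 2"
  have c: "mean_ln_lam < c1" "mean_ln_Y < c2" "c1 + c2 = - \<beta>"
    using \<beta> by (auto simp: c1_def c2_def X_def field_simps)
  \<comment> \<open>The summand \<open>1\<close> keeps the radii positive.\<close>
  define C where "C = 2 * d_max / (1 - exp (- \<beta>)) + 1"
  have d_max: "0 \<le> d_max" unfolding d_max_def by (intro sum_nonneg) auto
  have C: "0 < C" unfolding C_def using \<beta>0 d_max by (intro add_nonneg_pos divide_nonneg_pos) auto
  define r where "r n = C * exp (- \<beta> * real n)" for n
  define W where "W n = {w \<in> S.words n. exp (- \<alpha> * real n) \<le> S.word_prob w}" for n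
  have W_fin: "finite (W n)" for n unfolding W_def using S.finite_words by auto
  have W_card: "real (card (W n)) \<le> exp (\<alpha> * n)" for n
  proof -
    have "exp (- \<alpha> * n) * real (card (W n)) = (\<Sum>w\<in>W n. exp (- \<alpha> * n))" by simp
    also have "\<dots> \<le> (\<Sum>w\<in>W n. S.word_prob w)" by (intro sum_mono) (auto simp: W_def)
    also have "\<dots> \<le> (\<Sum>w\<in>S.words n. S.word_prob w)"
      using S.finite_words by (intro sum_mono2) (auto simp: W_def)
    finally have "exp (- \<alpha> * n) * real (card (W n)) \<le> 1"
      unfolding S.sum_word_prob .
    then show ?thesis by (simp add: exp_minus field_simps)
  qed
  have sum: "summable (\<lambda>n. card (W n) * r n powr s)"
  proof (rule summable_comparison_test')
    show "summable (\<lambda>n. C powr s * exp (\<alpha> - s * \<beta>) ^ n)"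
      using \<alpha> by (intro summable_mult summable_geometric) auto
    fix n
    have r: "r n powr s = C powr s * exp (- s * \<beta> * n)"
      unfolding r_def using C by (simp add: powr_mult exp_powr_real mult_ac)
    have "card (W n) * r n powr s \<le> exp (\<alpha> * n) * (C powr s * exp (- s * \<beta> * n))"
      unfolding r by (intro mult_right_mono W_card) auto
    also have "exp (\<alpha> * n) * (C powr s * exp (- s * \<beta> * n)) = C powr s * exp (\<alpha> - s * \<beta>) ^ n"
      by (simp add: exp_of_nat_mult[symmetric] exp_add[symmetric] algebra_simps)
    finally show "norm (card (W n) * r n powr s) \<le> C powr s * exp (\<alpha> - s * \<beta>) ^ n" by simp
  qed
  show ?thesis
    using AE_y_prod_less[OF c(2)] AE_coordinates_pos
  proof eventually_elim
    case (elim y)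
    obtain N0 where N0: "\<And>n. n \<ge> N0 \<Longrightarrow> y_prod n y < exp (c2 * n)" using elim(1) by (auto simp: eventually_sequentially)
    define G where "G n w = {i \<in> space \<mu>. S.itinerary n i = w \<and> (\<forall>k\<ge>n. lam_prod k i \<le> exp (c1 * k))}" for n w
    \<comment> \<open>The scales at which \<open>y\<close> is not yet typical contribute no sets, which is harmless because only
      the points covered at all large scales matter.\<close>
    define V where "V n w = (if n \<le> N0 then {} else closure ((\<lambda>i. proj i y) ` G n w))" for n w
    have pos: "0 \<le> y_prod n y" for n
      unfolding y_prod_def by (intro prod_nonneg ballI less_imp_le) (use elim(2) in blast)
    have close: "dist (proj i y) (proj j y) \<le> r n" if "N0 < n" "i \<in> G n w" "j \<in> G n w" for n w i j
    proof -
      obtain n' where n': "n = Suc n'" using \<open>N0 < n\<close> by (cases n) auto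
      have small: "\<bar>(\<Prod>l<k. lam (i l)) * (\<Prod>l<k. y l)\<bar> \<le> exp (- \<beta> * real k)"
        if "i \<in> G n w" "n' < k" for i k
      proof -
        have i: "i \<in> space \<mu>" "lam_prod k i \<le> exp (c1 * k)" using that n' by (auto simp: G_def)
        have "0 \<le> lam_prod k i" using lam_prod_pos[OF i(1)] by (rule less_imp_le)
        then have "\<bar>lam_prod k i * y_prod k y\<bar> = lam_prod k i * y_prod k y" using pos by simp
        also have "\<dots> \<le> exp (c1 * k) * exp (c2 * k)"
          using i(2) N0[of k] \<open>N0 < n\<close> n' \<open>n' < k\<close> pos by (intro mult_mono) (auto intro: less_imp_le)
        also have "\<dots> = exp (- \<beta> * k)" unfolding c(3)[symmetric] by (simp add: exp_add[symmetric] algebra_simps)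
        finally show ?thesis by (simp add: lam_prod_def y_prod_def)
      qed
      have "S.itinerary n i = S.itinerary n j" using that by (simp add: G_def)
      then have eq: "k \<le> n' \<Longrightarrow> i k = j k" for k unfolding itinerary_eq_itinerary n' by auto
      have "i \<in> space \<mu>" "j \<in> space \<mu>" using that by (auto simp: G_def)
      then have "\<bar>proj i y - proj j y\<bar> \<le> 2 * d_max / (1 - exp (- \<beta>)) * exp (- \<beta> * real (Suc n'))"
        by (intro projection_close d_le_d_max \<beta>0 eq small[OF \<open>i \<in> G n w\<close>] small[OF \<open>j \<in> G n w\<close>])
      also have "\<dots> \<le> r n" unfolding r_def C_def n' by (simp add: algebra_simps)
      finally show ?thesis by (simp add: dist_real_def)
    qed
    have V: "bounded (V n w) \<and> diameter (V n w) \<le> r n" for n w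
    proof (cases "n \<le> N0 \<or> G n w = {}")
      case True
      then show ?thesis using C by (auto simp: V_def r_def)
    next
      case False
      then obtain i where i: "i \<in> G n w" by blast
      have b: "bounded ((\<lambda>i. proj i y) ` G n w)"
        unfolding bounded_def using close[OF _ i] False by (intro exI[of _ "proj i y"] exI[of _ "r n"]) auto
      moreover have "diameter ((\<lambda>i. proj i y) ` G n w) \<le> r n"
      proof (rule diameter_le)
        show "(\<lambda>i. proj i y) ` G n w \<noteq> {} \<or> 0 \<le> r n" using i by blast
        fix x z assume "x \<in> (\<lambda>i. proj i y) ` G n w" "z \<in> (\<lambda>i. proj i y) ` G n w"
        then obtain i j where "x = proj i y" "i \<in> G n w" "z = proj j y" "j \<in> G n w" by blast
        then show "norm (x - z) \<le> r n" using close[of n i w j] False by (simp add: dist_norm)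
      qed
      ultimately show ?thesis using False diameter_closure[OF b] bounded_closure[OF b] unfolding V_def by simp
    qed
    have "AE x in \<nu> y. \<forall>\<^sub>F n in sequentially. \<exists>w\<in>W n. x \<in> V n w"
      unfolding projected_measure_def
    proof (subst AE_distr_iff)
      show "(\<lambda>i. proj i y) \<in> borel_measurable \<mu>" by (rule natural_projection_measurable[OF sets_\<mu>])
      have "{x \<in> space borel. \<forall>\<^sub>F n in sequentially. \<exists>w\<in>W n. x \<in> V n w} = (\<Union>N. \<Inter>n\<in>{N..}. \<Union>w\<in>W n. V n w)"
        unfolding eventually_sequentially by (rule set_eqI) (simp only: mem_Collect_eq UN_iff INT_iff atLeast_iff Ball_def space_borel UNIV_I simp_thms Bex_def)
      also have "\<dots> \<in> sets borel"
      proof -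
        have "V n w \<in> sets borel" for n w unfolding V_def by (auto intro!: borel_closed)
        then have "(\<Union>w\<in>W n. V n w) \<in> sets borel" for n by (intro sets.finite_UN W_fin)
        then have "(\<Inter>n\<in>{N..}. \<Union>w\<in>W n. V n w) \<in> sets borel" for N
          by (intro sets.countable_INT') auto
        then show ?thesis by (intro sets.countable_nat_UN) auto
      qed
      finally show "{x \<in> space borel. \<forall>\<^sub>F n in sequentially. \<exists>w\<in>W n. x \<in> V n w} \<in> sets borel" .
      show "AE i in \<mu>. \<forall>\<^sub>F n in sequentially. \<exists>w\<in>W n. proj i y \<in> V n w"
        using S.word_prob_eventually_ge[OF \<alpha>(1)] AE_lam_prod_less[OF c(1)] AE_space
      proof eventually_elim
        case (elim i)
        then obtain N1 where N1: "\<And>k. k \<ge> N1 \<Longrightarrow> lam_prod k i < exp (c1 * k)" by (auto simp: eventually_sequentially)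
        show ?case
          using elim(1) eventually_gt_at_top[of "max N0 N1"]
        proof eventually_elim
          case (elim n)
          have "S.itinerary n i \<in> W n" using elim S.itinerary_in_words[OF \<open>i \<in> space \<mu>\<close>] by (simp add: W_def)
          moreover have "i \<in> G n (S.itinerary n i)"
            using \<open>i \<in> space \<mu>\<close> N1 elim by (auto simp: G_def intro!: less_imp_le)
          then have "proj i y \<in> V n (S.itinerary n i)"
            using elim closure_subset[of "(\<lambda>i. proj i y) ` G n (S.itinerary n i)"] by (auto simp: V_def)
          ultimately show ?case by blast
        qed
      qed
    qed
    moreover have "r \<longlonglongrightarrow> 0" unfolding r_def using \<beta>0 by real_asymp
    moreover have "0 < r n" for n using C by (simp add: r_def)
    ultimately show ?case
      using V by (intro measure_hausdorff_dim_le[where V=V, OF W_fin _ _ _ _ s0 sum]) blast+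
  qed
qed

end

lemma (in prob_space) nn_integral_le_of_AE_le:
  assumes "AE x in M. g x \<le> c" shows "(\<integral>\<^sup>+x. g x \<partial>M) \<le> c"
  using nn_integral_mono_AE[OF assms] by (simp add: emeasure_space_1)

text \<open>Positivity of \<open>v\<close> lets the constant absorb the finitely many exceptions.\<close>

lemma eventually_le_imp_multiple:
  fixes u v :: "nat \<Rightarrow> real"
  assumes "\<forall>\<^sub>F n in sequentially. u n \<le> v n" "\<And>n. 0 < v n"
  shows "\<exists>N::nat. \<forall>n. u n \<le> N * v n"
proof -
  obtain n0 where n0: "\<And>n. n \<ge> n0 \<Longrightarrow> u n \<le> v n" using assms(1) by (auto simp: eventually_sequentially)
  obtain N :: nat where N: "1 + (\<Sum>n<n0. \<bar>u n\<bar> / v n) \<le> N" using real_arch_simple by blast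
  have s0: "0 \<le> (\<Sum>n<n0. \<bar>u n\<bar> / v n)" using assms(2) by (intro sum_nonneg) (auto simp: less_imp_le)
  have "u n \<le> N * v n" for n
  proof (cases "n < n0")
    case True
    have "\<bar>u n\<bar> / v n \<le> (\<Sum>n<n0. \<bar>u n\<bar> / v n)"
      using True assms(2) by (intro member_le_sum) (auto simp: less_imp_le)
    then have "\<bar>u n\<bar> / v n \<le> N" using N by linarith
    then show ?thesis using assms(2)[of n] by (simp add: pos_divide_le_eq)
  next
    case False
    then have "u n \<le> 1 * v n" using n0 by simp
    also have "\<dots> \<le> N * v n" using N s0 assms(2)[of n] by (intro mult_right_mono) auto
    finally show ?thesis .
  qed
  then show ?thesis by blast
qed

context random_ifs
begin

subsection \<open>The energy estimate\<close>

text \<open>The points whose cylinders are not too likely and not contracted too much, with a uniform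
  constant \<open>N\<close>; the last condition makes the series converge.\<close>

definition good_points :: "real \<Rightarrow> real \<Rightarrow> real \<Rightarrow> nat \<Rightarrow> (nat \<Rightarrow> nat) set" where
  "good_points b g c N = {i \<in> space \<mu>. (\<forall>n. S.word_prob (S.itinerary n i) \<le> N * exp (- b * real n)) \<and>
     (\<forall>n. exp (- g * real n) \<le> N * lam_prod n i) \<and> (\<forall>\<^sub>F n in sequentially. lam_prod n i < exp (c * real n))}"

definition good_ys :: "real \<Rightarrow> real \<Rightarrow> nat \<Rightarrow> (nat \<Rightarrow> real) set" where
  "good_ys g c N = {y. (\<forall>k. 0 < y k) \<and> (\<forall>n. exp (- g * real n) \<le> N * y_prod n y) \<and>
     (\<forall>\<^sub>F n in sequentially. y_prod n y < exp (c * real n))}"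

lemma good_points_sets [measurable]: "good_points b g c N \<in> sets \<mu>"
proof -
  have [measurable]: "(\<lambda>i. S.word_prob (S.itinerary n i)) \<in> borel_measurable \<mu>" for n
    by (rule measurable_compose[OF S.itinerary_measurable]) simp
  show ?thesis unfolding good_points_def eventually_sequentially by measurable
qed

lemma good_ys_sets [measurable]: "good_ys g c N \<in> sets eta_inf"
proof -
  have "{y \<in> space eta_inf. (\<forall>k. 0 < y k) \<and> (\<forall>n. exp (- g * n) \<le> N * y_prod n y) \<and>
     (\<exists>n0. \<forall>n\<ge>n0. y_prod n y < exp (c * n))} \<in> sets eta_inf" by measurable
  then show ?thesis by (simp add: good_ys_def eventually_sequentially)
qed

lemma good_points_mono: "N \<le> N' \<Longrightarrow> good_points b g c N \<subseteq> good_points b g c N'"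
proof
  fix i assume "N \<le> N'" and i: "i \<in> good_points b g c N"
  then have N: "real N \<le> real N'" by simp
  have "i \<in> space \<mu>" using i by (simp add: good_points_def)
  have "real N * exp (- b * n) \<le> N' * exp (- b * n)" for n :: nat using N by (intro mult_right_mono) auto
  moreover have "real N * lam_prod n i \<le> N' * lam_prod n i" for n :: nat
    using N lam_prod_pos[OF \<open>i \<in> space \<mu>\<close>, of n] by (intro mult_right_mono) auto
  ultimately show "i \<in> good_points b g c N'"
    using i unfolding good_points_def by (blast intro: order_trans)
qed

lemma good_ys_mono: "N \<le> N' \<Longrightarrow> good_ys g c N \<subseteq> good_ys g c N'"
proof
  fix y assume "N \<le> N'" and y: "y \<in> good_ys g c N"
  then have N: "real N \<le> real N'" by simp
  have "0 \<le> y_prod n y" for n unfolding y_prod_def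
    using y by (intro prod_nonneg ballI less_imp_le) (simp add: good_ys_def)
  then have "real N * y_prod n y \<le> N' * y_prod n y" for n :: nat
    using N by (intro mult_right_mono) auto
  then show "y \<in> good_ys g c N'"
    using y unfolding good_ys_def by (blast intro: order_trans)
qed

lemma AE_good_points:
  assumes b: "0 \<le> b" "b < S.entropy_rate" and g: "- g < mean_ln_lam" and c: "mean_ln_lam < c"
  shows "AE i in \<mu>. \<exists>N. i \<in> good_points b g c N"
  using S.word_prob_eventually_le[OF b] AE_lam_prod_greater[OF g] AE_lam_prod_less[OF c] AE_space
proof eventually_elim
  case (elim i)
  have "\<forall>\<^sub>F n in sequentially. S.word_prob (S.itinerary n i) \<le> exp (- b * n)"
    using elim(1) by eventually_elim simp
  then obtain N1 :: nat where N1: "\<And>n. S.word_prob (S.itinerary n i) \<le> N1 * exp (- b * n)"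
    using eventually_le_imp_multiple[of "\<lambda>n. S.word_prob (S.itinerary n i)" "\<lambda>n. exp (- b * n)"] by auto
  have "\<forall>\<^sub>F n in sequentially. exp (- g * n) \<le> lam_prod n i"
    using elim(2) by eventually_elim simp
  then obtain N2 :: nat where N2: "\<And>n. exp (- g * n) \<le> N2 * lam_prod n i"
    using eventually_le_imp_multiple[of "\<lambda>n. exp (- g * n)" "\<lambda>n. lam_prod n i"] lam_prod_pos[OF elim(4)] by auto
  have "S.word_prob (S.itinerary n i) \<le> (N1 + N2) * exp (- b * n)" for n
    using N1[of n] by (rule order_trans) (simp add: mult_right_mono)
  moreover have "exp (- g * n) \<le> (N1 + N2) * lam_prod n i" for n :: nat
    using N2[of n] lam_prod_pos[OF elim(4), of n] by (elim order_trans) (simp add: mult_right_mono)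
  ultimately show ?case using elim by (auto simp: good_points_def intro!: exI[of _ "N1 + N2"])
qed

lemma AE_good_ys:
  assumes g: "- g < mean_ln_Y" and c: "mean_ln_Y < c"
  shows "AE y in eta_inf. \<exists>N. y \<in> good_ys g c N"
  using AE_y_prod_greater[OF g] AE_y_prod_less[OF c] AE_coordinates_pos
proof eventually_elim
  case (elim y)
  have pos: "0 < y_prod n y" for n unfolding y_prod_def using elim(3) by (intro prod_pos) auto
  have "\<forall>\<^sub>F n in sequentially. exp (- g * n) \<le> y_prod n y"
    using elim(1) by eventually_elim simp
  then obtain N :: nat where N: "\<And>n. exp (- g * n) \<le> N * y_prod n y"
    using eventually_le_imp_multiple[of "\<lambda>n. exp (- g * n)" "\<lambda>n. y_prod n y"] pos by auto
  then show ?case using elim unfolding good_ys_def by blast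
qed

lemma projection_summable_typical:
  fixes c1 c2 :: real
  assumes i: "i \<in> space \<mu>" "\<forall>\<^sub>F n in sequentially. lam_prod n i < exp (c1 * n)"
    and y: "\<And>k. 0 < y k" "\<forall>\<^sub>F n in sequentially. y_prod n y < exp (c2 * n)" and c: "c1 + c2 < 0"
  shows "projection_summable d lam i y"
proof -
  have "\<forall>\<^sub>F n in sequentially. lam_prod n i < exp (c1 * n) \<and> y_prod n y < exp (c2 * n)"
    using i(2) y(2) by (rule eventually_conj)
  then obtain n0 where n0: "\<And>n. n \<ge> n0 \<Longrightarrow> lam_prod n i < exp (c1 * n) \<and> y_prod n y < exp (c2 * n)"
    by (auto simp: eventually_sequentially)
  have small: "\<bar>(\<Prod>l<k. lam (i l)) * (\<Prod>l<k. y l)\<bar> \<le> exp (- (- (c1 + c2)) * real k)" if "n0 < k" for k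
  proof -
    have p: "0 < lam_prod k i" "0 < y_prod k y"
      using lam_prod_pos[OF i(1)] y(1) by (auto simp: y_prod_def intro!: prod_pos)
    have "lam_prod k i * y_prod k y \<le> exp (c1 * k) * exp (c2 * k)"
      using n0[of k] that p by (intro mult_mono) auto
    also have "\<dots> = exp ((c1 + c2) * k)" by (simp add: exp_add[symmetric] algebra_simps)
    finally show ?thesis using p by (simp add: lam_prod_def y_prod_def add.commute)
  qed
  show ?thesis
    using projection_summable_geometric[of d i d_max i "- (c1 + c2)" n0 lam y] d_le_d_max[OF i(1)] c small by auto
qed

text \<open>Only the coordinate singled out by the affine representation is integrated; all other factors
  are bounded below on the good sets. The constant is uniform in the pair.\<close>

lemma transversality:
  assumes c: "c1 + c2 < 0"
  obtains C where "1 \<le> C" "\<And>i j n r.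
    i \<in> good_points b g1 c1 N \<Longrightarrow> j \<in> space \<mu> \<Longrightarrow> (\<forall>\<^sub>F n in sequentially. lam_prod n j < exp (c1 * n)) \<Longrightarrow>
    (\<And>k. k < n \<Longrightarrow> i k = j k) \<Longrightarrow> i n \<noteq> j n \<Longrightarrow> 0 < r \<Longrightarrow>
    emeasure eta_inf {y \<in> good_ys g2 c2 N. \<bar>proj i y - proj j y\<bar> < r} \<le> ennreal (C * exp ((g1 + g2) * n) * r)"
proof -
  define \<D> where "\<D> = ({d a - d b | a b. a \<in> {1..m} \<and> b \<in> {1..m}} \<union> {lam a - lam b | a b. a \<in> {1..m} \<and> b \<in> {1..m}})"
  have "finite \<D>"
    unfolding \<D>_def by (intro finite_UnI finite_image_set2) simp_all
  define A where "A = (\<Sum>D\<in>\<D>. (4 * C1 + 2) / \<bar>D\<bar>)"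
  have A: "(4 * C1 + 2) / \<bar>D\<bar> \<le> A" if "D \<in> \<D>" for D
    unfolding A_def using C1 \<open>finite \<D>\<close> that by (intro member_le_sum) auto
  have A0: "0 \<le> A" unfolding A_def using C1 by (intro sum_nonneg) auto
  \<comment> \<open>The singled-out coordinate may be the one after the first difference; the factor \<open>exp \<bar>g2\<bar>\<close>
    pays for this step.\<close>
  define C where "C = 1 + A * (real N)\<^sup>2 * exp \<bar>g2\<bar>"
  have "1 \<le> C" unfolding C_def using A0 by simp
  moreover have "emeasure eta_inf {y \<in> good_ys g2 c2 N. \<bar>proj i y - proj j y\<bar> < r} \<le> ennreal (C * exp ((g1 + g2) * n) * r)"
    if i: "i \<in> good_points b g1 c1 N" and j: "j \<in> space \<mu>" "\<forall>\<^sub>F n in sequentially. lam_prod n j < exp (c1 * n)"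
      and n: "\<And>k. k < n \<Longrightarrow> i k = j k" "i n \<noteq> j n" and r: "0 < r" for i j n r
  proof -
    have i': "i \<in> space \<mu>" "\<forall>\<^sub>F n in sequentially. lam_prod n i < exp (c1 * n)"
      "exp (- g1 * n) \<le> N * lam_prod n i" using i by (auto simp: good_points_def)
    have N: "0 < N" using i'(3) by (cases "N = 0") auto
    have ij: "i k \<in> {1..m}" "j k \<in> {1..m}" for k using i' j by (auto simp: space_\<mu>)
    obtain D k Z where D: "D \<in> \<D>" "D \<noteq> 0" and k: "k = n \<or> k = Suc n"
      and Z: "\<And>y x. Z (y(k := x)) = Z y"
      and diff: "\<And>y. projection_summable d lam i y \<Longrightarrow> projection_summable d lam j y \<Longrightarrow> (\<And>k. 0 < y k) \<Longrightarrow>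
         proj i y - proj j y = (\<Prod>l<n. lam (i l)) * (\<Prod>l<k. y l) * (D + y k * Z y)"
      unfolding \<D>_def by (rule projection_diff_affine[where i=i and j=j and n=n and d=d and lam=lam and m=m, OF n ij lam_pos separated]) blast+
    let ?S = "{y \<in> good_ys g2 c2 N. \<bar>proj i y - proj j y\<bar> < r}"
    define \<rho> where "\<rho> = r * (real N)\<^sup>2 * exp (g1 * n + g2 * k)"
    have \<rho>: "0 < \<rho>" using r N by (simp add: \<rho>_def)
    have affine: "\<bar>D + y k * Z y\<bar> < \<rho>" if y: "y \<in> ?S" for y
    proof -
      have y': "0 < y k" "exp (- g2 * k) \<le> N * y_prod k y" "\<forall>\<^sub>F n in sequentially. y_prod n y < exp (c2 * n)" for k
        using y by (auto simp: good_ys_def)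
      have "projection_summable d lam i y" "projection_summable d lam j y"
        using projection_summable_typical[OF i'(1,2) y'(1,3) c] projection_summable_typical[OF j y'(1,3) c] by blast+
      then have eq: "proj i y - proj j y = lam_prod n i * y_prod k y * (D + y k * Z y)"
        using diff y'(1) by (simp add: lam_prod_def y_prod_def)
      have p: "0 < lam_prod n i * y_prod k y"
        using lam_prod_pos[OF i'(1)] y'(1) by (auto simp: y_prod_def intro!: mult_pos_pos prod_pos)
      have "exp (- g1 * n) * exp (- g2 * k) \<le> (N * lam_prod n i) * (N * y_prod k y)"
        using i'(3) y'(2)[of k] by (intro mult_mono) (auto intro: order_trans[OF exp_ge_zero])
      then have "1 \<le> (real N)\<^sup>2 * exp (g1 * n + g2 * k) * (lam_prod n i * y_prod k y)"
        by (simp add: exp_minus exp_add power2_eq_square field_simps)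
      then have "r \<le> \<rho> * (lam_prod n i * y_prod k y)"
        unfolding \<rho>_def using r mult_left_mono[of 1 _ r] by (simp add: mult_ac)
      moreover have "\<bar>proj i y - proj j y\<bar> = (lam_prod n i * y_prod k y) * \<bar>D + y k * Z y\<bar>"
        unfolding eq abs_mult using p by (simp add: abs_mult[symmetric])
      ultimately have "(lam_prod n i * y_prod k y) * \<bar>D + y k * Z y\<bar> < (lam_prod n i * y_prod k y) * \<rho>"
        using y by (simp add: mult.commute)
      then show ?thesis using p by (simp only: mult_less_cancel_left_pos)
    qed
    have [measurable]: "(\<lambda>y. proj i y) \<in> borel_measurable eta_inf" "(\<lambda>y. proj j y) \<in> borel_measurable eta_inf"
      using i'(1) j(1) by (intro proj_measurable measurable_const measurable_ident_sets; simp)+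
    have S: "?S \<in> sets eta_inf"
    proof -
      have "{y \<in> space eta_inf. y \<in> good_ys g2 c2 N \<and> \<bar>proj i y - proj j y\<bar> < r} \<in> sets eta_inf"
        by measurable
      then show ?thesis by simp
    qed
    have "emeasure eta_inf ?S \<le> ennreal (A * \<rho>)"
      unfolding eta_inf_def
    proof (rule emeasure_PiM_le_coordinate[OF prob_\<eta>, where k=k])
      show "?S \<in> sets (Pi\<^sub>M UNIV (\<lambda>n. \<eta>))" using S by (simp add: eta_inf_def)
      fix y :: "nat \<Rightarrow> real"
      have "{x \<in> space \<eta>. y(k := x) \<in> ?S} \<subseteq> {x. 0 < x \<and> \<bar>D + x * Z y\<bar> < \<rho>}"
      proof
        fix x assume x: "x \<in> {x \<in> space \<eta>. y(k := x) \<in> ?S}"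
        then have "y(k := x) \<in> ?S" by blast
        from affine[OF this] have "\<bar>D + (y(k := x)) k * Z (y(k := x))\<bar> < \<rho>" .
        moreover have "0 < (y(k := x)) k" using x unfolding good_ys_def by blast
        ultimately show "x \<in> {x. 0 < x \<and> \<bar>D + x * Z y\<bar> < \<rho>}" unfolding Z by simp
      qed
      then have "emeasure \<eta> {x \<in> space \<eta>. y(k := x) \<in> ?S} \<le> emeasure \<eta> {x. 0 < x \<and> \<bar>D + x * Z y\<bar> < \<rho>}"
        by (rule emeasure_mono) simp
      also have "\<dots> \<le> ennreal ((4 * C1 + 2) / \<bar>D\<bar> * \<rho>)"
        unfolding \<eta>_def by (rule emeasure_affine_small[OF prob_\<Omega> Y_density C1 density_le D(2) \<rho>])
      also have "\<dots> \<le> ennreal (A * \<rho>)" using A[OF D(1)] \<rho> by (intro ennreal_leI mult_right_mono) auto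
      finally show "emeasure \<eta> {x \<in> space \<eta>. y(k := x) \<in> ?S} \<le> ennreal (A * \<rho>)" .
    qed
    also have "A * \<rho> \<le> C * exp ((g1 + g2) * n) * r"
    proof -
      have "g1 * n + g2 * k \<le> (g1 + g2) * n + \<bar>g2\<bar>" using k by (auto simp: algebra_simps)
      then have "exp (g1 * n + g2 * k) \<le> exp ((g1 + g2) * n) * exp \<bar>g2\<bar>" by (simp add: exp_add[symmetric])
      then have "A * \<rho> \<le> A * (r * (real N)\<^sup>2 * (exp ((g1 + g2) * n) * exp \<bar>g2\<bar>))"
        unfolding \<rho>_def using A0 r by (intro mult_left_mono) auto
      also have "\<dots> = (C - 1) * exp ((g1 + g2) * n) * r" by (simp add: C_def mult_ac)
      also have "\<dots> \<le> C * exp ((g1 + g2) * n) * r" using r by (intro mult_right_mono) auto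
      finally show ?thesis .
    qed
    finally show ?thesis by (simp add: ennreal_leI)
  qed
  ultimately show thesis by (rule that)
qed

lemma near_sets: "{j \<in> space \<mu>. \<bar>x - proj j y\<bar> < r} \<in> sets \<mu>"
  using natural_projection_measurable[OF sets_\<mu>, of d lam y] by measurable

lemma emeasure_near:
  "emeasure \<mu> {j \<in> space \<mu>. \<bar>x - proj j y\<bar> < r} = (\<integral>\<^sup>+j. of_bool (\<bar>x - proj j y\<bar> < r) \<partial>\<mu>)"
proof -
  have "(\<integral>\<^sup>+j. of_bool (\<bar>x - proj j y\<bar> < r) \<partial>\<mu>) = (\<integral>\<^sup>+j. indicator {j \<in> space \<mu>. \<bar>x - proj j y\<bar> < r} j \<partial>\<mu>)"
    by (intro nn_integral_cong) (simp add: indicator_def)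
  also have "\<dots> = emeasure \<mu> {j \<in> space \<mu>. \<bar>x - proj j y\<bar> < r}"
    by (rule nn_integral_indicator[OF near_sets])
  finally show ?thesis ..
qed

lemma emeasure_near_measurable [measurable]:
  "(\<lambda>(y, i). close_mass r y i) \<in> borel_measurable (eta_inf \<Otimes>\<^sub>M \<mu>)"
  unfolding emeasure_near by measurable

text \<open>Two points that agree on exactly \<open>n\<close> letters have projections closer than \<open>r\<close> with probability
  at most a constant times \<open>(exp ((g1 + g2) * n) * r) powr s\<close>, and given the first point, the second
  one agrees with it on \<open>n\<close> letters with probability of order \<open>exp (- b * n)\<close>. The condition
  \<open>s * (g1 + g2) < b\<close> makes the sum over \<open>n\<close> converge.\<close>

theorem energy_estimate:
  assumes c: "c1 + c2 < 0" "mean_ln_lam < c1" and s: "0 < s" "s \<le> 1" "s * (g1 + g2) < b" and b: "0 < b"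
  obtains K where "0 \<le> K" "\<And>r. 0 < r \<Longrightarrow>
    (\<integral>\<^sup>+y. indicator (good_ys g2 c2 N) y *
      (\<integral>\<^sup>+i. indicator (good_points b g1 c1 N) i * close_mass r y i \<partial>\<mu>) \<partial>eta_inf)
    \<le> ennreal (K * r powr s)"
proof -
  let ?A = "good_points b g1 c1 N" and ?B = "good_ys g2 c2 N"
  interpret P: pair_sigma_finite \<mu> eta_inf ..
  obtain C where C: "1 \<le> C" and trans: "\<And>i j n r.
    i \<in> good_points b g1 c1 N \<Longrightarrow> j \<in> space \<mu> \<Longrightarrow> (\<forall>\<^sub>F n in sequentially. lam_prod n j < exp (c1 * n)) \<Longrightarrow>
    (\<And>k. k < n \<Longrightarrow> i k = j k) \<Longrightarrow> i n \<noteq> j n \<Longrightarrow> 0 < r \<Longrightarrow>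
    emeasure eta_inf {y \<in> good_ys g2 c2 N. \<bar>proj i y - proj j y\<bar> < r} \<le> ennreal (C * exp ((g1 + g2) * n) * r)"
    using transversality[OF c(1), of b g1 N g2] by blast
  define q where "q = exp (s * (g1 + g2) - b)"
  have q: "0 < q" "q < 1" using s by (auto simp: q_def)
  define K where "K = C powr s * N * (1 / (1 - q))"
  have "0 \<le> K" using q by (simp add: K_def)
  moreover have "(\<integral>\<^sup>+y. indicator ?B y * (\<integral>\<^sup>+i. indicator ?A i * close_mass r y i \<partial>\<mu>) \<partial>eta_inf)
    \<le> ennreal (K * r powr s)" if r: "0 < r" for r
  proof -
    let ?near = "\<lambda>y i j. of_bool (\<bar>proj i y - proj j y\<bar> < r) :: ennreal"
    have "(\<integral>\<^sup>+y. indicator ?B y * (\<integral>\<^sup>+i. indicator ?A i * close_mass r y i \<partial>\<mu>) \<partial>eta_inf)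
        = (\<integral>\<^sup>+y. \<integral>\<^sup>+i. indicator ?B y * (indicator ?A i * (\<integral>\<^sup>+j. ?near y i j \<partial>\<mu>)) \<partial>\<mu> \<partial>eta_inf)"
      unfolding emeasure_near by (intro nn_integral_cong nn_integral_cmult[symmetric]) measurable
    also have "\<dots> = (\<integral>\<^sup>+i. \<integral>\<^sup>+y. indicator ?B y * (indicator ?A i * (\<integral>\<^sup>+j. ?near y i j \<partial>\<mu>)) \<partial>eta_inf \<partial>\<mu>)"
      by (rule P.Fubini') measurable
    also have "\<dots> = (\<integral>\<^sup>+i. \<integral>\<^sup>+y. \<integral>\<^sup>+j. indicator ?B y * indicator ?A i * ?near y i j \<partial>\<mu> \<partial>eta_inf \<partial>\<mu>)"
      by (intro nn_integral_cong, subst mult.assoc[symmetric], rule nn_integral_cmult[symmetric]) measurable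
    also have "\<dots> = (\<integral>\<^sup>+i. \<integral>\<^sup>+j. \<integral>\<^sup>+y. indicator ?B y * indicator ?A i * ?near y i j \<partial>eta_inf \<partial>\<mu> \<partial>\<mu>)"
      by (intro nn_integral_cong P.Fubini') measurable
    also have "\<dots> \<le> ennreal (K * r powr s)"
    proof (rule S.nn_integral_le_of_AE_le, rule AE_I2)
      fix i assume i: "i \<in> space \<mu>"
      show "(\<integral>\<^sup>+j. \<integral>\<^sup>+y. indicator ?B y * indicator ?A i * ?near y i j \<partial>eta_inf \<partial>\<mu>) \<le> ennreal (K * r powr s)"
      proof (cases "i \<in> ?A")
        case True
        have p: "S.word_prob (S.itinerary n i) \<le> N * exp (- b * n)" for n using True by (simp add: good_points_def)
        let ?I = "\<lambda>n. {j \<in> space \<mu>. S.itinerary n j = S.itinerary n i}"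
        have I: "emeasure \<mu> (?I n) = ennreal (S.word_prob (S.itinerary n i))" for n
          by (simp add: S.word_prob_def S.emeasure_eq_measure)
        have I_sets: "?I n \<in> sets \<mu>" for n using S.pred_itinerary[of n] by (simp add: pred_def)
        have neq: "AE j in \<mu>. j \<noteq> i"
        proof -
          have "emeasure \<mu> (\<Inter>n. ?I n) \<le> 0"
          proof (rule LIMSEQ_le_const)
            have "(\<lambda>n. N * exp (- b * real n)) \<longlonglongrightarrow> 0" using b by real_asymp
            then have "(\<lambda>n. ennreal (N * exp (- b * real n))) \<longlonglongrightarrow> ennreal 0" by (rule tendsto_ennrealI)
            then show "(\<lambda>n. ennreal (N * exp (- b * real n))) \<longlonglongrightarrow> 0" by simp
            have "emeasure \<mu> (\<Inter>n. ?I n) \<le> emeasure \<mu> (?I n)" for n using I_sets by (intro emeasure_mono) auto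
            then have "emeasure \<mu> (\<Inter>n. ?I n) \<le> ennreal (N * exp (- b * real n))" for n
              using p[of n] unfolding I by (meson ennreal_leI order_trans)
            then show "\<exists>N'. \<forall>n\<ge>N'. emeasure \<mu> (\<Inter>n. ?I n) \<le> ennreal (N * exp (- b * real n))" by blast
          qed
          then have "(\<Inter>n. ?I n) \<in> null_sets \<mu>" using I_sets by (auto simp: null_sets_def)
          then show ?thesis by (rule AE_I') auto
        qed
        define u where "u n = (C * exp ((g1 + g2) * n) * r) powr s" for n :: nat
        have "AE j in \<mu>. (\<integral>\<^sup>+y. indicator ?B y * indicator ?A i * ?near y i j \<partial>eta_inf)
            \<le> (\<Sum>n. ennreal (u n) * indicator (?I n) j)"
          using neq AE_lam_prod_less[OF c(2)] AE_space
        proof eventually_elim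
          case (elim j)
          let ?S = "{y \<in> ?B. \<bar>proj i y - proj j y\<bar> < r}"
          define n where "n = (LEAST n. i n \<noteq> j n)"
          have "\<exists>n. i n \<noteq> j n" using elim(1) by auto
          then have n: "i n \<noteq> j n" "\<And>k. k < n \<Longrightarrow> i k = j k"
            unfolding n_def by (rule LeastI_ex) (use not_less_Least in blast)
          have "(\<integral>\<^sup>+y. indicator ?B y * indicator ?A i * ?near y i j \<partial>eta_inf) = (\<integral>\<^sup>+y. indicator ?S y \<partial>eta_inf)"
            using True by (intro nn_integral_cong) (auto simp: indicator_def)
          also have "\<dots> = emeasure eta_inf ?S"
          proof (rule nn_integral_indicator)
            have [measurable]: "(\<lambda>y. proj i y) \<in> borel_measurable eta_inf" "(\<lambda>y. proj j y) \<in> borel_measurable eta_inf"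
              using i elim(3) by (intro proj_measurable measurable_const measurable_ident_sets; simp)+
            have "{y \<in> space eta_inf. y \<in> ?B \<and> \<bar>proj i y - proj j y\<bar> < r} \<in> sets eta_inf" by measurable
            then show "?S \<in> sets eta_inf" by simp
          qed
          \<comment> \<open>A probability that is at most \<open>t\<close> is at most \<open>t powr s\<close>, because \<open>s \<le> 1\<close>.\<close>
          also have "\<dots> \<le> ennreal (u n)"
          proof (cases "C * exp ((g1 + g2) * n) * r \<le> 1")
            case True
            have "C * exp ((g1 + g2) * n) * r = (C * exp ((g1 + g2) * n) * r) powr 1" using C r by simp
            also have "\<dots> \<le> u n" unfolding u_def using s C r True by (intro powr_mono') auto
            finally have "ennreal (C * exp ((g1 + g2) * n) * r) \<le> ennreal (u n)" by (rule ennreal_leI)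
            then show ?thesis using trans[OF \<open>i \<in> ?A\<close> elim(3,2) n(2,1) r] by (rule order_trans[rotated])
          next
            case False
            then have "1 \<le> u n" unfolding u_def using s by (intro ge_one_powr_ge_zero) auto
            then have "ennreal 1 \<le> ennreal (u n)" by (rule ennreal_leI)
            then show ?thesis using Q.measure_le_1[of ?S] by (auto intro: order_trans)
          qed
          also have "\<dots> = ennreal (u n) * indicator (?I n) j"
            using n(2) elim(3) by (simp add: itinerary_eq_itinerary)
          also have "\<dots> \<le> (\<Sum>n. ennreal (u n) * indicator (?I n) j)"
          proof -
            define h where "h = (\<lambda>n. ennreal (u n) * indicator (?I n) j)"
            have "h n \<le> suminf h" using sum_le_suminf[of h "{n}"] by simp
            then show ?thesis unfolding h_def .
          qed
          finally show ?case .
        qed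
        then have "(\<integral>\<^sup>+j. \<integral>\<^sup>+y. indicator ?B y * indicator ?A i * ?near y i j \<partial>eta_inf \<partial>\<mu>)
            \<le> (\<integral>\<^sup>+j. (\<Sum>n. ennreal (u n) * indicator (?I n) j) \<partial>\<mu>)"
          by (rule nn_integral_mono_AE)
        also have "\<dots> = (\<Sum>n. \<integral>\<^sup>+j. ennreal (u n) * indicator (?I n) j \<partial>\<mu>)"
          using I_sets by (intro nn_integral_suminf) measurable
        also have "\<dots> = (\<Sum>n. ennreal (u n) * ennreal (S.word_prob (S.itinerary n i)))"
          by (simp add: nn_integral_cmult_indicator[OF I_sets] I)
        also have "\<dots> \<le> (\<Sum>n. ennreal ((C powr s * r powr s * N) * q ^ n))"
        proof (rule suminf_le)
          fix n
          have u: "u n = C powr s * exp (s * (g1 + g2) * n) * r powr s"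
            unfolding u_def using C r by (simp add: powr_mult exp_powr_real mult_ac)
          have "u n * S.word_prob (S.itinerary n i) \<le> u n * (N * exp (- b * n))"
            by (intro mult_left_mono p) (simp add: u_def)
          also have "\<dots> = (C powr s * r powr s * N) * (exp (s * (g1 + g2) * n) * exp (- b * n))"
            unfolding u by (simp add: mult_ac)
          also have "exp (s * (g1 + g2) * n) * exp (- b * n) = q ^ n"
            unfolding q_def by (simp add: exp_of_nat_mult[symmetric] exp_add[symmetric] algebra_simps)
          finally have "ennreal (u n * S.word_prob (S.itinerary n i)) \<le> ennreal ((C powr s * r powr s * N) * q ^ n)"
            by (rule ennreal_leI)
          then show "ennreal (u n) * ennreal (S.word_prob (S.itinerary n i)) \<le> ennreal ((C powr s * r powr s * N) * q ^ n)"
            by (subst ennreal_mult[symmetric]) (auto simp: u_def)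
        qed auto
        also have "\<dots> = ennreal (\<Sum>n. (C powr s * r powr s * N) * q ^ n)"
          using q by (intro suminf_ennreal2 summable_mult summable_geometric) auto
        also have "(\<Sum>n. (C powr s * r powr s * N) * q ^ n) = K * r powr s"
        proof -
          have "summable (\<lambda>n. q ^ n)" using q by (intro summable_geometric) auto
          then have "(\<Sum>n. (C powr s * r powr s * N) * q ^ n) = (C powr s * r powr s * N) * (\<Sum>n. q ^ n)"
            by (rule suminf_mult)
          also have "(\<Sum>n. q ^ n) = 1 / (1 - q)" using q by (intro suminf_geometric) auto
          finally show ?thesis by (simp add: K_def mult_ac)
        qed
        finally show ?thesis .
      qed simp
    qed
    finally show ?thesis .
  qed
  ultimately show thesis by (rule that)
qed

subsection \<open>The lower bound for the dimension and absolute continuity\<close>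

text \<open>All the requirements are strict inequalities at the typical rates, which leaves room for small
  errors.\<close>

lemma exponents_exist:
  assumes X: "mean_ln_lam + mean_ln_Y < 0" and s: "0 < s" "s * - (mean_ln_lam + mean_ln_Y) < S.entropy_rate"
  obtains b g1 g2 c1 c2 :: real where "0 < b" "b < S.entropy_rate" "s * (g1 + g2) < b" "- g1 < mean_ln_lam" "- g2 < mean_ln_Y"
    "mean_ln_lam < c1" "mean_ln_Y < c2" "c1 + c2 < 0"
proof -
  define X where "X = - (mean_ln_lam + mean_ln_Y)"
  have X: "0 < X" "s * X < S.entropy_rate" using assms by (auto simp: X_def)
  obtain b where b: "s * X < b" "b < S.entropy_rate" using X dense by blast
  define \<delta> where "\<delta> = (b - s * X) / (2 * s)"
  have \<delta>: "0 < \<delta>" "s * \<delta> < b - s * X" using b s by (auto simp: \<delta>_def field_simps)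
  have "0 < s * X" using s X by simp
  show thesis
  proof (rule that[of b "\<delta> / 2 - mean_ln_lam" "\<delta> / 2 - mean_ln_Y" "mean_ln_lam + X / 4" "mean_ln_Y + X / 4"])
    have "\<delta> / 2 - mean_ln_lam + (\<delta> / 2 - mean_ln_Y) = \<delta> + X" by (simp add: X_def)
    then show "s * (\<delta> / 2 - mean_ln_lam + (\<delta> / 2 - mean_ln_Y)) < b" using \<delta> by (simp add: distrib_left)
    show "0 < b" using b \<open>0 < s * X\<close> by linarith
    have "mean_ln_lam + X / 4 + (mean_ln_Y + X / 4) = - X / 2" by (simp add: X_def field_simps)
    then show "mean_ln_lam + X / 4 + (mean_ln_Y + X / 4) < 0" using X by simp
  qed (use b \<delta> X in auto)
qed

lemma measure_projected_ball:
  "emeasure (\<nu> y) (ball x r) = emeasure \<mu> {j \<in> space \<mu>. \<bar>x - proj j y\<bar> < r}"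
  unfolding projected_measure_def
  by (subst emeasure_distr[OF natural_projection_measurable[OF sets_\<mu>]])
     (auto intro!: arg_cong[where f="emeasure \<mu>"] simp: dist_real_def)

text \<open>Integrating the weighted sum over all dyadic scales shows that almost every point has finite
  weighted sum, hence local dimension at least \<open>t\<close>.\<close>

lemma projected_measure_dim_ge:
  assumes neg: "mean_ln_lam + mean_ln_Y < 0" and s: "0 < s" "s \<le> 1" "s * - (mean_ln_lam + mean_ln_Y) < S.entropy_rate"
    and t: "0 < t" "t < s"
  shows "AE y in eta_inf. ereal t \<le> measure_hausdorff_dim (\<nu> y)"
proof -
  obtain b g1 g2 c1 c2 where b: "0 < b" "b < S.entropy_rate" "s * (g1 + g2) < b" and g: "- g1 < mean_ln_lam" "- g2 < mean_ln_Y"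
    and c: "mean_ln_lam < c1" "mean_ln_Y < c2" "c1 + c2 < 0"
    by (rule exponents_exist[OF neg s(1,3)])
  let ?A = "good_points b g1 c1" and ?B = "good_ys g2 c2"
  let ?E = "\<lambda>k y i. close_mass (1 / 2 ^ k) y i"
  define w where "w k = (2 ^ k) powr t" for k :: nat
  have w: "0 < w k" for k by (simp add: w_def)
  have fin: "AE y in eta_inf. y \<in> ?B N \<longrightarrow> (AE i in \<mu>. i \<in> ?A N \<longrightarrow> (\<Sum>k. ennreal (w k) * ?E k y i) \<noteq> \<infinity>)" for N
  proof -
    obtain K where K: "0 \<le> K" "\<And>r. 0 < r \<Longrightarrow>
      (\<integral>\<^sup>+y. indicator (?B N) y * (\<integral>\<^sup>+i. indicator (?A N) i * close_mass r y i \<partial>\<mu>) \<partial>eta_inf)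
      \<le> ennreal (K * r powr s)"
      by (rule energy_estimate[OF c(3,1) s(1,2) b(3,1), where N=N]) blast
    define \<Phi> where "\<Phi> k y = indicator (?B N) y * (\<integral>\<^sup>+i. indicator (?A N) i * ?E k y i \<partial>\<mu>)" for k y
    have [measurable]: "\<Phi> k \<in> borel_measurable eta_inf" for k
      unfolding \<Phi>_def[abs_def] by measurable
    have "(\<integral>\<^sup>+y. (\<Sum>k. ennreal (w k) * \<Phi> k y) \<partial>eta_inf) = (\<Sum>k. \<integral>\<^sup>+y. ennreal (w k) * \<Phi> k y \<partial>eta_inf)"
      by (rule nn_integral_suminf) measurable
    also have "\<dots> = (\<Sum>k. ennreal (w k) * (\<integral>\<^sup>+y. \<Phi> k y \<partial>eta_inf))"
      by (intro suminf_cong nn_integral_cmult) measurable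
    also have "\<dots> \<le> (\<Sum>k. ennreal (K * (2 powr (t - s)) ^ k))"
    proof (rule suminf_le)
      fix k
      have "ennreal (w k) * (\<integral>\<^sup>+y. \<Phi> k y \<partial>eta_inf) \<le> ennreal (w k) * ennreal (K * (1 / 2 ^ k) powr s)"
        unfolding \<Phi>_def by (intro mult_left_mono K) auto
      also have "\<dots> = ennreal (w k * (K * (1 / 2 ^ k) powr s))"
        using w[of k] K(1) by (subst ennreal_mult[symmetric]) (auto simp: less_imp_le)
      also have "w k * (K * (1 / 2 ^ k) powr s) = K * (2 powr (t - s)) ^ k"
        unfolding w_def by (simp add: powr_diff power_divide powr_divide powr_power powr_realpow[symmetric] powr_powr mult.commute)
      finally show "ennreal (w k) * (\<integral>\<^sup>+y. \<Phi> k y \<partial>eta_inf) \<le> ennreal (K * (2 powr (t - s)) ^ k)" .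
    qed auto
    also have "\<dots> = ennreal (\<Sum>k. K * (2 powr (t - s)) ^ k)"
    proof (rule suminf_ennreal2)
      have "2 powr (t - s) < 2 powr 0" using t by (intro powr_less_mono) auto
      then show "summable (\<lambda>k. K * (2 powr (t - s)) ^ k)" by (intro summable_mult summable_geometric) auto
    qed (use K in auto)
    finally have "(\<integral>\<^sup>+y. (\<Sum>k. ennreal (w k) * \<Phi> k y) \<partial>eta_inf) \<noteq> \<infinity>"
      using ennreal_less_top[of "\<Sum>k. K * (2 powr (t - s)) ^ k"] by (auto simp: top_unique)
    then have "AE y in eta_inf. (\<Sum>k. ennreal (w k) * \<Phi> k y) \<noteq> \<infinity>"
      by (intro nn_integral_PInf_AE) measurable
    then show ?thesis
    proof eventually_elim
      case (elim y)
      show ?case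
      proof
        assume y: "y \<in> ?B N"
        have [measurable]: "(\<lambda>i. ?E k y i) \<in> borel_measurable \<mu>" for k
          using measurable_compose[OF measurable_Pair1' emeasure_near_measurable, of y] by simp
        have "(\<integral>\<^sup>+i. (\<Sum>k. ennreal (w k) * (indicator (?A N) i * ?E k y i)) \<partial>\<mu>)
            = (\<Sum>k. \<integral>\<^sup>+i. ennreal (w k) * (indicator (?A N) i * ?E k y i) \<partial>\<mu>)"
          by (rule nn_integral_suminf) measurable
        also have "\<dots> = (\<Sum>k. ennreal (w k) * \<Phi> k y)"
          unfolding \<Phi>_def using y by (intro suminf_cong) (simp add: nn_integral_cmult)
        finally have "(\<integral>\<^sup>+i. (\<Sum>k. ennreal (w k) * (indicator (?A N) i * ?E k y i)) \<partial>\<mu>) \<noteq> \<infinity>"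
          using elim by simp
        then have "AE i in \<mu>. (\<Sum>k. ennreal (w k) * (indicator (?A N) i * ?E k y i)) \<noteq> \<infinity>"
          by (intro nn_integral_PInf_AE) measurable
        then show "AE i in \<mu>. i \<in> ?A N \<longrightarrow> (\<Sum>k. ennreal (w k) * ?E k y i) \<noteq> \<infinity>"
        proof eventually_elim
          case (elim i)
          show ?case
          proof
            assume "i \<in> ?A N"
            then have "indicator (?A N) i = (1 :: ennreal)" by simp
            with elim show "(\<Sum>k. ennreal (w k) * ?E k y i) \<noteq> \<infinity>" by (simp only: mult_1_left not_False_eq_True)
          qed
        qed
      qed
    qed
  qed
  have "AE y in eta_inf. \<forall>N. y \<in> ?B N \<longrightarrow> (AE i in \<mu>. i \<in> ?A N \<longrightarrow> (\<Sum>k. ennreal (w k) * ?E k y i) \<noteq> \<infinity>)"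
    using fin by (intro AE_all_countable[THEN iffD2] allI)
  with AE_good_ys[OF g(2) c(2)] show ?thesis
  proof eventually_elim
    case (elim y)
    then obtain Ny where Ny: "y \<in> ?B Ny" by blast
    let ?\<nu> = "\<nu> y"
    interpret N: prob_space ?\<nu> by (rule projected_measure_prob)
    have sets_\<nu>: "sets ?\<nu> = sets borel" by (simp add: projected_measure_def)
    have ball: "measure ?\<nu> (ball (proj i y) (1 / 2 ^ k)) = enn2real (?E k y i)" for i k
      by (simp only: measure_def measure_projected_ball)
    have "AE i in \<mu>. \<forall>N. i \<in> ?A (max N Ny) \<longrightarrow> (\<Sum>k. ennreal (w k) * ?E k y i) \<noteq> \<infinity>"
    proof (intro AE_all_countable[THEN iffD2] allI)
      fix N
      have "y \<in> ?B (max N Ny)" using Ny good_ys_mono[of Ny "max N Ny"] by auto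
      then show "AE i in \<mu>. i \<in> ?A (max N Ny) \<longrightarrow> (\<Sum>k. ennreal (w k) * ?E k y i) \<noteq> \<infinity>" using elim(2) by blast
    qed
    then have local: "AE i in \<mu>. \<exists>C::nat. \<forall>k. measure ?\<nu> (ball (proj i y) (1 / 2 ^ k)) \<le> C * (1 / 2 ^ k) powr t"
      using AE_good_points[OF less_imp_le[OF b(1)] b(2) g(1) c(1)]
    proof eventually_elim
      case (elim i)
      then obtain N where "i \<in> ?A N" by blast
      then have "i \<in> ?A (max N Ny)" using good_points_mono[of N "max N Ny"] by auto
      then have "(\<Sum>k. ennreal (w k) * ?E k y i) \<noteq> \<infinity>" using elim by blast
      then obtain z where z: "0 \<le> z" "(\<Sum>k. ennreal (w k) * ?E k y i) = ennreal z"
        by (cases "\<Sum>k. ennreal (w k) * ?E k y i" rule: ennreal_cases) auto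
      obtain C :: nat where C: "z \<le> C" using real_arch_simple by blast
      have "measure ?\<nu> (ball (proj i y) (1 / 2 ^ k)) \<le> C * (1 / 2 ^ k) powr t" for k
      proof -
        define h where "h = (\<lambda>k. ennreal (w k) * ?E k y i)"
        have "h k \<le> suminf h" using sum_le_suminf[of h "{k}"] by simp
        then have "ennreal (w k) * ?E k y i \<le> ennreal z" using z(2) unfolding h_def by simp
        moreover have "?E k y i = ennreal (measure ?\<nu> (ball (proj i y) (1 / 2 ^ k)))"
          by (simp only: measure_projected_ball[symmetric] N.emeasure_eq_measure)
        ultimately have "ennreal (w k * measure ?\<nu> (ball (proj i y) (1 / 2 ^ k))) \<le> ennreal z"
          using w[of k] by (simp add: ennreal_mult less_imp_le)
        then have "w k * measure ?\<nu> (ball (proj i y) (1 / 2 ^ k)) \<le> C" using z(1) C by (simp add: ennreal_le_iff)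
        then have "measure ?\<nu> (ball (proj i y) (1 / 2 ^ k)) \<le> C / w k" using w[of k] by (simp add: field_simps)
        also have "C / w k = C * (1 / 2 ^ k) powr t" by (simp add: w_def powr_divide)
        finally show ?thesis .
      qed
      then show ?case by blast
    qed
    show ?case
    proof (rule measure_hausdorff_dim_ge[OF projected_measure_prob sets_\<nu> t(1)])
      have m: "(\<lambda>x. measure ?\<nu> (ball x r)) \<in> borel_measurable borel" for r
        using measurable_emeasure_ball[OF N.finite_measure_axioms sets_\<nu>, of r] unfolding measure_def by measurable
      have "{x \<in> space borel. \<exists>C::nat. \<forall>k. measure ?\<nu> (ball x (1 / 2 ^ k)) \<le> C * (1 / 2 ^ k) powr t} \<in> sets borel"
        using m by measurable
      then have "(AE x in distr \<mu> borel (\<lambda>i. proj i y). \<exists>C::nat. \<forall>k. measure ?\<nu> (ball x (1 / 2 ^ k)) \<le> C * (1 / 2 ^ k) powr t)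
        \<longleftrightarrow> (AE i in \<mu>. \<exists>C::nat. \<forall>k. measure ?\<nu> (ball (proj i y) (1 / 2 ^ k)) \<le> C * (1 / 2 ^ k) powr t)"
        by (rule AE_distr_iff[OF natural_projection_measurable[OF sets_\<mu>]])
      then show "AE x in ?\<nu>. \<exists>C::nat. \<forall>k. measure ?\<nu> (ball x (1 / 2 ^ k)) \<le> C * (1 / 2 ^ k) powr t"
        using local by (simp only: projected_measure_def)
    qed
  qed
qed

text \<open>With exponent \<open>1\<close>, Fatou's lemma bounds the energies at infinitely many dyadic scales for almost
  every \<open>y\<close>, for the restriction of \<open>\<mu>\<close> to each of the sets \<open>good_points\<close>.\<close>

lemma projected_measure_absolutely_continuous:
  assumes neg: "mean_ln_lam + mean_ln_Y < 0" and h: "- (mean_ln_lam + mean_ln_Y) < S.entropy_rate"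
  shows "AE y in eta_inf. absolutely_continuous lborel (\<nu> y)"
proof -
  obtain b g1 g2 c1 c2 where b: "0 < b" "b < S.entropy_rate" "1 * (g1 + g2) < b" and g: "- g1 < mean_ln_lam" "- g2 < mean_ln_Y"
    and c: "mean_ln_lam < c1" "mean_ln_Y < c2" "c1 + c2 < 0"
    by (rule exponents_exist[OF neg zero_less_one]) (use h in auto)
  let ?A = "good_points b g1 c1" and ?B = "good_ys g2 c2"
  let ?E = "\<lambda>k y i. close_mass (1 / 2 ^ k) y i"
  have ac: "AE y in eta_inf. y \<in> ?B N \<longrightarrow>
      absolutely_continuous lborel (distr (density \<mu> (indicator (?A N))) borel (\<lambda>i. proj i y))" for N
  proof -
    obtain K where K: "0 \<le> K" "\<And>r. 0 < r \<Longrightarrow>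
      (\<integral>\<^sup>+y. indicator (?B N) y * (\<integral>\<^sup>+i. indicator (?A N) i * close_mass r y i \<partial>\<mu>) \<partial>eta_inf)
      \<le> ennreal (K * r powr 1)"
      by (rule energy_estimate[OF c(3,1) zero_less_one order_refl b(3,1), where N=N]) blast
    define \<Phi> where "\<Phi> k y = indicator (?B N) y * (\<integral>\<^sup>+i. indicator (?A N) i * ?E k y i \<partial>\<mu>)" for k y
    have [measurable]: "\<Phi> k \<in> borel_measurable eta_inf" for k
      unfolding \<Phi>_def[abs_def] by measurable
    have le: "(\<integral>\<^sup>+y. ennreal (2 ^ k) * \<Phi> k y \<partial>eta_inf) \<le> ennreal K" for k
    proof -
      have "(\<integral>\<^sup>+y. ennreal (2 ^ k) * \<Phi> k y \<partial>eta_inf) = ennreal (2 ^ k) * (\<integral>\<^sup>+y. \<Phi> k y \<partial>eta_inf)"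
        by (rule nn_integral_cmult) measurable
      also have "\<dots> \<le> ennreal (2 ^ k) * ennreal (K * (1 / 2 ^ k) powr 1)"
        unfolding \<Phi>_def by (intro mult_left_mono K) auto
      also have "\<dots> = ennreal K"
        using K(1) by (subst ennreal_mult[symmetric]) auto
      finally show ?thesis .
    qed
    have "(\<integral>\<^sup>+y. liminf (\<lambda>k. ennreal (2 ^ k) * \<Phi> k y) \<partial>eta_inf) \<le> liminf (\<lambda>k. \<integral>\<^sup>+y. ennreal (2 ^ k) * \<Phi> k y \<partial>eta_inf)"
      by (rule nn_integral_liminf) measurable
    also have "\<dots> \<le> liminf (\<lambda>k::nat. ennreal K)" using le by (intro Liminf_mono always_eventually) auto
    also have "\<dots> = ennreal K" by (rule Liminf_const) simp
    finally have "(\<integral>\<^sup>+y. liminf (\<lambda>k. ennreal (2 ^ k) * \<Phi> k y) \<partial>eta_inf) \<noteq> \<infinity>"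
      using ennreal_less_top[of K] by (auto simp: top_unique)
    then have "AE y in eta_inf. liminf (\<lambda>k. ennreal (2 ^ k) * \<Phi> k y) \<noteq> \<infinity>"
      by (intro nn_integral_PInf_AE) measurable
    then show ?thesis
    proof eventually_elim
      case (elim y)
      show ?case
      proof
        assume y: "y \<in> ?B N"
        let ?M = "density \<mu> (indicator (?A N))"
        let ?\<nu> = "distr ?M borel (\<lambda>i. proj i y)"
        have p: "(\<lambda>i. proj i y) \<in> borel_measurable \<mu>" by (rule natural_projection_measurable[OF sets_\<mu>])
        have pM: "(\<lambda>i. proj i y) \<in> borel_measurable ?M" using p by simp
        have em: "emeasure ?\<nu> S \<le> emeasure \<mu> ((\<lambda>i. proj i y) -` S \<inter> space \<mu>)" if S: "S \<in> sets borel" for S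
        proof -
          have "emeasure ?\<nu> S = emeasure ?M ((\<lambda>i. proj i y) -` S \<inter> space \<mu>)"
            using emeasure_distr[OF pM S] by simp
          also have "\<dots> = (\<integral>\<^sup>+i. indicator (?A N) i * indicator ((\<lambda>i. proj i y) -` S \<inter> space \<mu>) i \<partial>\<mu>)"
            by (intro emeasure_density borel_measurable_indicator good_points_sets measurable_sets[OF p S])
          also have "\<dots> \<le> (\<integral>\<^sup>+i. indicator ((\<lambda>i. proj i y) -` S \<inter> space \<mu>) i \<partial>\<mu>)"
            by (intro nn_integral_mono) (auto simp: indicator_def)
          also have "\<dots> = emeasure \<mu> ((\<lambda>i. proj i y) -` S \<inter> space \<mu>)"
            by (rule nn_integral_indicator[OF measurable_sets[OF p S]])
          finally show ?thesis .
        qed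
        have fin: "finite_measure ?\<nu>"
        proof (rule finite_measureI)
          have "emeasure ?\<nu> UNIV \<le> emeasure \<mu> (space \<mu>)" using em[of UNIV] by simp
          then show "emeasure ?\<nu> (space ?\<nu>) \<noteq> \<infinity>" using S.emeasure_space_1 by (auto simp: top_unique)
        qed
        have sets_\<nu>: "sets ?\<nu> = sets borel" by simp
        obtain K' where K': "0 \<le> K'" "liminf (\<lambda>k. ennreal (2 ^ k) * \<Phi> k y) < ennreal K'"
        proof -
          obtain z where z: "0 \<le> z" "liminf (\<lambda>k. ennreal (2 ^ k) * \<Phi> k y) = ennreal z"
            using elim by (metis ennreal_cases infinity_ennreal_def)
          show thesis by (rule that[of "z + 1"]) (use z in \<open>auto simp: ennreal_less_iff\<close>)
        qed
        have freq: "\<exists>\<^sub>F k in sequentially. ennreal (2 ^ k) * \<Phi> k y < ennreal K'"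
        proof (rule ccontr)
          assume "\<not> ?thesis"
          then have "\<forall>\<^sub>F k in sequentially. ennreal K' \<le> ennreal (2 ^ k) * \<Phi> k y"
            by (simp add: not_frequently not_less)
          then have "ennreal K' \<le> liminf (\<lambda>k. ennreal (2 ^ k) * \<Phi> k y)" by (rule Liminf_bounded)
          then show False using K' by simp
        qed
        show "absolutely_continuous lborel ?\<nu>"
        proof (rule absolutely_continuous_of_energy[OF fin sets_\<nu> K'(1)], rule frequently_mono[OF _ freq], intro allI impI)
          fix k :: nat assume k: "ennreal (2 ^ k) * \<Phi> k y < ennreal K'"
          have "(\<integral>\<^sup>+u. emeasure ?\<nu> (ball u (1 / 2 ^ k)) \<partial>?\<nu>) = (\<integral>\<^sup>+i. emeasure ?\<nu> (ball (proj i y) (1 / 2 ^ k)) \<partial>?M)"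
            using measurable_emeasure_ball[OF fin sets_\<nu>, of "1 / 2 ^ k"] by (intro nn_integral_distr[OF pM]) simp
          also have "\<dots> = (\<integral>\<^sup>+i. indicator (?A N) i * emeasure ?\<nu> (ball (proj i y) (1 / 2 ^ k)) \<partial>\<mu>)"
            using measurable_compose[OF p measurable_emeasure_ball[OF fin sets_\<nu>, of "1 / 2 ^ k"]]
            by (intro nn_integral_density) measurable
          also have "\<dots> \<le> (\<integral>\<^sup>+i. indicator (?A N) i * ?E k y i \<partial>\<mu>)"
          proof (intro nn_integral_mono mult_left_mono)
            fix i
            have "emeasure ?\<nu> (ball (proj i y) (1 / 2 ^ k)) \<le> emeasure \<mu> ((\<lambda>i. proj i y) -` ball (proj i y) (1 / 2 ^ k) \<inter> space \<mu>)"
              by (rule em) simp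
            also have "(\<lambda>i. proj i y) -` ball (proj i y) (1 / 2 ^ k) \<inter> space \<mu> = {j \<in> space \<mu>. \<bar>proj i y - proj j y\<bar> < 1 / 2 ^ k}"
              by (auto simp: dist_real_def)
            finally show "emeasure ?\<nu> (ball (proj i y) (1 / 2 ^ k)) \<le> ?E k y i" .
          qed simp
          also have "\<dots> = \<Phi> k y" using y by (simp add: \<Phi>_def)
          also have "\<Phi> k y = ennreal (1 / 2 ^ k) * (ennreal (2 ^ k) * \<Phi> k y)"
            by (simp add: mult.assoc[symmetric] ennreal_mult[symmetric])
          also have "\<dots> \<le> ennreal (1 / 2 ^ k) * ennreal K'" using k by (intro mult_left_mono) auto
          also have "\<dots> = ennreal (K' * (1 / 2 ^ k))" using K'(1) by (subst ennreal_mult[symmetric]) auto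
          finally show "(\<integral>\<^sup>+u. emeasure ?\<nu> (ball u (1 / 2 ^ k)) \<partial>?\<nu>) \<le> ennreal (K' * (1 / 2 ^ k))" .
        qed
      qed
    qed
  qed
  have "AE y in eta_inf. \<forall>N. y \<in> ?B N \<longrightarrow>
      absolutely_continuous lborel (distr (density \<mu> (indicator (?A N))) borel (\<lambda>i. proj i y))"
    using ac by (intro AE_all_countable[THEN iffD2] allI)
  with AE_good_ys[OF g(2) c(2)] show ?thesis
  proof eventually_elim
    case (elim y)
    then obtain Ny where Ny: "y \<in> ?B Ny" by blast
    have p: "(\<lambda>i. proj i y) \<in> borel_measurable \<mu>" by (rule natural_projection_measurable[OF sets_\<mu>])
    show ?case
      unfolding absolutely_continuous_def
    proof
      fix X :: "real set" assume X: "X \<in> null_sets lborel"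
      then have Xb: "X \<in> sets borel" by auto
      have "AE i in \<mu>. \<forall>N. i \<in> ?A (max N Ny) \<longrightarrow> proj i y \<notin> X"
      proof (intro AE_all_countable[THEN iffD2] allI)
        fix N
        let ?M = "density \<mu> (indicator (?A (max N Ny)))"
        have "y \<in> ?B (max N Ny)" using Ny good_ys_mono[of Ny "max N Ny"] by auto
        then have "X \<in> null_sets (distr ?M borel (\<lambda>i. proj i y))"
          using elim(2) X unfolding absolutely_continuous_def by blast
        then have "AE x in distr ?M borel (\<lambda>i. proj i y). x \<notin> X" by (rule AE_not_in)
        then have "AE i in ?M. proj i y \<notin> X"
          by (rule AE_distrD[rotated]) (use p in simp)
        then show "AE i in \<mu>. i \<in> ?A (max N Ny) \<longrightarrow> proj i y \<notin> X"
          by (subst (asm) AE_density) (auto simp: indicator_def elim: eventually_mono)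
      qed
      then have "AE i in \<mu>. proj i y \<notin> X"
        using AE_good_points[OF less_imp_le[OF b(1)] b(2) g(1) c(1)]
      proof eventually_elim
        case (elim i)
        then obtain N where "i \<in> ?A N" by blast
        then have "i \<in> ?A (max N Ny)" using good_points_mono[of N "max N Ny"] by auto
        then show ?case using elim by blast
      qed
      then have "AE x in \<nu> y. x \<notin> X"
        unfolding projected_measure_def using Xb by (subst AE_distr_iff[OF p]) auto
      moreover have "X \<in> sets (\<nu> y)" using Xb by (simp add: projected_measure_def)
      ultimately show "X \<in> null_sets (\<nu> y)"
        using AE_iff_null_sets by blast
    qed
  qed
qed

lemma projected_measure_dim_eq:
  assumes neg: "mean_ln_lam + mean_ln_Y < 0" and h: "S.entropy_rate \<le> - (mean_ln_lam + mean_ln_Y)"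
  shows "AE y in eta_inf. measure_hausdorff_dim (\<nu> y)
    = ereal (S.entropy_rate / - (mean_ln_lam + mean_ln_Y))"
proof -
  define X where "X = - (mean_ln_lam + mean_ln_Y)"
  define a where "a = S.entropy_rate / X"
  have X: "0 < X" using neg by (simp add: X_def)
  have hX: "S.entropy_rate = a * X" using X by (simp add: a_def)
  have "S.entropy_rate \<le> X" using h unfolding X_def .
  then have a: "0 \<le> a" "a \<le> 1" using X S.entropy_rate_nonneg by (auto simp: a_def)
  have "AE y in eta_inf. measure_hausdorff_dim (\<nu> y) \<le> ereal (a + 1 / real (Suc n))" for n
  proof (rule projected_measure_dim_le[OF neg])
    show "S.entropy_rate < (a + 1 / real (Suc n)) * - (mean_ln_lam + mean_ln_Y)"
      unfolding X_def[symmetric] hX using X by (simp add: field_simps)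
  qed
  then have upper: "AE y in eta_inf. \<forall>n. measure_hausdorff_dim (\<nu> y) \<le> ereal (a + 1 / real (Suc n))"
    by (intro AE_all_countable[THEN iffD2] allI)
  have "AE y in eta_inf. ereal (a * (1 - 1 / real (n + 2))) \<le> measure_hausdorff_dim (\<nu> y)" for n
  proof (cases "a = 0")
    case True
    then have eq: "ereal (a * (1 - 1 / real (n + 2))) = 0" by simp
    show ?thesis unfolding eq by (intro AE_I2 measure_hausdorff_dim_nonneg)
  next
    case False
    then have a0: "0 < a" using a by simp
    let ?s = "a * (1 - 1 / real (n + 3))"
    have lt: "1 / real (n + 3) < 1 / real (n + 2)" "1 / real (n + 2) < 1" "0 < 1 / real (n + 3)" by (auto simp: field_simps)
    show ?thesis
    proof (rule projected_measure_dim_ge[OF neg, of ?s])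
      show "0 < ?s" using a0 lt by simp
      show "a * (1 - 1 / real (n + 2)) < ?s" using a0 lt by (intro mult_strict_left_mono) auto
      show "0 < a * (1 - 1 / real (n + 2))" using a0 lt by simp
      have "?s \<le> a * 1" using a0 lt by (intro mult_left_mono) auto
      then show "?s \<le> 1" using a by simp
      have "?s < a * 1" using a0 lt by (intro mult_strict_left_mono) auto
      then show "?s * - (mean_ln_lam + mean_ln_Y) < S.entropy_rate"
        unfolding X_def[symmetric] hX using X by (intro mult_strict_right_mono) auto
    qed
  qed
  then have lower: "AE y in eta_inf. \<forall>n. ereal (a * (1 - 1 / real (n + 2))) \<le> measure_hausdorff_dim (\<nu> y)"
    by (intro AE_all_countable[THEN iffD2] allI)
  show ?thesis
    using upper lower unfolding X_def[symmetric] a_def[symmetric]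
  proof eventually_elim
    case (elim y)
    let ?D = "measure_hausdorff_dim (\<nu> y)"
    have "?D \<le> ereal a"
    proof (rule LIMSEQ_le_const)
      have "(\<lambda>n. a + 1 / real (Suc n)) \<longlonglongrightarrow> a" by real_asymp
      then show "(\<lambda>n. ereal (a + 1 / real (Suc n))) \<longlonglongrightarrow> ereal a" by simp
    qed (use elim(1) in blast)
    moreover have "ereal a \<le> ?D"
    proof (rule LIMSEQ_le_const2)
      have "(\<lambda>n. a * (1 - 1 / real (n + 2))) \<longlonglongrightarrow> a" by real_asymp
      then show "(\<lambda>n. ereal (a * (1 - 1 / real (n + 2)))) \<longlonglongrightarrow> ereal a" by simp
    qed (use elim(2) in blast)
    ultimately show ?case by (rule antisym)
  qed
qed

end

theorem theorem2p1:
  fixes \<Omega> :: "'w measure" and Y :: "'w \<Rightarrow> real" and f :: "real \<Rightarrow> ennreal" and C1 :: real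
    and m :: nat and d lam :: "nat \<Rightarrow> real" and \<mu> :: "(nat \<Rightarrow> nat) measure"
  defines "\<eta> \<equiv> distr \<Omega> borel Y"
  defines "eta_inf \<equiv> (\<Pi>\<^sub>M n\<in>(UNIV :: nat set). \<eta>)"
  defines "chi \<equiv> lyapunov_exponent \<Omega> Y lam \<mu>"
  defines "h \<equiv> ks_entropy \<mu> shift"
  defines "\<nu> \<equiv> projected_measure d lam \<mu>"
  assumes "prob_space \<Omega>"
    and "\<And>\<omega>. \<omega> \<in> space \<Omega> \<Longrightarrow> 0 < Y \<omega>"
    and "distributed \<Omega> lborel Y f"
    and "0 < C1"
    and "\<And>x. 0 < x \<Longrightarrow> f x \<le> ennreal (C1 / x)"
    and "integrable \<Omega> (\<lambda>\<omega>. ln (Y \<omega>))"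
    and "\<And>j. j \<in> {1..m} \<Longrightarrow> 0 < lam j"
    and "prob_space \<mu>"
    and "sets \<mu> = sets (symbolic_space m)"
    and "ergodic \<mu> shift"
    and "chi < 0"
    and "inj_on d {1..m} \<or> ((\<forall>j\<in>{1..m}. d j = 1) \<and> inj_on lam {1..m})"
  shows "(h > ereal \<bar>chi\<bar> \<longrightarrow> (AE y in eta_inf. absolutely_continuous lborel (\<nu> y))) \<and>
         (h \<le> ereal \<bar>chi\<bar> \<longrightarrow> (AE y in eta_inf. measure_hausdorff_dim (\<nu> y) = h / ereal \<bar>chi\<bar>))"
proof -
  interpret R: random_ifs \<Omega> Y f C1 m d lam \<mu>
    by (rule random_ifs.intro[OF assms(6-15,17)])
  have eta: "eta_inf = R.eta_inf"
    by (simp only: eta_inf_def \<eta>_def R.eta_inf_def R.\<eta>_def)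
  have chi: "chi = R.mean_ln_lam + R.mean_ln_Y"
    by (simp add: chi_def lyapunov_exponent_def R.mean_ln_lam_def R.mean_ln_Y_def)
  have h: "h = ereal R.S.entropy_rate" unfolding h_def by (rule R.ks_entropy_eq)
  have neg: "R.mean_ln_lam + R.mean_ln_Y < 0" using \<open>chi < 0\<close> by (simp add: chi)
  have abs: "\<bar>chi\<bar> = - (R.mean_ln_lam + R.mean_ln_Y)" using neg by (simp add: chi)
  show ?thesis
    unfolding h abs eta \<nu>_def
    using R.projected_measure_absolutely_continuous[OF neg] R.projected_measure_dim_eq[OF neg] neg
    by (auto simp: ereal_divide)
qed

end
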